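(* Consider $$(E_3)\qquad y'''+(a_2+r_2(t))y''+(a_1+r_1(t))y'+(a_0+r_0(t))y=0,\qquad t\in\mathbb{R},$$ with $a_0,a_1,a_2\in\mathbb{C}$, and suppose that the roots $\lambda,\lambda_1,\lambda_2$ of $x^3+a_2x^2+a_1x+a_0$ have distinct real parts. Let $r_i=\mu_i+\nu_i\in\mathcal{AAP}(\mathbb{R})$ (resp. $\mathcal{AAP}_0(\mathbb{R})$, $\mathcal{AP}(\mathbb{R},\mathbb{C},p)$ or $\mathcal{AP}_0(\mathbb{R},\mathbb{C},p)$, $p\ge1$) with $\mu_i\in\mathcal{AP}(\mathbb{R})$ and $\nu_i\in BC_0(\mathbb{R})$ (resp. $C_{00}(\mathbb{R})$, $L^p_0$ or $L^p(\mathbb{R})$), $i=0,1,2$. Assume that there is a solution $\theta\in\mathcal{AP}(\mathbb{R})$ of $$\theta=-G\big[\lambda^2\mu_2+\lambda\mu_1+\mu_0+(2\lambda\mu_2+\mu_1)\theta+\mu_2\theta'+(3\lambda+a_2+\mu_2)\theta^2+3\theta\theta'+\theta^3\big],$$ such that, with the notation of the context, $L_{0,\theta}<1$ and $$\|G[P_\nu(\theta;\lambda)]\|_\infty+\|G[P_\nu(\theta;\lambda)]'\|_\infty\le M_\theta\Big[\tfrac23(1-L_{0,\theta})-Q_{0,\theta}M_\theta\Big].$$ Then there exists a solution $y$ of $(E_3)$ satisfying $$\begin{aligned}y(t)=\ &e^{\lambda t}\exp\Big(-\gamma_1^{-1}\gamma_2^{-1}\int_0^t\big[P(r(s);\lambda)+\mathcal{L}(s,z(s))+\mathcal{F}(s,z(s),z'(s))\big]ds\Big)\\&\times\exp\Big(-\sum_{j=1}^2\frac1{\Gamma_j\gamma_j}G_{\gamma_j}\big[P(r;\lambda)+\mathcal{L}(\cdot,z)+\mathcal{F}(\cdot,z,z')\big](t)\Big),\end{aligned}$$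 where $z=\theta+\psi$ is a solution of the integral equation $$z=-G\big[\lambda^2r_2+\lambda r_1+r_0+(2\lambda r_2+r_1)z+r_2z'+(3\lambda+a_2+r_2)z^2+3zz'+z^3\big],$$ $z,z'\in\mathcal{AAP}(\mathbb{R})$ (resp. $\mathcal{AAP}_0(\mathbb{R})$, $\mathcal{AP}(\mathbb{R},\mathbb{C},p)$ or $\mathcal{AP}_0(\mathbb{R},\mathbb{C},p)$), and $\psi\in BC_0^1(\mathbb{R})$ (resp. $C_{00}^1(\mathbb{R})$, $L_0^p$ or $L^p(\mathbb{R})$) satisfies the integral equation $$\psi=-G\big[P_\nu(\theta;\lambda)+r_\theta\psi+(r_2+\theta)\psi'+(3\lambda+3\theta+a_2+r_2)\psi^2+3\psi\psi'+\psi^3\big].$$ In addition, if there exists a constant $0<\beta<\min\{|\alpha_1|,|\alpha_2|\}$ such that $L_{\beta,\theta}<\frac12$, then $\psi,\psi'=O\big((I_\beta+I_{-\beta})[P_\nu(\theta;\lambda)]\big)$.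
   Context: All functions map $\mathbb{R}$ to $\mathbb{C}$. $\mathcal{AP}(\mathbb{R})$: continuous $r$ such that every real sequence $\{b_k\}$ has a subsequence $\{\tilde b_m\}$ for which $\lim_mr(t+\tilde b_m)$ exists uniformly in $t\in\mathbb{R}$. $BC(\mathbb{R})$: bounded continuous functions; $BC_0(\mathbb{R})$: $f\in BC(\mathbb{R})$ with $f(t)\to0$ as $t\to+\infty$; $C_{00}(\mathbb{R})$: $f\in BC_0(\mathbb{R})$ with also $f(t)\to0$ as $t\to-\infty$; $BC_0^1$, $C_{00}^1$: functions $f$ with $f,f'$ in $BC_0$, resp. $C_{00}$. $L^p_0$: functions $f:\mathbb{R}\to\mathbb{C}$ bounded on $(-\infty,0]$ with $\int_0^\infty|f|^p<\infty$. A bounded continuous function $f$ belongs to $\mathcal{AAP}(\mathbb{R})$ (resp. $\mathcal{AAP}_0(\mathbb{R})$, $\mathcal{AP}(\mathbb{R},\mathbb{C},p)$, $\mathcal{AP}_0(\mathbb{R},\mathbb{C},p)$) if $f=\phi+g$ with $\phi\in\mathcal{AP}(\mathbb{R})$ and $g\in BC_0(\mathbb{R})$ (resp. $C_{00}(\mathbb{R})$, $L^p_0$, $L^p(\mathbb{R})$). $\|\cdot\|_\infty$ is the supremum norm on $\mathbb{R}$; $f=O(h)$ ($h\ge0$) means $|f(t)|\le C\,h(t)$ for all $t\in\mathbb{R}$, for some constant $C$. Green operators: for $\omega\in\mathbb{C}$, $\Re\omega\ne0$, $g_\omega(t,s)=-\mathrm{sgn}(\Re\omega)e^{\omega(t-s)}$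 if $\mathrm{sgn}(\Re\omega)(t-s)<0$ and $0$ otherwise; $G_\omega[f](t)=\int_{-\infty}^\infty g_\omega(t,s)f(s)ds$, $I_\omega[f](t)=\int_{-\infty}^\infty|g_\omega(t,s)f(s)|ds$. For $i=1,2$: $\gamma_i=\lambda_i-\lambda$, $\alpha_i=\Re\gamma_i$, $\Gamma_i=(-1)^i(\lambda_2-\lambda_1)$; $G[f]=\frac1{\Gamma_1}G_{\gamma_1}[f]+\frac1{\Gamma_2}G_{\gamma_2}[f]$. $P(r(t);\lambda)=\lambda^2r_2(t)+\lambda r_1(t)+r_0(t)$, $\mathcal{L}(t,z)=r_2(t)z'+(2\lambda r_2(t)+r_1(t))z$, $\mathcal{F}(t,z,z')=(a_2+r_2(t)+3\lambda)z^2+3zz'+z^3$. Given $\theta$: $P_\nu(\theta;\lambda)=\lambda^2\nu_2+\lambda\nu_1+\nu_0+(2\lambda\nu_2+\nu_1)\theta+\nu_2\theta'+\nu_2\theta^2$, $r_\theta=2\lambda r_2+r_1+2(3\lambda+a_2+r_2)\theta+3\theta^2+3\theta'$, and for $0\le\beta<\min\{|\alpha_1|,|\alpha_2|\}$ $$L_{\beta,\theta}=\sum_{i=1}^2\frac{1+|\gamma_i|}{|\lambda_1-\lambda_2|}\Big[\big\|I_{\alpha_i-\mathrm{sgn}(\alpha_i)\beta}[r_\theta]\big\|_\infty+\big\|I_{\alpha_i-\mathrm{sgn}(\alpha_i)\beta}[r_2+\theta]\big\|_\infty\Big],$$ $$Q_{\beta,\theta}=\sum_{i=1}^2\frac{1+|\gamma_i|}{|\lambda_1-\lambda_2|}\Big[\frac{1+3|\lambda|+|a_2|}{|\alpha_i-\mathrm{sgn}(\alpha_i)\beta|}+\big\|I_{\alpha_i-\mathrm{sgn}(\alpha_i)\beta}[r_2+3\theta]\big\|_\infty\Big].$$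 When $L_{0,\theta}<1$, $M_\theta=\frac13\Big(\sqrt{1+\frac{1-L_{0,\theta}}{Q_{0,\theta}}}-1\Big)$.
   Formalization: The printed coefficient r_2+θ is corrected to r_2+3θ, both as the coefficient of ψ' in the integral equation for ψ and in the definition of L_{β,θ} (hence also in M_θ); as printed, the claim fails, e.g. for θ a small nonzero constant with r_1=r_2=0 and ν_0 a tiny bump. *)

theory Defs
  imports "HOL-Analysis.Analysis"
begin

section \<open>Function spaces\<close>

abbreviation D :: "(real \<Rightarrow> complex) \<Rightarrow> real \<Rightarrow> complex" where
  "D f \<equiv> \<lambda>t. vector_derivative f (at t)"

definition AP :: "(real \<Rightarrow> complex) set" where
  "AP = {f. continuous_on UNIV f \<and>
     (\<forall>b :: nat \<Rightarrow> real. \<exists>\<sigma> :: nat \<Rightarrow> nat. strict_mono \<sigma> \<and>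
        (\<exists>l. uniform_limit UNIV (\<lambda>m t. f (t + b (\<sigma> m))) l sequentially))}"

definition BC :: "(real \<Rightarrow> complex) set" where
  "BC = {f. continuous_on UNIV f \<and> bounded (range f)}"

definition BC0 :: "(real \<Rightarrow> complex) set" where
  "BC0 = {f \<in> BC. (f \<longlongrightarrow> 0) at_top}"

definition C00 :: "(real \<Rightarrow> complex) set" where
  "C00 = {f \<in> BC0. (f \<longlongrightarrow> 0) at_bot}"

definition with_deriv :: "(real \<Rightarrow> complex) set \<Rightarrow> (real \<Rightarrow> complex) set" where
  "with_deriv N = {f \<in> N. (\<forall>t. f differentiable (at t)) \<and> D f \<in> N}"

definition Lp :: "real \<Rightarrow> (real \<Rightarrow> complex) set" where
  "Lp p = {f \<in> borel_measurable borel. integrable lborel (\<lambda>t. norm (f t) powr p)}"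

definition Lp0 :: "real \<Rightarrow> (real \<Rightarrow> complex) set" where
  "Lp0 p = {f \<in> borel_measurable borel. bounded (f ` {..0}) \<and>
              set_integrable lborel {0..} (\<lambda>t. norm (f t) powr p)}"

text \<open>Bounded continuous functions that are almost periodic up to a perturbation in \<open>N\<close>.
  For \<open>N\<close> equal to \<open>BC0\<close>, \<open>C00\<close>, \<open>Lp0 p\<close>, \<open>Lp p\<close> these are the classes
  \<open>AAP(\<real>)\<close>, \<open>AAP\<^sub>0(\<real>)\<close>, \<open>AP(\<real>,\<complex>,p)\<close>, \<open>AP\<^sub>0(\<real>,\<complex>,p)\<close>.\<close>

definition AP_plus :: "(real \<Rightarrow> complex) set \<Rightarrow> (real \<Rightarrow> complex) set" where
  "AP_plus N = {f \<in> BC. \<exists>\<phi>\<in>AP. \<exists>g\<in>N. f = (\<lambda>t. \<phi> t + g t)}"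

text \<open>Extended-real valued, so that no boundedness is presupposed.\<close>

definition supnorm :: "(real \<Rightarrow> complex) \<Rightarrow> ennreal" where
  "supnorm f = (SUP t. ennreal (norm (f t)))"

definition dominated_by :: "(real \<Rightarrow> complex) \<Rightarrow> (real \<Rightarrow> ennreal) \<Rightarrow> bool" where
  "dominated_by f h \<longleftrightarrow> (\<exists>C::real. \<forall>t. ennreal (norm (f t)) \<le> ennreal C * h t)"

section \<open>Green operators\<close>

definition green :: "complex \<Rightarrow> real \<Rightarrow> real \<Rightarrow> complex" where
  "green \<omega> t s = (if sgn (Re \<omega>) * (t - s) < 0
     then - of_real (sgn (Re \<omega>)) * exp (\<omega> * of_real (t - s)) else 0)"

definition Gop :: "complex \<Rightarrow> (real \<Rightarrow> complex) \<Rightarrow> real \<Rightarrow> complex" where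
  "Gop \<omega> f t = (LINT s|lborel. green \<omega> t s * f s)"

definition Iop :: "complex \<Rightarrow> (real \<Rightarrow> complex) \<Rightarrow> real \<Rightarrow> ennreal" where
  "Iop \<omega> f t = (\<integral>\<^sup>+s. ennreal (norm (green \<omega> t s * f s)) \<partial>lborel)"

text \<open>The three characteristic roots are \<open>lam 0\<close> (the root \<open>\<lambda>\<close> singled out),
  \<open>lam 1\<close> and \<open>lam 2\<close>; likewise \<open>a\<close>, \<open>r\<close>, \<open>\<mu>\<close>, \<open>\<nu>\<close> below are only used
  at the indices \<open>0\<close>, \<open>1\<close>, \<open>2\<close>.\<close>

definition gam :: "(nat \<Rightarrow> complex) \<Rightarrow> nat \<Rightarrow> complex" where
  "gam lam i = lam i - lam 0"

definition alph :: "(nat \<Rightarrow> complex) \<Rightarrow> nat \<Rightarrow> real" where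
  "alph lam i = Re (gam lam i)"

definition Gam :: "(nat \<Rightarrow> complex) \<Rightarrow> nat \<Rightarrow> complex" where
  "Gam lam i = (-1) ^ i * (lam 2 - lam 1)"

definition G :: "(nat \<Rightarrow> complex) \<Rightarrow> (real \<Rightarrow> complex) \<Rightarrow> real \<Rightarrow> complex" where
  "G lam f t = (\<Sum>i\<in>{1,2}. 1 / Gam lam i * Gop (gam lam i) f t)"

text \<open>The function \<open>z\<close> solves \<open>z = -G[N(z)]\<close>, where \<open>N\<close> may involve \<open>z'\<close>.  The first two
  conditions say that both sides are meaningful (the Bochner integral is \<open>0\<close> by convention on
  non-integrable functions).\<close>

definition solves_integral_eq ::
    "(nat \<Rightarrow> complex) \<Rightarrow> ((real \<Rightarrow> complex) \<Rightarrow> real \<Rightarrow> complex) \<Rightarrow> (real \<Rightarrow> complex) \<Rightarrow> bool" where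
  "solves_integral_eq lam N z \<longleftrightarrow>
     (\<forall>t. z differentiable (at t)) \<and>
     (\<forall>i\<in>{1,2}. \<forall>t. integrable lborel (\<lambda>s. green (gam lam i) t s * N z s)) \<and>
     (\<forall>t. z t = - G lam (N z) t)"

section \<open>The differential equation and its nonlinear reduction\<close>

definition solves_E3 ::
    "(nat \<Rightarrow> complex) \<Rightarrow> (nat \<Rightarrow> real \<Rightarrow> complex) \<Rightarrow> (real \<Rightarrow> complex) \<Rightarrow> bool" where
  "solves_E3 a r y \<longleftrightarrow>
     (\<forall>t. y differentiable (at t) \<and> D y differentiable (at t) \<and> D (D y) differentiable (at t)) \<and>
     (\<forall>t. D (D (D y)) t + (a 2 + r 2 t) * D (D y) t + (a 1 + r 1 t) * D y t
            + (a 0 + r 0 t) * y t = 0)"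

definition P :: "(nat \<Rightarrow> complex) \<Rightarrow> (nat \<Rightarrow> real \<Rightarrow> complex) \<Rightarrow> real \<Rightarrow> complex" where
  "P lam r t = (lam 0)\<^sup>2 * r 2 t + lam 0 * r 1 t + r 0 t"

definition Lterm ::
    "(nat \<Rightarrow> complex) \<Rightarrow> (nat \<Rightarrow> real \<Rightarrow> complex) \<Rightarrow> (real \<Rightarrow> complex) \<Rightarrow> real \<Rightarrow> complex" where
  "Lterm lam r z t = r 2 t * D z t + (2 * lam 0 * r 2 t + r 1 t) * z t"

definition Fterm :: "(nat \<Rightarrow> complex) \<Rightarrow> (nat \<Rightarrow> complex) \<Rightarrow> (nat \<Rightarrow> real \<Rightarrow> complex) \<Rightarrow>
    (real \<Rightarrow> complex) \<Rightarrow> real \<Rightarrow> complex" where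
  "Fterm a lam r z t =
     (a 2 + r 2 t + 3 * lam 0) * (z t)\<^sup>2 + 3 * z t * D z t + (z t) ^ 3"

text \<open>\<open>P(r;\<lambda>) + L(\<cdot>,z) + F(\<cdot>,z,z')\<close>.  Expanded, this is \<open>\<lambda>\<^sup>2r\<^sub>2 + \<lambda>r\<^sub>1 + r\<^sub>0 + (2\<lambda>r\<^sub>2 + r\<^sub>1)z + r\<^sub>2z'
  + (3\<lambda> + a\<^sub>2 + r\<^sub>2)z\<^sup>2 + 3zz' + z\<^sup>3\<close>, the integrand of the integral equation for \<open>z\<close>;
  with \<open>\<mu>\<close> in place of \<open>r\<close> it is the integrand of the integral equation for \<open>\<theta>\<close>.\<close>

definition PLF :: "(nat \<Rightarrow> complex) \<Rightarrow> (nat \<Rightarrow> complex) \<Rightarrow> (nat \<Rightarrow> real \<Rightarrow> complex) \<Rightarrow>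
    (real \<Rightarrow> complex) \<Rightarrow> real \<Rightarrow> complex" where
  "PLF a lam r z t = P lam r t + Lterm lam r z t + Fterm a lam r z t"

definition P\<theta> ::
    "(nat \<Rightarrow> complex) \<Rightarrow> (nat \<Rightarrow> real \<Rightarrow> complex) \<Rightarrow> (real \<Rightarrow> complex) \<Rightarrow> real \<Rightarrow> complex" where
  "P\<theta> lam \<nu> \<theta> t = (lam 0)\<^sup>2 * \<nu> 2 t + lam 0 * \<nu> 1 t + \<nu> 0 t
     + (2 * lam 0 * \<nu> 2 t + \<nu> 1 t) * \<theta> t + \<nu> 2 t * D \<theta> t + \<nu> 2 t * (\<theta> t)\<^sup>2"

definition r\<theta> :: "(nat \<Rightarrow> complex) \<Rightarrow> (nat \<Rightarrow> complex) \<Rightarrow> (nat \<Rightarrow> real \<Rightarrow> complex) \<Rightarrow>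
    (real \<Rightarrow> complex) \<Rightarrow> real \<Rightarrow> complex" where
  "r\<theta> a lam r \<theta> t = 2 * lam 0 * r 2 t + r 1 t + 2 * (3 * lam 0 + a 2 + r 2 t) * \<theta> t
     + 3 * (\<theta> t)\<^sup>2 + 3 * D \<theta> t"

text \<open>The integrand of the equation for \<open>\<psi> = z - \<theta>\<close>, i.e.
  \<open>PLF a lam r (\<theta> + \<psi>) - PLF a lam \<mu> \<theta>\<close> for \<open>r = \<mu> + \<nu>\<close>.  The coefficient of \<open>\<psi>'\<close> is
  \<open>r\<^sub>2 + 3\<theta>\<close> (the cross term of \<open>3zz'\<close> contributes \<open>3\<theta>\<psi>'\<close>); the source prints \<open>r\<^sub>2 + \<theta>\<close>
  here and in \<open>L\<close> below, with which \<open>\<theta> + \<psi>\<close> does not solve the equation for \<open>z\<close>.\<close>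

definition Npsi :: "(nat \<Rightarrow> complex) \<Rightarrow> (nat \<Rightarrow> complex) \<Rightarrow> (nat \<Rightarrow> real \<Rightarrow> complex) \<Rightarrow>
    (nat \<Rightarrow> real \<Rightarrow> complex) \<Rightarrow> (real \<Rightarrow> complex) \<Rightarrow> (real \<Rightarrow> complex) \<Rightarrow> real \<Rightarrow> complex" where
  "Npsi a lam r \<nu> \<theta> \<psi> t = P\<theta> lam \<nu> \<theta> t + r\<theta> a lam r \<theta> t * \<psi> t + (r 2 t + 3 * \<theta> t) * D \<psi> t
     + (3 * lam 0 + 3 * \<theta> t + a 2 + r 2 t) * (\<psi> t)\<^sup>2 + 3 * \<psi> t * D \<psi> t + (\<psi> t) ^ 3"

section \<open>Smallness constants\<close>

definition weight :: "(nat \<Rightarrow> complex) \<Rightarrow> nat \<Rightarrow> ennreal" where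
  "weight lam i = ennreal ((1 + norm (gam lam i)) / norm (lam 1 - lam 2))"

definition shifted :: "(nat \<Rightarrow> complex) \<Rightarrow> real \<Rightarrow> nat \<Rightarrow> real" where
  "shifted lam \<beta> i = alph lam i - sgn (alph lam i) * \<beta>"

definition L :: "(nat \<Rightarrow> complex) \<Rightarrow> (nat \<Rightarrow> complex) \<Rightarrow> (nat \<Rightarrow> real \<Rightarrow> complex) \<Rightarrow>
    (real \<Rightarrow> complex) \<Rightarrow> real \<Rightarrow> ennreal" where
  "L a lam r \<theta> \<beta> = (\<Sum>i\<in>{1,2}. weight lam i *
     ((SUP t. Iop (of_real (shifted lam \<beta> i)) (r\<theta> a lam r \<theta>) t)
      + (SUP t. Iop (of_real (shifted lam \<beta> i)) (\<lambda>s. r 2 s + 3 * \<theta> s) t)))"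

definition Q :: "(nat \<Rightarrow> complex) \<Rightarrow> (nat \<Rightarrow> complex) \<Rightarrow> (nat \<Rightarrow> real \<Rightarrow> complex) \<Rightarrow>
    (real \<Rightarrow> complex) \<Rightarrow> real \<Rightarrow> ennreal" where
  "Q a lam r \<theta> \<beta> = (\<Sum>i\<in>{1,2}. weight lam i *
     (ennreal ((1 + 3 * norm (lam 0) + norm (a 2)) / \<bar>shifted lam \<beta> i\<bar>)
      + (SUP t. Iop (of_real (shifted lam \<beta> i)) (\<lambda>s. r 2 s + 3 * \<theta> s) t)))"

text \<open>Real versions at \<open>\<beta> = 0\<close>.  They are used only when \<open>L a lam r \<theta> 0 < 1\<close>, and \<open>Q\<close> is
  finite for bounded \<open>r\<^sub>2\<close> and \<open>\<theta>\<close>.\<close>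

definition L0 :: "(nat \<Rightarrow> complex) \<Rightarrow> (nat \<Rightarrow> complex) \<Rightarrow> (nat \<Rightarrow> real \<Rightarrow> complex) \<Rightarrow>
    (real \<Rightarrow> complex) \<Rightarrow> real" where
  "L0 a lam r \<theta> = enn2real (L a lam r \<theta> 0)"

definition Q0 :: "(nat \<Rightarrow> complex) \<Rightarrow> (nat \<Rightarrow> complex) \<Rightarrow> (nat \<Rightarrow> real \<Rightarrow> complex) \<Rightarrow>
    (real \<Rightarrow> complex) \<Rightarrow> real" where
  "Q0 a lam r \<theta> = enn2real (Q a lam r \<theta> 0)"

definition M :: "(nat \<Rightarrow> complex) \<Rightarrow> (nat \<Rightarrow> complex) \<Rightarrow> (nat \<Rightarrow> real \<Rightarrow> complex) \<Rightarrow>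
    (real \<Rightarrow> complex) \<Rightarrow> real" where
  "M a lam r \<theta> = 1 / 3 * (sqrt (1 + (1 - L0 a lam r \<theta>) / Q0 a lam r \<theta>) - 1)"

end

theory Submission
  imports Defs
begin

text \<open>
  With \<open>y = exp (\<lambda>t + \<integral>z)\<close> the equation becomes the integral equation \<open>z = -G[\<dots>]\<close>, and \<open>z = \<theta> + \<psi>\<close>
  solves it as soon as \<open>(\<psi>, \<psi>')\<close> is a fixed point of \<open>(u, v) \<mapsto> (-G[n(u,v)], -G[n(u,v)]')\<close>, where \<open>n\<close> is
  algebraic in the pair.  This map is a contraction of the ball of radius \<open>M\<close> in the space of pairs of bounded
  continuous functions with the maximum norm, because \<open>1 - L = 9QM\<^sup>2 + 6QM\<close>.

  The same estimate gives \<open>|\<psi>| \<le> h + \<integral>K|\<psi>|\<close> with a kernel of mass less than \<open>1\<close> that decays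
  exponentially off the diagonal; its mass stays below \<open>1\<close> after multiplication by \<open>exp (\<epsilon>|t - s|)\<close>
  for small \<open>\<epsilon>\<close>.  As \<open>w = exp (-\<epsilon>|\<cdot>|) * |P\<^sub>\<nu>|\<close> satisfies \<open>w(s) \<le> exp (\<epsilon>|t - s|) w(t)\<close>, comparison yields
  \<open>\<psi>, \<psi>' = O(w)\<close>.  Convolution with an exponential preserves each of the four perturbation classes, so
  no fixed point argument inside these classes is needed.  For a prescribed \<open>\<beta>\<close> the nonlinear terms are absorbed
  where \<open>\<psi>\<close> is small; where it is not, \<open>w\<close> is bounded below, and hence so is
  \<open>exp (-\<beta>|\<cdot>|) * |P\<^sub>\<nu>|\<close>.
\<close>

section \<open>The exponential kernels\<close>

text \<open>Three obstacles shape the proof. First, a solution of an integral equation is only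
  required to be differentiable and to have integrable products with the kernels. Thus \<theta>' is
  a priori neither continuous nor bounded, although it occurs in \<open>P\<theta>\<close> and
  \<open>r\<theta>\<close>. The basic facts about Green operators are therefore proved for
  integrands of which only this integrability is known, and \<theta>' is shown to be almost periodic
  before the contraction is set up. Second, the fixed point has two independent unknowns, so that a
  space of bounded continuous functions is enough; that v is the derivative of u comes out
  afterwards. Third, the decay argument needs a linear inequality. On the ball the quadratic terms
  can be linearised by |\<psi>| \<le> M, which keeps the kernel mass below 1 at exponent 0 and
  therefore, with a margin, at some small \<epsilon>. For a prescribed \<beta> the radius M is not
  adapted to the shifted kernels and this linearisation may cost too much, so the bound for some
  \<epsilon> has to come first.\<close>

definition kap :: "real \<Rightarrow> real \<Rightarrow> real \<Rightarrow> real" where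
  "kap \<alpha> t s = (if sgn \<alpha> * (t - s) < 0 then exp (\<alpha> * (t - s)) else 0)"

text \<open>For bounded measurable \<open>f\<close>, \<open>J\<close> of the modulus is
  \<open>Iop\<close> (\<open>Iop_eq_J\<close>); staying in the reals makes subtraction and linearity
  available.\<close>

definition J :: "real \<Rightarrow> (real \<Rightarrow> real) \<Rightarrow> real \<Rightarrow> real" where
  "J \<alpha> f t = (LINT s|lborel. kap \<alpha> t s * f s)"

lemma norm_green: "norm (green \<omega> t s) = kap (Re \<omega>) t s"
  by (auto simp: green_def kap_def norm_mult sgn_if)

lemma kap_nonneg [simp]: "0 \<le> kap \<alpha> t s"
  by (simp add: kap_def)

lemma kap_measurable [measurable]: "kap \<alpha> t \<in> borel_measurable borel"
  unfolding kap_def by measurable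

lemma green_measurable [measurable]: "green \<omega> t \<in> borel_measurable borel"
proof -
  have [measurable]: "(\<lambda>s. exp (\<omega> * complex_of_real (t - s))) \<in> borel_measurable borel"
    by (intro borel_measurable_continuous_onI continuous_intros)
  show ?thesis unfolding green_def by measurable
qed

text \<open>Substituting \<open>s = t + sgn \<alpha> * x\<close> carries both signs of \<alpha> to
  one exponential on x > 0. The half-line formula also includes x = 0, which is a null set.\<close>

lemma has_bochner_integral_kap:
  assumes "\<alpha> \<noteq> 0"
  shows "has_bochner_integral lborel (kap \<alpha> t) (1 / \<bar>\<alpha>\<bar>)"
proof -
  have a: "\<bar>\<alpha>\<bar> > 0" using assms by simp
  define e where "e = (\<lambda>x::real. if 0 < x then exp (- \<bar>\<alpha>\<bar> * x) else 0)"
  have [measurable]: "e \<in> borel_measurable borel" unfolding e_def by measurable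
  have "((\<lambda>x. exp (- \<bar>\<alpha>\<bar> * x)) has_integral (1 / \<bar>\<alpha>\<bar>)) {0..}"
    using has_integral_exp_minus_to_infinity[OF a, of 0] by simp
  hence "((\<lambda>x. if x \<in> {0..} then exp (- \<bar>\<alpha>\<bar> * x) else 0) has_integral (1 / \<bar>\<alpha>\<bar>)) UNIV"
    by (simp only: has_integral_restrict_UNIV)
  hence "(e has_integral (1 / \<bar>\<alpha>\<bar>)) UNIV"
    by (rule has_integral_spike[of "{0}", rotated 2]) (auto simp: e_def)
  hence "integral\<^sup>N lborel e = 1 / \<bar>\<alpha>\<bar>"
    by (intro nn_integral_has_integral_lborel) (auto simp: e_def)
  hence *: "has_bochner_integral lborel e (1 / \<bar>\<alpha>\<bar>)"
    by (intro has_bochner_integral_nn_integral) (auto simp: e_def)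
  have eq: "(\<lambda>x. kap \<alpha> t (t + sgn \<alpha> * x)) = e"
    using assms by (auto simp: kap_def e_def fun_eq_iff sgn_if)
  have "sgn \<alpha> \<noteq> 0" using assms by (simp add: sgn_if)
  from lborel_has_bochner_integral_real_affine_iff[OF this, of "kap \<alpha> t" "1 / \<bar>\<alpha>\<bar>" t]
  show ?thesis unfolding eq using * assms by (simp add: sgn_if split: if_splits)
qed

lemma integrable_kap [simp]: "\<alpha> \<noteq> 0 \<Longrightarrow> integrable lborel (kap \<alpha> t)"
  using has_bochner_integral_kap has_bochner_integral_iff by blast

lemma integral_kap [simp]: "\<alpha> \<noteq> 0 \<Longrightarrow> (LINT s|lborel. kap \<alpha> t s) = 1 / \<bar>\<alpha>\<bar>"
  using has_bochner_integral_kap has_bochner_integral_iff by blast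

lemma integrable_bounded_mult:
  fixes f :: "real \<Rightarrow> 'a::{real_normed_field, second_countable_topology, banach}"
  assumes "integrable lborel k" "f \<in> borel_measurable borel" "bounded (range f)"
  shows "integrable lborel (\<lambda>s. k s * f s)"
proof -
  obtain B where B: "\<And>x. norm (f x) \<le> B" using assms(3) by (auto simp: bounded_iff)
  have B0: "0 \<le> B" using B[of 0] norm_ge_zero order_trans by blast
  have "k \<in> borel_measurable borel" using borel_measurable_integrable[OF assms(1)] by simp
  with assms(2) have m: "(\<lambda>s. k s * f s) \<in> borel_measurable lborel" by simp
  show ?thesis
  proof (rule Bochner_Integration.integrable_bound[of _ "\<lambda>s. B * norm (k s)"])
    show "AE x in lborel. norm (k x * f x) \<le> norm (B * norm (k x))"
      using B B0 by (auto simp: norm_mult mult.commute intro!: AE_I2 mult_right_mono)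
  qed (use assms(1) m in auto)
qed

lemma integrable_kap_mult:
  assumes "\<alpha> \<noteq> 0" "f \<in> borel_measurable borel" "bounded (range f)"
  shows "integrable lborel (\<lambda>s. kap \<alpha> t s * f s)"
  using integrable_bounded_mult[OF integrable_kap] assms by blast

lemma integrable_green:
  assumes "Re \<omega> \<noteq> 0"
  shows "integrable lborel (green \<omega> t)"
  by (rule Bochner_Integration.integrable_bound[OF integrable_kap[OF assms]])
    (auto simp: norm_green)

lemma integrable_green_mult:
  assumes "Re \<omega> \<noteq> 0" "f \<in> borel_measurable borel" "bounded (range f)"
  shows "integrable lborel (\<lambda>s. green \<omega> t s * f s)"
  using integrable_bounded_mult[OF integrable_green] assms by blast

lemma BC_D: assumes "f \<in> BC" shows "continuous_on UNIV f" "bounded (range f)" "f \<in> borel_measurable borel"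
  using assms borel_measurable_continuous_onI by (auto simp: BC_def)

lemma norm_Gop_le:
  assumes "Re \<omega> \<noteq> 0" "f \<in> borel_measurable borel" "bounded (range f)"
  shows "norm (Gop \<omega> f t) \<le> J (Re \<omega>) (\<lambda>s. norm (f s)) t"
  unfolding Gop_def J_def
  by (rule order_trans[OF integral_norm_bound]) (simp add: norm_mult norm_green)

lemma J_mono:
  assumes "\<alpha> \<noteq> 0" "f \<in> borel_measurable borel" "bounded (range f)"
    "g \<in> borel_measurable borel" "bounded (range g)" "\<And>s. f s \<le> g s"
  shows "J \<alpha> f t \<le> J \<alpha> g t"
  unfolding J_def by (intro integral_mono integrable_kap_mult) (use assms in \<open>auto intro: mult_left_mono\<close>)

lemma J_add:
  assumes "\<alpha> \<noteq> 0" "f \<in> borel_measurable borel" "bounded (range f)"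
    "g \<in> borel_measurable borel" "bounded (range g)"
  shows "J \<alpha> (\<lambda>s. f s + g s) t = J \<alpha> f t + J \<alpha> g t"
  unfolding J_def using assms by (simp add: distrib_left integrable_kap_mult)

lemma J_cmult: "J \<alpha> (\<lambda>s. c * f s) t = c * J \<alpha> f t"
  unfolding J_def by (simp add: mult.left_commute)

lemma J_const: "\<alpha> \<noteq> 0 \<Longrightarrow> J \<alpha> (\<lambda>s. c) t = c / \<bar>\<alpha>\<bar>"
  unfolding J_def by simp

lemma J_nonneg: "(\<And>s. 0 \<le> f s) \<Longrightarrow> 0 \<le> J \<alpha> f t"
  unfolding J_def by (intro integral_nonneg_AE) auto

lemma Iop_eq_J:
  assumes "Re \<omega> \<noteq> 0" "f \<in> borel_measurable borel" "bounded (range f)"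
  shows "Iop \<omega> f t = ennreal (J (Re \<omega>) (\<lambda>s. norm (f s)) t)"
proof -
  have "bounded (range (\<lambda>s. norm (f s)))" using assms(3) by (simp add: bounded_iff)
  hence "integrable lborel (\<lambda>s. kap (Re \<omega>) t s * norm (f s))"
    using assms by (intro integrable_kap_mult) auto
  thus ?thesis unfolding Iop_def J_def
    by (subst nn_integral_eq_integral[symmetric]) (auto simp: norm_mult norm_green)
qed

text \<open>The kernel jumps by +1 across the diagonal whatever the sign of
  \<open>Re \<omega>\<close>. So moving t to t + h multiplies it by
  \<open>exp (\<omega> * h)\<close> and adds an exponential on the interval passed over; the strict
  inequality in \<open>green\<close> leaves out the two endpoints.\<close>

lemma green_shift:
  assumes "0 \<le> h" "Re \<omega> \<noteq> 0" "s \<noteq> t" "s \<noteq> t + h"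
  shows "green \<omega> (t + h) s * z = exp (\<omega> * of_real h) * (green \<omega> t s * z) +
     indicator {t..t + h} s *\<^sub>R (exp (\<omega> * of_real (t + h - s)) * z)"
proof -
  have *: "exp (\<omega> * of_real (t + h - s)) = exp (\<omega> * of_real h) * exp (\<omega> * of_real (t - s))"
    by (simp add: exp_add[symmetric] algebra_simps)
  consider "Re \<omega> > 0" "s < t" | "Re \<omega> > 0" "t < s" "s < t + h" | "Re \<omega> > 0" "t + h < s"
    | "Re \<omega> < 0" "s < t" | "Re \<omega> < 0" "t < s" "s < t + h" | "Re \<omega> < 0" "t + h < s"
    using assms by linarith
  thus ?thesis
    by cases (use assms(1) in \<open>simp_all add: green_def * del: of_real_add of_real_diff\<close>)
qed

text \<open>Integrating \<open>green_shift\<close> gives the variation of constants over one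
  interval. Only integrability of the products with \<open>green\<close> is assumed, because the
  integrand for \<theta> is not yet known to be continuous.\<close>

lemma Gop_shift:
  assumes int: "\<And>t. integrable lborel (\<lambda>s. green \<omega> t s * f s)" and "0 \<le> h" "Re \<omega> \<noteq> 0"
  shows "set_integrable lborel {t..t+h} (\<lambda>s. exp (\<omega> * of_real (t + h - s)) * f s)"
    "Gop \<omega> f (t + h) = exp (\<omega> * of_real h) * Gop \<omega> f t +
      (LINT s:{t..t+h}|lborel. exp (\<omega> * of_real (t + h - s)) * f s)"
proof -
  let ?k = "\<lambda>s. indicator {t..t + h} s *\<^sub>R (exp (\<omega> * of_real (t + h - s)) * f s)"
  have "AE s in lborel. s \<noteq> t" "AE s in lborel. s \<noteq> t + h" by (rule AE_lborel_singleton)+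
  hence ae: "AE s in lborel. green \<omega> (t + h) s * f s =
      exp (\<omega> * of_real h) * (green \<omega> t s * f s) + ?k s"
    by eventually_elim (rule green_shift[OF assms(2,3)])
  have "(\<lambda>s. green \<omega> (t+h) s * f s - exp (\<omega> * of_real h) * (green \<omega> t s * f s)) \<in> borel_measurable borel"
    using borel_measurable_integrable[OF int[of "t+h"]] borel_measurable_integrable[OF int[of t]] by simp
  \<comment> \<open>Measurability of \<open>f\<close> is not among the assumptions. Off the two
    points left out by \<open>green_shift\<close>, \<open>?k\<close> is a combination of measurable
    products, and two point values do no harm.\<close>
  have fm: "(\<lambda>s. if s = t \<or> s = t + h then 0 else ?k s) \<in> borel_measurable borel"
  proof -
    have "(\<lambda>s. if s = t \<or> s = t + h then 0 else ?k s) =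
      (\<lambda>s. if s = t \<or> s = t + h then 0 else green \<omega> (t+h) s * f s - exp (\<omega> * of_real h) * (green \<omega> t s * f s))"
      using green_shift[OF assms(2,3)] by (auto simp: fun_eq_iff)
    thus ?thesis using \<open>_ \<in> borel_measurable borel\<close> by simp
  qed
  have km: "?k \<in> borel_measurable borel"
  proof -
    have "?k = (\<lambda>s. if s = t then ?k t else if s = t + h then ?k (t+h) else (if s = t \<or> s = t + h then 0 else ?k s))"
      by auto
    thus ?thesis using fm by simp
  qed
  have ik: "integrable lborel ?k"
  proof (rule integrable_cong_AE_imp)
    show "integrable lborel (\<lambda>s. green \<omega> (t+h) s * f s - exp (\<omega> * of_real h) * (green \<omega> t s * f s))"
      by (intro Bochner_Integration.integrable_diff integrable_mult_right int)
    show "?k \<in> borel_measurable lborel" using km by simp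
    show "AE s in lborel. green \<omega> (t+h) s * f s - exp (\<omega> * of_real h) * (green \<omega> t s * f s) = ?k s"
      using ae by eventually_elim simp
  qed
  thus "set_integrable lborel {t..t+h} (\<lambda>s. exp (\<omega> * of_real (t + h - s)) * f s)"
    by (simp add: set_integrable_def)
  have "Gop \<omega> f (t + h) = (LINT s|lborel. exp (\<omega> * of_real h) * (green \<omega> t s * f s) + ?k s)"
    unfolding Gop_def
    by (rule integral_cong_AE) (use ae int ik borel_measurable_integrable in auto)
  also have "\<dots> = exp (\<omega> * of_real h) * Gop \<omega> f t + integral\<^sup>L lborel ?k"
    unfolding Gop_def by (subst Bochner_Integration.integral_add) (use int ik in auto)
  finally show "Gop \<omega> f (t + h) = exp (\<omega> * of_real h) * Gop \<omega> f t +
      (LINT s:{t..t+h}|lborel. exp (\<omega> * of_real (t + h - s)) * f s)"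
    by (simp add: set_lebesgue_integral_def)
qed

section \<open>Regularity of the Green operators\<close>

lemma set_integrable_continuous_mult:
  fixes f g :: "real \<Rightarrow> complex"
  assumes "set_integrable lborel {a..b} f" "continuous_on UNIV g"
  shows "set_integrable lborel {a..b} (\<lambda>s. g s * f s)"
proof -
  have "bounded (g ` {a..b})"
    by (intro compact_imp_bounded compact_continuous_image) (use assms(2) continuous_on_subset in auto)
  then obtain B where B: "\<And>s. s \<in> {a..b} \<Longrightarrow> norm (g s) \<le> B" by (meson bounded_iff imageI)
  have [measurable]: "g \<in> borel_measurable borel"
    using assms(2) by (rule borel_measurable_continuous_onI)
  have m: "(\<lambda>s. indicat_real {a..b} s *\<^sub>R f s) \<in> borel_measurable borel"
    using borel_measurable_integrable assms(1) unfolding set_integrable_def by force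
  have "(\<lambda>s. indicat_real {a..b} s *\<^sub>R (g s * f s)) = (\<lambda>s. g s * (indicat_real {a..b} s *\<^sub>R f s))"
    by (auto simp: indicator_def)
  moreover have "\<dots> \<in> borel_measurable borel" using m by (intro borel_measurable_times) auto
  ultimately have m': "(\<lambda>s. indicat_real {a..b} s *\<^sub>R (g s * f s)) \<in> borel_measurable borel" by simp
  show ?thesis unfolding set_integrable_def
  proof (rule Bochner_Integration.integrable_bound)
    show "integrable lborel (\<lambda>s. \<bar>B\<bar> * norm (indicat_real {a..b} s *\<^sub>R f s))"
      using assms(1) unfolding set_integrable_def by (intro integrable_mult_right integrable_norm)
    have "norm (g s) \<le> \<bar>B\<bar>" if "s \<in> {a..b}" for s using B[OF that] by linarith
    thus "AE s in lborel. norm (indicat_real {a..b} s *\<^sub>R (g s * f s)) \<le>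
       norm (\<bar>B\<bar> * norm (indicat_real {a..b} s *\<^sub>R f s))"
      by (intro AE_I2) (auto simp: indicator_def norm_mult intro!: mult_right_mono)
  qed (use m' in simp)
qed

context
  fixes \<omega> :: complex and f :: "real \<Rightarrow> complex"
  assumes int: "\<And>t. integrable lborel (\<lambda>s. green \<omega> t s * f s)" and nz: "Re \<omega> \<noteq> 0"
begin

lemma Gop_locally_integrable:
  assumes "continuous_on UNIV g"
  shows "set_integrable lborel {a..b} (\<lambda>s. g s * f s)"
proof (cases "a \<le> b")
  case True
  have "set_integrable lborel {a..b} (\<lambda>s. exp (\<omega> * of_real (b - s)) * f s)"
    using Gop_shift(1)[OF int _ nz, of "b - a" a] True by simp
  \<comment> \<open>The exponential from \<open>Gop_shift\<close> has no zeros, so replacing it by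
    \<open>g\<close> is multiplication by one continuous function.\<close>
  hence "set_integrable lborel {a..b}
     (\<lambda>s. (g s * exp (- \<omega> * of_real (b - s))) * (exp (\<omega> * of_real (b - s)) * f s))"
    by (rule set_integrable_continuous_mult) (intro continuous_intros assms)
  moreover have "g s * exp (- \<omega> * of_real (b - s)) * (exp (\<omega> * of_real (b - s)) * f s) = g s * f s" for s
    by (simp add: exp_minus field_simps del: of_real_diff)
  ultimately show ?thesis by (simp only:)
qed (simp add: set_integrable_def)

text \<open>The integrand is normalised at the base point \<open>a\<close>, so t enters only through
  the upper limit and an outer factor. Continuity and derivative are then those of an indefinite
  integral.\<close>

lemma Gop_rep:
  assumes "a \<le> t"
  shows "Gop \<omega> f t = exp (\<omega> * of_real (t - a)) * (Gop \<omega> f a + integral {a..t} (\<lambda>s. exp (\<omega> * of_real (a - s)) * f s))"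
proof -
  have "set_integrable lborel {a..t} (\<lambda>s. exp (\<omega> * of_real (a - s)) * f s)"
    by (intro Gop_locally_integrable continuous_intros)
  hence eq: "(LINT s:{a..t}|lborel. exp (\<omega> * of_real (a - s)) * f s) = integral {a..t} (\<lambda>s. exp (\<omega> * of_real (a - s)) * f s)"
    by (rule set_borel_integral_eq_integral)
  have "Gop \<omega> f t = exp (\<omega> * of_real (t - a)) * Gop \<omega> f a +
      (LINT s:{a..t}|lborel. exp (\<omega> * of_real (t - s)) * f s)"
    using Gop_shift(2)[OF int _ nz, of "t - a" a] assms by simp
  also have "(\<lambda>s. exp (\<omega> * of_real (t - s)) * f s) =
      (\<lambda>s. exp (\<omega> * of_real (t - a)) * (exp (\<omega> * of_real (a - s)) * f s))"
  proof
    fix s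
    have "exp (\<omega> * of_real (t - s)) = exp (\<omega> * of_real (t - a) + \<omega> * of_real (a - s))"
      by (simp add: algebra_simps)
    thus "exp (\<omega> * of_real (t - s)) * f s = exp (\<omega> * of_real (t - a)) * (exp (\<omega> * of_real (a - s)) * f s)"
      by (simp only: exp_add mult.assoc)
  qed
  also have "(LINT s:{a..t}|lborel. exp (\<omega> * of_real (t - a)) * (exp (\<omega> * of_real (a - s)) * f s)) =
     exp (\<omega> * of_real (t - a)) * (LINT s:{a..t}|lborel. exp (\<omega> * of_real (a - s)) * f s)"
    by (rule set_integral_mult_right)
  finally show ?thesis by (simp only: eq distrib_left)
qed

lemma Gop_continuous: "continuous_on UNIV (Gop \<omega> f)"
proof (intro continuous_at_imp_continuous_on ballI)
  fix t :: real
  have "set_integrable lborel {t-1..t+1} (\<lambda>s. exp (\<omega> * of_real (t - 1 - s)) * f s)"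
    by (intro Gop_locally_integrable continuous_intros)
  hence c: "continuous_on {t-1..t+1} (\<lambda>u. integral {t-1..u} (\<lambda>s. exp (\<omega> * of_real (t - 1 - s)) * f s))"
    by (intro indefinite_integral_continuous_1 set_borel_integral_eq_integral)
  have e: "continuous_on {t-1..t+1} (\<lambda>u. exp (\<omega> * of_real (u - (t-1))))"
    by (intro continuous_intros)
  have "continuous_on {t-1..t+1} (\<lambda>u. exp (\<omega> * of_real (u - (t-1))) * (Gop \<omega> f (t-1) + integral {t-1..u} (\<lambda>s. exp (\<omega> * of_real ((t-1) - s)) * f s)))"
    by (rule continuous_on_mult[OF e continuous_on_add[OF continuous_on_const c]])
  hence "continuous_on {t-1..t+1} (Gop \<omega> f)"
    by (rule continuous_on_eq) (rule Gop_rep[symmetric], simp)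
  thus "isCont (Gop \<omega> f) t"
    by (rule continuous_on_interior) simp
qed

text \<open>The jump of the kernel on the diagonal produces the term \<open>f t\<close>.
  \<open>Gop_rep\<close> holds only to the right of its base point, so \<open>t - 1\<close> is taken
  to make t an interior point.\<close>

lemma Gop_has_vector_derivative:
  assumes "continuous_on UNIV f"
  shows "(Gop \<omega> f has_vector_derivative (f t + \<omega> * Gop \<omega> f t)) (at t)"
proof -
  let ?k = "\<lambda>s. exp (\<omega> * of_real (t - 1 - s)) * f s"
  let ?E = "\<lambda>u. exp (\<omega> * of_real (u - (t-1)))"
  let ?H = "\<lambda>u. Gop \<omega> f (t-1) + integral {t-1..u} ?k"
  have "continuous_on {t-1..t+1} ?k"
    by (intro continuous_intros continuous_on_subset[OF assms]) auto
  hence "((\<lambda>u. integral {t-1..u} ?k) has_vector_derivative ?k t) (at t within {t-1..t+1})"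
    by (rule integral_has_vector_derivative) auto
  hence "((\<lambda>u. integral {t-1..u} ?k) has_vector_derivative ?k t) (at t within {t-1<..<t+1})"
    by (rule has_vector_derivative_within_subset) auto
  hence 1: "((\<lambda>u. integral {t-1..u} ?k) has_vector_derivative ?k t) (at t)"
    by (subst (asm) at_within_open) auto
  have 2: "(?E has_vector_derivative \<omega> * ?E t) (at t)"
    by (auto intro!: derivative_eq_intros has_vector_derivative_real_field[where f = "\<lambda>u. exp (\<omega> * (u - of_real (t - 1)))", simplified])
  have 3: "(?H has_vector_derivative ?k t) (at t)"
    using has_vector_derivative_add[OF has_vector_derivative_const[of "Gop \<omega> f (t-1)"] 1] by (simp only: add_0)
  have "((\<lambda>u. ?E u * ?H u) has_vector_derivative (?E t * ?k t + \<omega> * ?E t * ?H t)) (at t)"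
    by (rule has_vector_derivative_mult[OF 2 3])
  moreover have "?E t * ?k t = f t"
  proof -
    have "?E t * exp (\<omega> * of_real (t - 1 - t)) = exp (\<omega> * of_real (t - (t - 1)) + \<omega> * of_real (t - 1 - t))"
      by (simp only: exp_add)
    also have "\<dots> = 1" by simp
    finally show ?thesis by (simp only: mult.assoc[symmetric] mult_1)
  qed
  moreover have "\<omega> * ?E t * ?H t = \<omega> * Gop \<omega> f t"
    by (subst Gop_rep[of "t-1" t]) (simp, simp only: mult.assoc)
  ultimately have "((\<lambda>u. ?E u * ?H u) has_vector_derivative (f t + \<omega> * Gop \<omega> f t)) (at t)"
    by (simp only:)
  thus ?thesis
    by (rule has_vector_derivative_transform_within_open[of _ _ _ "{t-1<..<t+1}"])
       (auto intro!: Gop_rep[symmetric] simp del: of_real_diff)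
qed

end

section \<open>Differences of Green integrals of a discontinuous integrand\<close>

lemma exp_diff_bound:
  fixes \<omega>1 \<omega>2 :: complex
  obtains K where "K \<ge> 0" "\<And>u. 0 \<le> u \<Longrightarrow> u \<le> 1 \<Longrightarrow> norm (exp (\<omega>1 * of_real u) - exp (\<omega>2 * of_real u)) \<le> K * u"
proof -
  define K where "K = norm \<omega>1 * exp (norm \<omega>1) + norm \<omega>2 * exp (norm \<omega>2)"
  have b: "norm (\<omega> * exp (\<omega> * z)) \<le> norm \<omega> * exp (norm \<omega>)" if "z \<in> cball 0 1" for \<omega> z :: complex
  proof -
    have "norm (exp (\<omega> * z)) \<le> exp (norm (\<omega> * z))" by (rule norm_exp)
    also have "\<dots> \<le> exp (norm \<omega>)" using that by (simp add: norm_mult mult_left_le)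
    finally show ?thesis by (simp add: norm_mult mult_left_mono)
  qed
  have "norm (exp (\<omega>1 * of_real u) - exp (\<omega>2 * of_real u)) \<le> K * u" if "0 \<le> u" "u \<le> 1" for u :: real
  proof -
    have "norm ((exp (\<omega>1 * of_real u) - exp (\<omega>2 * of_real u)) - (exp (\<omega>1 * 0) - exp (\<omega>2 * 0))) \<le> K * norm (of_real u - (0::complex))"
    proof (rule field_differentiable_bound[where S = "cball 0 1" and f = "\<lambda>z. exp (\<omega>1 * z) - exp (\<omega>2 * z)"
          and f' = "\<lambda>z. \<omega>1 * exp (\<omega>1 * z) - \<omega>2 * exp (\<omega>2 * z)"])
      show "norm (\<omega>1 * exp (\<omega>1 * z) - \<omega>2 * exp (\<omega>2 * z)) \<le> K" if "z \<in> cball 0 1" for z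
        unfolding K_def using b[OF that, of \<omega>1] b[OF that, of \<omega>2] by (meson add_mono norm_triangle_le_diff)
    qed (use that in \<open>auto intro!: derivative_eq_intros\<close>)
    thus ?thesis using that by simp
  qed
  moreover have "K \<ge> 0" unfolding K_def by simp
  ultimately show ?thesis using that by blast
qed

text \<open>Here \<open>f\<close> need not be continuous, so the single \<open>Gop \<omega>\<^sub>i f\<close> need not be differentiable; in the
  difference of the two the kernels cancel on the diagonal.\<close>

lemma Gop_diff_vector_derivative:
  assumes int: "\<And>t. integrable lborel (\<lambda>s. green \<omega>1 t s * f s)" "\<And>t. integrable lborel (\<lambda>s. green \<omega>2 t s * f s)"
    and nz: "Re \<omega>1 \<noteq> 0" "Re \<omega>2 \<noteq> 0"
    and diff: "(\<lambda>t. Gop \<omega>1 f t - Gop \<omega>2 f t) differentiable (at t)"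
  shows "vector_derivative (\<lambda>t. Gop \<omega>1 f t - Gop \<omega>2 f t) (at t) = \<omega>1 * Gop \<omega>1 f t - \<omega>2 * Gop \<omega>2 f t"
proof -
  let ?u = "\<lambda>t. Gop \<omega>1 f t - Gop \<omega>2 f t"
  let ?q = "\<lambda>h. (?u (t + h) - ?u t) /\<^sub>R h"
  have "(?u has_vector_derivative vector_derivative ?u (at t)) (at t)"
    using diff vector_derivative_works by blast
  hence "((\<lambda>h. norm (?u (t + h) - ?u t - h *\<^sub>R vector_derivative ?u (at t)) / norm h) \<longlongrightarrow> 0) (at 0)"
    by (simp add: has_vector_derivative_def has_derivative_at)
  moreover have "\<forall>\<^sub>F h in at 0. norm (?u (t + h) - ?u t - h *\<^sub>R vector_derivative ?u (at t)) / norm h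
      = norm (?q h - vector_derivative ?u (at t))"
  proof (rule eventually_mono[OF eventually_neq_at_within[of 0]])
    fix h :: real assume h: "h \<noteq> 0"
    have "?q h - vector_derivative ?u (at t) = (?u (t + h) - ?u t - h *\<^sub>R vector_derivative ?u (at t)) /\<^sub>R h"
      using h by (simp add: scaleR_diff_right)
    thus "norm (?u (t + h) - ?u t - h *\<^sub>R vector_derivative ?u (at t)) / norm h
      = norm (?q h - vector_derivative ?u (at t))"
      by (simp add: divide_inverse mult.commute)
  qed
  ultimately have "((\<lambda>h. norm (?q h - vector_derivative ?u (at t))) \<longlongrightarrow> 0) (at 0)"
    by (rule Lim_transform_eventually)
  hence "(?q \<longlongrightarrow> vector_derivative ?u (at t)) (at 0)"
    by (simp only: tendsto_norm_zero_iff Lim_null[symmetric])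
  \<comment> \<open>\<open>Gop_shift\<close> moves only to the right. As the derivative is assumed
    to exist, its value can be read off from the right-hand quotients.\<close>
  hence lim1: "(?q \<longlongrightarrow> vector_derivative ?u (at t)) (at_right 0)"
    by (rule tendsto_mono[OF at_le, rotated]) simp
  obtain K where K: "K \<ge> 0" "\<And>u. 0 \<le> u \<Longrightarrow> u \<le> 1 \<Longrightarrow> norm (exp (\<omega>1 * of_real u) - exp (\<omega>2 * of_real u)) \<le> K * u"
    using exp_diff_bound by blast
  have fi: "set_integrable lborel {t..t+h} f" for h
    using Gop_locally_integrable[OF int(1) nz(1), of "\<lambda>_. 1"] by simp
  define I where "I h = (LINT s:{t..t+h}|lborel. norm (f s))" for h
  have Ilim: "(I \<longlongrightarrow> 0) (at_right 0)"
  proof -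
    have ni: "set_integrable lborel {t..t+h} (\<lambda>s. norm (f s))" for h
      using fi by (rule set_integrable_norm)
    have eq: "I h = integral {t..t+h} (\<lambda>s. norm (f s))" for h
      unfolding I_def using ni by (rule set_borel_integral_eq_integral)
    have "continuous_on {t..t+1} (\<lambda>x. integral {t..x} (\<lambda>s. norm (f s)))"
      by (rule indefinite_integral_continuous_1) (rule set_borel_integral_eq_integral[OF ni])
    hence "((\<lambda>x. integral {t..x} (\<lambda>s. norm (f s))) \<longlongrightarrow> integral {t..t} (\<lambda>s. norm (f s))) (at t within {t..t+1})"
      by (rule continuous_on_def[THEN iffD1, THEN bspec]) simp
    hence "((\<lambda>x. integral {t..x} (\<lambda>s. norm (f s))) \<longlongrightarrow> 0) (at_right t)"
      by (simp add: at_within_Icc_at_right)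
    hence "((\<lambda>h. integral {t..t+h} (\<lambda>s. norm (f s))) \<longlongrightarrow> 0) (at_right 0)"
      by (subst (asm) filterlim_at_right_to_0) (simp add: add.commute)
    thus ?thesis unfolding eq[abs_def] .
  qed
  let ?c = "\<lambda>\<omega> h. (exp (\<omega> * of_real h) - 1) / of_real h"
  \<comment> \<open>\<open>?v\<close> is the difference quotient without the integrals over
    \<open>{t..t+h}\<close>. These enter with a kernel difference of order h, so after division by h
    they contribute at most \<open>K * I h\<close>.\<close>
  let ?v = "\<lambda>h. ?c \<omega>1 h * Gop \<omega>1 f t - ?c \<omega>2 h * Gop \<omega>2 f t"
  have clim: "((\<lambda>h::real. ?c \<omega> h) \<longlongrightarrow> \<omega>) (at_right 0)" for \<omega> :: complex
  proof -
    have "((\<lambda>z. exp (\<omega> * z)) has_field_derivative \<omega>) (at 0)"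
      by (auto intro!: derivative_eq_intros)
    hence "((\<lambda>z. (exp (\<omega> * z) - 1) / z) \<longlongrightarrow> \<omega>) (at 0)"
      by (simp add: DERIV_def)
    moreover have "filterlim (\<lambda>h::real. complex_of_real h) (at 0) (at_right 0)"
      by (auto simp: filterlim_at eventually_at_filter intro!: tendsto_eq_intros)
    ultimately show ?thesis by (rule filterlim_compose)
  qed
  have "(?v \<longlongrightarrow> \<omega>1 * Gop \<omega>1 f t - \<omega>2 * Gop \<omega>2 f t) (at_right 0)"
    by (intro tendsto_intros clim)
  moreover have "((\<lambda>h. ?q h - ?v h) \<longlongrightarrow> 0) (at_right 0)"
  proof (rule Lim_null_comparison)
    show "((\<lambda>h. K * I h) \<longlongrightarrow> 0) (at_right 0)"
      using tendsto_mult_right_zero[OF Ilim] by simp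
    have "norm (?q h - ?v h) \<le> K * I h" if h: "0 < h" "h < 1" for h
    proof -
      let ?e = "\<lambda>\<omega> s. exp (\<omega> * of_real (t + h - s))"
      have h0: "0 \<le> h" using h by simp
      note s1 = Gop_shift[OF int(1) h0 nz(1), of t] and s2 = Gop_shift[OF int(2) h0 nz(2), of t]
      have eq: "?q h - ?v h = (LINT s:{t..t+h}|lborel. (?e \<omega>1 s * f s - ?e \<omega>2 s * f s)) /\<^sub>R h"
        unfolding s1(2) s2(2) set_integral_diff(2)[OF s1(1) s2(1)]
        using h by (simp add: scaleR_conv_of_real field_simps del: of_real_add of_real_diff)
      have "norm (LINT s:{t..t+h}|lborel. (?e \<omega>1 s * f s - ?e \<omega>2 s * f s)) \<le>
          (LINT s:{t..t+h}|lborel. norm (?e \<omega>1 s * f s - ?e \<omega>2 s * f s))"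
        by (rule set_integral_norm_bound) (rule set_integral_diff(1)[OF s1(1) s2(1)])
      also have "\<dots> \<le> (LINT s:{t..t+h}|lborel. K * h * norm (f s))"
      proof (rule set_integral_mono)
        show "set_integrable lborel {t..t+h} (\<lambda>s. norm (?e \<omega>1 s * f s - ?e \<omega>2 s * f s))"
          by (rule set_integrable_norm) (rule set_integral_diff(1)[OF s1(1) s2(1)])
        show "set_integrable lborel {t..t+h} (\<lambda>s. K * h * norm (f s))"
          using set_integrable_norm[OF fi] by (intro set_integrable_mult_right) simp
        fix s assume s: "s \<in> {t..t+h}"
        have "norm (?e \<omega>1 s * f s - ?e \<omega>2 s * f s) = norm (?e \<omega>1 s - ?e \<omega>2 s) * norm (f s)"
          by (simp only: norm_mult[symmetric] left_diff_distrib)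
        also have "\<dots> \<le> (K * (t + h - s)) * norm (f s)"
          using s h by (intro mult_right_mono K(2)) auto
        also have "\<dots> \<le> K * h * norm (f s)"
          using s K(1) by (intro mult_right_mono mult_left_mono) auto
        finally show "norm (?e \<omega>1 s * f s - ?e \<omega>2 s * f s) \<le> K * h * norm (f s)" .
      qed
      also have "\<dots> = h * (K * I h)" unfolding I_def by simp
      finally show ?thesis unfolding eq using h by (simp add: field_simps)
    qed
    thus "\<forall>\<^sub>F h in at_right 0. norm (?q h - ?v h) \<le> K * I h"
      unfolding eventually_at_right_field by (intro exI[of _ 1]) auto
  qed
  ultimately have "((\<lambda>h. (?q h - ?v h) + ?v h) \<longlongrightarrow> 0 + (\<omega>1 * Gop \<omega>1 f t - \<omega>2 * Gop \<omega>2 f t)) (at_right 0)"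
    by (intro tendsto_add)
  hence "(?q \<longlongrightarrow> \<omega>1 * Gop \<omega>1 f t - \<omega>2 * Gop \<omega>2 f t) (at_right 0)" by simp
  from tendsto_unique[OF _ lim1 this] show ?thesis by simp
qed

section \<open>Almost periodic functions\<close>

lemma AP_bounded: assumes "f \<in> AP" shows "bounded (range f)"
proof (rule ccontr)
  assume "\<not> bounded (range f)"
  hence "\<forall>k::nat. \<exists>x. norm (f x) > real k"
    by (force simp: bounded_iff not_le)
  then obtain b where b: "\<And>k. norm (f (b k)) > real k" by metis
  from assms obtain \<sigma> l where \<sigma>: "strict_mono \<sigma>"
    and l: "uniform_limit UNIV (\<lambda>m t. f (t + b (\<sigma> m))) l sequentially"
    unfolding AP_def by blast
  have "(\<lambda>m. f (0 + b (\<sigma> m))) \<longlonglongrightarrow> l 0"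
    using tendsto_uniform_limitI[OF l, of 0] by simp
  hence "Bseq (\<lambda>m. f (b (\<sigma> m)))"
    using convergentI convergent_imp_Bseq by fastforce
  then obtain B where B: "\<And>m. norm (f (b (\<sigma> m))) \<le> B" by (auto simp: Bseq_def)
  obtain m :: nat where "B < real m" using reals_Archimedean2 by blast
  also have "real m \<le> real (\<sigma> m)" using seq_suble[OF \<sigma>] by simp
  also have "\<dots> < norm (f (b (\<sigma> m)))" by (rule b)
  finally show False using B[of m] by simp
qed

lemma AP_BC: "f \<in> AP \<Longrightarrow> f \<in> BC"
  using AP_bounded by (auto simp: AP_def BC_def)

lemma vector_derivative_bounded_imp_lipschitz:
  fixes f :: "real \<Rightarrow> 'a::real_normed_vector"
  assumes "\<And>t. (f has_vector_derivative f' t) (at t)" "\<And>t. norm (f' t) \<le> C"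
  shows "norm (f a - f b) \<le> C * \<bar>a - b\<bar>"
proof -
  have "norm (f a - f b) \<le> C * norm (a - b)"
  proof (rule differentiable_bound[of UNIV f "\<lambda>x h. h *\<^sub>R f' x"])
    show "onorm (\<lambda>h. h *\<^sub>R f' x) \<le> C" for x
      using assms(2)[of x] by (intro onorm_le) (simp add: mult.commute[of C] mult_left_mono)
  qed (use assms(1) in \<open>auto simp: has_vector_derivative_def\<close>)
  thus ?thesis by simp
qed

text \<open>With a Lipschitz derivative, difference quotients of step h approximate
  \<open>f'\<close> within \<open>C * h\<close> uniformly in t, so \<open>f'\<close> inherits
  uniformly Cauchy translates from \<open>f\<close>.\<close>

lemma AP_lipschitz_derivative:
  assumes AP: "f \<in> AP" and der: "\<And>t. (f has_vector_derivative f' t) (at t)"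
    and lip: "\<And>s t. norm (f' s - f' t) \<le> C * \<bar>s - t\<bar>"
  shows "f' \<in> AP"
proof -
  have C: "C \<ge> 0" using lip[of 1 0] by (simp add: order_trans[OF norm_ge_zero])
  have cont: "continuous_on UNIV f'"
  proof -
    have "C-lipschitz_on UNIV f'"
      by (rule lipschitz_onI) (use lip C in \<open>auto simp: dist_norm\<close>)
    thus ?thesis by (rule lipschitz_on_continuous_on)
  qed
  have quot: "norm (f (t + h) - f t - h *\<^sub>R f' t) \<le> h * (C * h)" if "h > 0" for t h
  proof -
    have "norm (f (t + h) - f t - (t + h - t) *\<^sub>R f' t) \<le> norm (t + h - t) * (C * h)"
    proof (rule vector_differentiable_bound_linearization[of "{t..t+h}"])
      show "(f has_vector_derivative f' x) (at x within {t..t+h})" for x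
        using der has_vector_derivative_at_within by blast
      show "norm (f' x - f' t) \<le> C * h" if "x \<in> {t..t+h}" for x
      proof -
        have "C * \<bar>x - t\<bar> \<le> C * h" using that C by (intro mult_left_mono) auto
        thus ?thesis using lip[of x t] by linarith
      qed
    qed (use that in \<open>auto simp: closed_segment_eq_real_ivl\<close>)
    thus ?thesis using that by simp
  qed
  have "\<exists>\<sigma> :: nat \<Rightarrow> nat. strict_mono \<sigma> \<and> (\<exists>l. uniform_limit UNIV (\<lambda>m t. f' (t + b (\<sigma> m))) l sequentially)"
    for b :: "nat \<Rightarrow> real"
  proof -
    from AP obtain \<sigma> l where \<sigma>: "strict_mono \<sigma>"
      and l: "uniform_limit UNIV (\<lambda>m t. f (t + b (\<sigma> m))) l sequentially"
      unfolding AP_def by blast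
    have "uniformly_Cauchy_on UNIV (\<lambda>m t. f (t + b (\<sigma> m)))"
      using l uniformly_convergent_Cauchy uniformly_convergent_on_def by blast
    hence cau: "\<exists>M. \<forall>t. \<forall>m\<ge>M. \<forall>n\<ge>M. dist (f (t + b (\<sigma> m))) (f (t + b (\<sigma> n))) < e" if "e > 0" for e
      using that unfolding uniformly_Cauchy_on_def by simp
    have "uniformly_Cauchy_on UNIV (\<lambda>m t. f' (t + b (\<sigma> m)))"
    proof (rule uniformly_Cauchy_onI)
      fix e :: real assume e: "e > 0"
      \<comment> \<open>After division by h the error is at most e/8 + e/8 from the translates of
        \<open>f\<close> and twice e/4 from the quotients, 3e/4 in all. \<open>C + 1\<close> keeps
        the denominator positive.\<close>
      define h where "h = e / (4 * (C + 1))"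
      have h: "h > 0" "C * h \<le> e / 4"
        using e C by (auto simp: h_def field_simps)
      obtain M where M: "\<And>t m n. m \<ge> M \<Longrightarrow> n \<ge> M \<Longrightarrow> dist (f (t + b (\<sigma> m))) (f (t + b (\<sigma> n))) < e * h / 8"
        using cau[of "e * h / 8"] e h by (metis divide_pos_pos mult_pos_pos zero_less_numeral)
      have "dist (f' (t + b (\<sigma> m))) (f' (t + b (\<sigma> n))) < e" if mn: "m \<ge> M" "n \<ge> M" for t m n
      proof -
        let ?x = "t + b (\<sigma> m)" and ?y = "t + b (\<sigma> n)"
        have "h *\<^sub>R (f' ?x - f' ?y) = (f (?x + h) - f (?y + h)) - (f ?x - f ?y)
           - (f (?x + h) - f ?x - h *\<^sub>R f' ?x) + (f (?y + h) - f ?y - h *\<^sub>R f' ?y)"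
          by (simp add: algebra_simps)
        moreover have "norm (f (?x + h) - f (?y + h)) < e * h / 8"
          using M[OF mn, of "t + h"] by (simp add: dist_norm algebra_simps)
        moreover have "norm (f ?x - f ?y) < e * h / 8"
          using M[OF mn, of t] by (simp add: dist_norm)
        moreover note quot[OF h(1), of ?x] quot[OF h(1), of ?y]
        ultimately have "norm (h *\<^sub>R (f' ?x - f' ?y)) < e * h / 8 + e * h / 8 + h * (C * h) + h * (C * h)"
          by (smt (verit) norm_triangle_ineq norm_triangle_ineq4)
        also have "\<dots> \<le> e * h / 8 + e * h / 8 + h * (e / 4) + h * (e / 4)"
          using h by (intro add_mono mult_left_mono) auto
        also have "\<dots> < h * e" using h(1) e by (simp add: field_simps)
        finally show ?thesis using h(1) by (simp add: dist_norm)
      qed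
      thus "\<exists>M. \<forall>x\<in>UNIV. \<forall>m\<ge>M. \<forall>n\<ge>M. dist (f' (x + b (\<sigma> m))) (f' (x + b (\<sigma> n))) < e" by blast
    qed
    hence "uniformly_convergent_on UNIV (\<lambda>m t. f' (t + b (\<sigma> m)))"
      by (rule Cauchy_uniformly_convergent)
    thus ?thesis using \<sigma> unfolding uniformly_convergent_on_def by blast
  qed
  with cont show ?thesis by (simp add: AP_def)
qed

section \<open>Convolution with \<open>exp (- \<epsilon> \<bar>t\<bar>)\<close>\<close>

text \<open>For bounded measurable \<open>F\<close> this is
  \<open>J \<epsilon> F + J (- \<epsilon>) F\<close> (\<open>conv_eq_J\<close>), so
  \<open>conv \<beta>\<close> of the modulus of \<open>P\<theta> lam \<nu> \<theta>\<close> is the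
  bound claimed in the theorem. One symmetric kernel dominates both one-sided kernels.\<close>

definition conv :: "real \<Rightarrow> (real \<Rightarrow> real) \<Rightarrow> real \<Rightarrow> real" where
  "conv \<epsilon> F t = (LINT s|lborel. exp (- \<epsilon> * \<bar>t - s\<bar>) * F s)"

lemma exp_eq_kap: "\<epsilon> > 0 \<Longrightarrow> s \<noteq> t \<Longrightarrow> exp (- \<epsilon> * \<bar>t - s\<bar>) = kap \<epsilon> t s + kap (- \<epsilon>) t s"
  by (auto simp: kap_def abs_if algebra_simps)

lemma has_bochner_integral_exp_abs:
  fixes \<epsilon> :: real
  assumes "\<epsilon> > 0"
  shows "has_bochner_integral lborel (\<lambda>s. exp (- \<epsilon> * \<bar>t - s\<bar>)) (2 / \<epsilon>)"
proof -
  have 1: "has_bochner_integral lborel (\<lambda>s. kap \<epsilon> t s + kap (- \<epsilon>) t s) (2 / \<epsilon>)"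
    using has_bochner_integral_add[OF has_bochner_integral_kap[of \<epsilon> t] has_bochner_integral_kap[of "-\<epsilon>" t]] assms
    by simp
  have ae: "AE s in lborel. kap \<epsilon> t s + kap (- \<epsilon>) t s = exp (- \<epsilon> * \<bar>t - s\<bar>)"
    using AE_lborel_singleton[of t] by eventually_elim (metis exp_eq_kap assms)
  show ?thesis
    by (rule has_bochner_integral_cong_AE[THEN iffD1, OF _ _ ae 1]) measurable
qed

lemma integrable_exp_abs: "(\<epsilon>::real) > 0 \<Longrightarrow> integrable lborel (\<lambda>s. exp (- \<epsilon> * \<bar>t - s\<bar>))"
  and integral_exp_abs: "(\<epsilon>::real) > 0 \<Longrightarrow> (LINT s|lborel. exp (- \<epsilon> * \<bar>t - s\<bar>)) = 2 / \<epsilon>"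
  using has_bochner_integral_exp_abs[of \<epsilon> t] by (auto simp only: has_bochner_integral_iff)

context
  fixes \<epsilon> :: real and F :: "real \<Rightarrow> real"
  assumes eps: "\<epsilon> > 0" and Fm [measurable]: "F \<in> borel_measurable borel" and Fb: "bounded (range F)"
begin

lemma integrable_conv: "integrable lborel (\<lambda>s. exp (- \<epsilon> * \<bar>t - s\<bar>) * F s)"
  using integrable_bounded_mult[OF integrable_exp_abs[OF eps] Fm Fb] .

lemma conv_eq_J: "conv \<epsilon> F t = J \<epsilon> F t + J (- \<epsilon>) F t"
proof -
  have i: "integrable lborel (\<lambda>s. kap \<epsilon> t s * F s)" "integrable lborel (\<lambda>s. kap (-\<epsilon>) t s * F s)"
    using eps Fm Fb by (auto intro!: integrable_kap_mult)
  have "conv \<epsilon> F t = (LINT s|lborel. kap \<epsilon> t s * F s + kap (-\<epsilon>) t s * F s)"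
    unfolding conv_def
  proof (rule integral_cong_AE)
    show "AE s in lborel. exp (- \<epsilon> * \<bar>t - s\<bar>) * F s = kap \<epsilon> t s * F s + kap (- \<epsilon>) t s * F s"
      using AE_lborel_singleton[of t] by eventually_elim (metis exp_eq_kap eps distrib_right)
  qed measurable
  thus ?thesis unfolding J_def using Bochner_Integration.integral_add[OF i] by simp
qed

lemma conv_measurable: "conv \<epsilon> F \<in> borel_measurable borel"
  unfolding conv_def by measurable

context
  assumes nn: "\<And>s. 0 \<le> F s"
begin

lemma conv_nonneg: "0 \<le> conv \<epsilon> F t"
  unfolding conv_def by (intro integral_nonneg_AE) (auto simp: nn)

text \<open>Triangle inequality in the exponent. This slow variation allows the value at s under a
  Green integral to be replaced by the value at t, at the price of a growing factor in the
  kernel.\<close>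

lemma conv_growth: "conv \<epsilon> F s \<le> exp (\<epsilon> * \<bar>t - s\<bar>) * conv \<epsilon> F t"
proof -
  have "conv \<epsilon> F s \<le> (LINT u|lborel. exp (\<epsilon> * \<bar>t - s\<bar>) * (exp (- \<epsilon> * \<bar>t - u\<bar>) * F u))"
    unfolding conv_def
  proof (intro integral_mono integrable_mult_right integrable_conv)
    fix u
    have "\<epsilon> * \<bar>t - u\<bar> \<le> \<epsilon> * (\<bar>t - s\<bar> + \<bar>s - u\<bar>)" using eps by (intro mult_left_mono) auto
    hence "exp (- \<epsilon> * \<bar>s - u\<bar>) \<le> exp (\<epsilon> * \<bar>t - s\<bar> + - \<epsilon> * \<bar>t - u\<bar>)" by (simp add: algebra_simps)
    hence "exp (- \<epsilon> * \<bar>s - u\<bar>) * F u \<le> exp (\<epsilon> * \<bar>t - s\<bar>) * exp (- \<epsilon> * \<bar>t - u\<bar>) * F u"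
      by (intro mult_right_mono nn) (simp only: exp_add)
    thus "exp (- \<epsilon> * \<bar>s - u\<bar>) * F u \<le> exp (\<epsilon> * \<bar>t - s\<bar>) * (exp (- \<epsilon> * \<bar>t - u\<bar>) * F u)"
      by (simp only: mult.assoc)
  qed
  thus ?thesis by (simp add: conv_def)
qed

lemma J_le_conv:
  assumes "\<epsilon> \<le> \<bar>\<alpha>\<bar>"
  shows "J \<alpha> F t \<le> conv \<epsilon> F t"
  unfolding J_def conv_def
proof (intro integral_mono integrable_kap_mult integrable_conv mult_right_mono nn)
  fix s
  show "kap \<alpha> t s \<le> exp (- \<epsilon> * \<bar>t - s\<bar>)"
  proof (cases "sgn \<alpha> * (t - s) < 0")
    case True
    hence "\<alpha> * (t - s) = - (\<bar>\<alpha>\<bar> * \<bar>t - s\<bar>)" by (auto simp: sgn_if abs_if algebra_simps split: if_splits)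
    also have "\<dots> \<le> - (\<epsilon> * \<bar>t - s\<bar>)" using assms by (simp add: mult_right_mono)
    finally show ?thesis using True by (simp add: kap_def)
  qed (simp add: kap_def)
qed (use assms eps Fm Fb in auto)

end

lemma conv_tendsto_at_top:
  assumes "(F \<longlongrightarrow> 0) at_top"
  shows "(conv \<epsilon> F \<longlongrightarrow> 0) at_top"
proof -
  obtain B where B: "\<And>x. \<bar>F x\<bar> \<le> B" using Fb by (auto simp: bounded_iff)
  \<comment> \<open>Moving t from the kernel into \<open>F\<close> leaves a fixed integrable
    majorant for dominated convergence.\<close>
  have eq: "conv \<epsilon> F t = (LINT u|lborel. exp (- \<epsilon> * \<bar>0 - u\<bar>) * F (t + u))" for t
    unfolding conv_def by (subst lborel_integral_real_affine[of 1 _ t]) auto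
  have "((\<lambda>t. LINT u|lborel. exp (- \<epsilon> * \<bar>0 - u\<bar>) * F (t + u)) \<longlongrightarrow> integral\<^sup>L lborel (\<lambda>_::real. 0::real)) at_top"
  proof (rule integral_dominated_convergence_at_top)
    show "integrable lborel (\<lambda>u. exp (- \<epsilon> * \<bar>0 - u\<bar>) * B)"
      using integrable_exp_abs[OF eps, of 0] by (rule integrable_mult_left)
    show "AE u in lborel. ((\<lambda>t. exp (- \<epsilon> * \<bar>0 - u\<bar>) * F (t + u)) \<longlongrightarrow> 0) at_top"
    proof (rule AE_I2)
      fix u :: real
      have "filterlim (\<lambda>t. t + u) at_top at_top"
        using filterlim_tendsto_add_at_top[OF tendsto_const[of u] filterlim_ident] by (simp add: add.commute)
      thus "((\<lambda>t. exp (- \<epsilon> * \<bar>0 - u\<bar>) * F (t + u)) \<longlongrightarrow> 0) at_top"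
        by (intro tendsto_mult_right_zero filterlim_compose[OF assms])
    qed
    show "\<forall>\<^sub>F t in at_top. AE u in lborel. norm (exp (- \<epsilon> * \<bar>0 - u\<bar>) * F (t + u)) \<le> exp (- \<epsilon> * \<bar>0 - u\<bar>) * B"
      using B by (intro always_eventually allI AE_I2) (simp add: abs_mult)
  qed measurable
  thus ?thesis unfolding eq[abs_def] by simp
qed

end

lemma conv_tendsto_at_bot:
  assumes eps: "\<epsilon> > 0" and [measurable]: "F \<in> borel_measurable borel" and Fb: "bounded (range F)"
    and lim: "(F \<longlongrightarrow> 0) at_bot"
  shows "(conv \<epsilon> F \<longlongrightarrow> 0) at_bot"
proof -
  \<comment> \<open>The kernel is even, so reflection turns the limit at minus infinity into the one
    at plus infinity.\<close>
  have eq: "conv \<epsilon> (\<lambda>s. F (- s)) t = conv \<epsilon> F (- t)" for t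
    unfolding conv_def
    by (subst lborel_integral_real_affine[of "-1" _ 0]) (auto simp: abs_if intro!: Bochner_Integration.integral_cong)
  have "(conv \<epsilon> (\<lambda>s. F (- s)) \<longlongrightarrow> 0) at_top"
  proof (rule conv_tendsto_at_top[OF eps])
    show "bounded (range (\<lambda>s. F (- s)))" using Fb by (auto simp: bounded_iff)
    show "((\<lambda>s. F (- s)) \<longlongrightarrow> 0) at_top" using lim by (simp add: filterlim_at_bot_mirror)
  qed measurable
  thus ?thesis unfolding eq[abs_def] filterlim_at_bot_mirror[of "conv \<epsilon> F"] .
qed

lemma conv_bounded:
  assumes eps: "\<epsilon> > 0" and Fm: "F \<in> borel_measurable borel" and Fb: "bounded (range F)"
  shows "bounded (range (conv \<epsilon> F))"
proof -
  obtain B where B: "\<And>x. \<bar>F x\<bar> \<le> B" using Fb by (auto simp: bounded_iff)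
  have "norm (conv \<epsilon> F t) \<le> 2 / \<epsilon> * B" for t
  proof -
    have "norm (conv \<epsilon> F t) \<le> (LINT s|lborel. norm (exp (- \<epsilon> * \<bar>t - s\<bar>) * F s))"
      unfolding conv_def by (rule integral_norm_bound)
    also have "\<dots> \<le> (LINT s|lborel. exp (- \<epsilon> * \<bar>t - s\<bar>) * B)"
    proof (rule integral_mono)
      show "integrable lborel (\<lambda>s. norm (exp (- \<epsilon> * \<bar>t - s\<bar>) * F s))"
        by (intro integrable_norm integrable_conv eps Fm Fb)
      show "integrable lborel (\<lambda>s. exp (- \<epsilon> * \<bar>t - s\<bar>) * B)"
        by (intro integrable_mult_left integrable_exp_abs eps)
    qed (use B in \<open>simp add: abs_mult\<close>)
    also have "\<dots> = 2 / \<epsilon> * B" by (simp only: integral_mult_left_zero integral_exp_abs[OF eps])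
    finally show ?thesis .
  qed
  thus ?thesis by (auto simp: bounded_iff)
qed

text \<open>Fubini: the kernel has mass \<open>2 / \<epsilon>\<close> in either variable.\<close>

lemma integrable_conv_of_integrable:
  assumes eps: "\<epsilon> > 0" and H: "integrable lborel H"
  shows "integrable lborel (conv \<epsilon> H)"
proof -
  have [measurable]: "H \<in> borel_measurable borel" using borel_measurable_integrable[OF H] by simp
  have "integrable (lborel \<Otimes>\<^sub>M lborel) (\<lambda>(s, t). exp (- \<epsilon> * \<bar>t - s\<bar>) * H s)"
  proof (rule lborel_pair.Fubini_integrable)
    have sw: "(LINT t|lborel. exp (- \<epsilon> * \<bar>t - s\<bar>)) = 2 / \<epsilon>" "integrable lborel (\<lambda>t. exp (- \<epsilon> * \<bar>t - s\<bar>))" for s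
      using integral_exp_abs[OF eps, of s] integrable_exp_abs[OF eps, of s] by (auto simp only: abs_minus_commute)
    have "(LINT t|lborel. norm (exp (- \<epsilon> * \<bar>t - s\<bar>) * H s)) = 2 / \<epsilon> * norm (H s)" for s
      using sw(1) by (simp add: abs_mult)
    thus "integrable lborel (\<lambda>x. LINT y|lborel. norm (case (x, y) of (s, t) \<Rightarrow> exp (- \<epsilon> * \<bar>t - s\<bar>) * H s))"
      using H by (simp only: prod.case) (intro integrable_mult_right integrable_norm)
    show "AE x in lborel. integrable lborel (\<lambda>y. case (x, y) of (s, t) \<Rightarrow> exp (- \<epsilon> * \<bar>t - s\<bar>) * H s)"
      using sw(2) by (intro AE_I2) (simp only: prod.case, rule integrable_mult_left)
  qed measurable
  from lborel_pair.integrable_snd[OF this] show ?thesis by (simp add: conv_def[abs_def])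
qed

text \<open>Made for \<open>Lp0\<close>. The part of \<open>H\<close> on the negative half-line is
  only bounded, but seen from t \<ge> 0 its convolution is an exact multiple of
  \<open>exp (- \<epsilon> * t)\<close>. The part on the positive half-line is integrable over the
  whole line.\<close>

lemma set_integrable_conv_half_line:
  assumes eps: "\<epsilon> > 0" and [measurable]: "H \<in> borel_measurable borel" and Hb: "bounded (range H)"
    and H: "set_integrable lborel {0..} H"
  shows "set_integrable lborel {0..} (conv \<epsilon> H)"
proof -
  define H1 H2 where "H1 = (\<lambda>s. indicator {0..} s * H s)" and "H2 = (\<lambda>s. indicator {..<0} s * H s)"
  have [measurable]: "H1 \<in> borel_measurable borel" "H2 \<in> borel_measurable borel"
    unfolding H1_def H2_def by measurable
  have b: "bounded (range H1)" "bounded (range H2)"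
  proof -
    obtain B where B: "\<And>x. \<bar>H x\<bar> \<le> B" using Hb by (auto simp: bounded_iff)
    have "\<bar>H1 x\<bar> \<le> \<bar>B\<bar>" "\<bar>H2 x\<bar> \<le> \<bar>B\<bar>" for x
      using B[of x] by (auto simp: H1_def H2_def indicator_def)
    thus "bounded (range H1)" "bounded (range H2)" by (auto simp: bounded_iff)
  qed
  have c1: "conv \<epsilon> H t = conv \<epsilon> H1 t + conv \<epsilon> H2 t" for t
  proof -
    have "H s = H1 s + H2 s" for s by (auto simp: H1_def H2_def indicator_def)
    thus ?thesis unfolding conv_def
      using Bochner_Integration.integral_add[OF integrable_conv[OF eps _ b(1), of t] integrable_conv[OF eps _ b(2), of t]]
      by (simp add: distrib_left)
  qed
  have c2: "conv \<epsilon> H2 t = exp (- \<epsilon> * t) * conv \<epsilon> H2 0" if "t \<ge> 0" for t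
  proof -
    have "exp (- \<epsilon> * \<bar>t - s\<bar>) * H2 s = exp (- \<epsilon> * t) * (exp (- \<epsilon> * \<bar>0 - s\<bar>) * H2 s)" for s
      using that by (auto simp: H2_def indicator_def exp_add[symmetric] algebra_simps)
    thus ?thesis by (simp only: conv_def integral_mult_right_zero)
  qed
  have eq: "indicat_real {0..} t *\<^sub>R conv \<epsilon> H t =
      indicator {0..} t * conv \<epsilon> H1 t + indicator {0..} t * (exp (- \<epsilon> * t) * conv \<epsilon> H2 0)" for t
    using c1[of t] c2[of t] by (cases "t \<ge> 0") (simp_all only: simp_thms, simp_all)
  have "integrable lborel (conv \<epsilon> H1)"
    using H by (intro integrable_conv_of_integrable[OF eps]) (simp add: H1_def set_integrable_def)
  hence 1: "integrable lborel (\<lambda>t. indicat_real {0..} t * conv \<epsilon> H1 t)"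
    using integrable_mult_indicator[of "{0..}" lborel "conv \<epsilon> H1"] by simp
  have "integrable lborel (\<lambda>t. kap (-\<epsilon>) t 0)"
  proof -
    have "(\<lambda>t. kap (-\<epsilon>) t 0) = (\<lambda>t. kap \<epsilon> 0 t)" using eps by (auto simp: kap_def fun_eq_iff)
    thus ?thesis using eps by simp
  qed
  hence "integrable lborel (\<lambda>t. indicat_real {0..} t * exp (- \<epsilon> * t))"
  proof (rule integrable_cong_AE_imp)
    show "AE t in lborel. kap (- \<epsilon>) t 0 = indicat_real {0..} t * exp (- \<epsilon> * t)"
      using AE_lborel_singleton[of 0]
      by eventually_elim (use eps in \<open>auto simp: kap_def indicator_def\<close>)
  qed measurable
  hence 2: "integrable lborel (\<lambda>t. indicat_real {0..} t * (exp (- \<epsilon> * t) * conv \<epsilon> H2 0))"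
    unfolding mult.assoc[symmetric] by (rule integrable_mult_left)
  show ?thesis unfolding set_integrable_def eq
    by (rule Bochner_Integration.integrable_add[OF 1 2])
qed

text \<open>Convexity; x = 0 is treated by hand because the tangent argument runs on the open
  half-line.\<close>

lemma powr_tangent:
  fixes x y p :: real
  assumes "p \<ge> 1" "0 \<le> x" "0 < y"
  shows "y powr p + p * y powr (p - 1) * (x - y) \<le> x powr p"
proof (cases "x = 0")
  case True
  have "y powr p = y * y powr (p - 1)" using assms by (simp add: powr_diff)
  hence "y powr p + p * y powr (p - 1) * (x - y) = (1 - p) * y powr p"
    using True by (simp add: algebra_simps)
  also have "\<dots> \<le> 0" using assms by (simp add: mult_nonpos_nonneg)
  finally show ?thesis using True by simp
next
  case False
  have "x powr p - y powr p \<ge> (p * y powr (p - 1)) * (x - y)"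
  proof (rule convex_on_imp_above_tangent[OF powr_convex[OF assms(1)]])
    show "((\<lambda>x. x powr p) has_real_derivative p * y powr (p - 1)) (at y within {0<..})"
      using assms(3) by (auto intro!: derivative_eq_intros)
  qed (use assms False in \<open>auto simp: interior_open\<close>)
  thus ?thesis by simp
qed

text \<open>Jensen's inequality; \<open>2 / \<epsilon>\<close> is the total mass of the kernel.\<close>

lemma conv_powr_le:
  assumes eps: "\<epsilon> > 0" and [measurable]: "F \<in> borel_measurable borel" and Fb: "bounded (range F)"
    and nn: "\<And>s. 0 \<le> F s" and p: "p \<ge> 1"
  shows "conv \<epsilon> F t powr p \<le> (2 / \<epsilon>) powr (p - 1) * conv \<epsilon> (\<lambda>s. F s powr p) t"
proof -
  define m where "m = 2 / \<epsilon>"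
  have m: "m > 0" using eps by (simp add: m_def)
  define y where "y = conv \<epsilon> F t / m"
  have cF: "conv \<epsilon> F t = m * y" using m by (simp add: y_def)
  have y0: "y \<ge> 0" using conv_nonneg[OF eps _ Fb nn] m by (simp add: y_def)
  obtain B where B: "\<And>x. \<bar>F x\<bar> \<le> B" using Fb by (auto simp: bounded_iff)
  have b: "bounded (range (\<lambda>s. F s powr p))"
    unfolding bounded_iff
  proof (intro exI[of _ "B powr p"] ballI)
    fix x assume "x \<in> range (\<lambda>s. F s powr p)"
    then obtain s where "x = F s powr p" by auto
    moreover have "F s \<le> B" using B[of s] by linarith
    ultimately show "norm x \<le> B powr p" using nn p by (auto intro: powr_mono2)
  qed
  have nnp: "conv \<epsilon> (\<lambda>s. F s powr p) t \<ge> 0"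
    by (rule conv_nonneg[OF eps _ b]) auto
  show ?thesis
  proof (cases "y = 0")
    case True
    thus ?thesis using cF nnp p by simp
  next
    case False
    hence y: "y > 0" using y0 by simp
    let ?k = "\<lambda>s. exp (- \<epsilon> * \<bar>t - s\<bar>)"
    \<comment> \<open>Tangent line of the power at the kernel average \<open>y\<close>, integrated
      against the kernel of mass m. As m y is the integral of the kernel times \<open>F\<close>, the
      linear terms cancel and \<open>m * y powr p\<close> remains.\<close>
    let ?a = "y powr p - p * y powr (p - 1) * y" and ?b = "p * y powr (p - 1)"
    have ik: "integrable lborel (\<lambda>s. ?k s * F s powr p)" "integrable lborel (\<lambda>s. ?k s * F s)"
      by (rule integrable_conv[OF eps _ b], measurable) (rule integrable_conv[OF eps _ Fb], measurable)
    have "(LINT s|lborel. ?k s * ?a + ?b * (?k s * F s)) \<le> (LINT s|lborel. ?k s * F s powr p)"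
    proof (rule integral_mono)
      show "integrable lborel (\<lambda>s. ?k s * ?a + ?b * (?k s * F s))"
        by (intro Bochner_Integration.integrable_add integrable_mult_left integrable_mult_right integrable_exp_abs[OF eps] ik)
      fix s
      have "?k s * (?a + ?b * F s) \<le> ?k s * F s powr p"
        using powr_tangent[OF p nn y, of s] by (intro mult_left_mono) (auto simp: algebra_simps)
      thus "?k s * ?a + ?b * (?k s * F s) \<le> ?k s * F s powr p" by (simp add: algebra_simps)
    qed (rule ik)
    also have "(LINT s|lborel. ?k s * ?a + ?b * (?k s * F s)) = m * ?a + ?b * (m * y)"
    proof -
      have "(LINT s|lborel. ?k s * ?a + ?b * (?k s * F s)) =
        (LINT s|lborel. ?k s * ?a) + (LINT s|lborel. ?b * (?k s * F s))"
        by (intro Bochner_Integration.integral_add integrable_mult_left integrable_mult_right integrable_exp_abs[OF eps] ik)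
      also have "(LINT s|lborel. ?k s * ?a) = m * ?a"
        using integral_exp_abs[OF eps, of t] by (simp add: m_def)
      also have "(LINT s|lborel. ?b * (?k s * F s)) = ?b * (m * y)"
        using cF by (simp add: conv_def)
      finally show ?thesis .
    qed
    finally have *: "m * y powr p \<le> conv \<epsilon> (\<lambda>s. F s powr p) t"
      by (simp add: conv_def algebra_simps)
    have "(m * y) powr p = m powr (p - 1) * (m * y powr p)"
      using m y by (simp add: powr_mult powr_diff)
    also have "\<dots> \<le> m powr (p - 1) * conv \<epsilon> (\<lambda>s. F s powr p) t"
      using * by (intro mult_left_mono) auto
    finally show ?thesis unfolding cF by (simp add: m_def)
  qed
qed

text \<open>Within distance R of t the two kernels are comparable, and R can be chosen,
  independently of t, so that the rest of \<open>conv \<epsilon> F\<close> is below \<delta>/2.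
  Hence a lower bound at one rate gives one at any other, even a faster one.\<close>

lemma conv_lower_bound:
  assumes eps: "\<epsilon> > 0" "\<beta> > 0" and Fm [measurable]: "F \<in> borel_measurable borel" and Fb: "bounded (range F)"
    and nn: "\<And>s. 0 \<le> F s" and d: "\<delta> > 0"
  shows "\<exists>c>0. \<forall>t. \<delta> \<le> conv \<epsilon> F t \<longrightarrow> c \<le> conv \<beta> F t"
proof -
  obtain B where B: "\<And>x. \<bar>F x\<bar> \<le> B" using Fb by (auto simp: bounded_iff)
  hence B': "F x \<le> B" for x using abs_le_D1 by blast
  have B0: "B \<ge> 0" using B[of 0] by linarith
  have e2: "\<epsilon> / 2 > 0" using eps by simp
  \<comment> \<open>Beyond R the rate is split in half: one half gives smallness in R, the other
    keeps the tail integrable, with mass \<open>2 / (\<epsilon> / 2)\<close>.\<close>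
  have "((\<lambda>R. exp (- (\<epsilon> / 2) * R) * (B * (2 / (\<epsilon> / 2)))) \<longlongrightarrow> 0) at_top"
    by (intro tendsto_mult_left_zero filterlim_compose[OF exp_at_bot]
        filterlim_tendsto_neg_mult_at_bot[OF tendsto_const _ filterlim_ident]) (use eps in simp)
  hence "\<forall>\<^sub>F R in at_top. exp (- (\<epsilon> / 2) * R) * (B * (2 / (\<epsilon> / 2))) < \<delta> / 2"
    by (rule order_tendstoD) (use d in simp)
  then obtain R where R: "exp (- (\<epsilon> / 2) * R) * (B * (2 / (\<epsilon> / 2))) < \<delta> / 2"
    by (meson eventually_happens' trivial_limit_at_top_linorder)
  have "exp (- \<beta> * R) * (\<delta> / 2) \<le> conv \<beta> F t" if t: "\<delta> \<le> conv \<epsilon> F t" for t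
  proof -
    have "conv \<epsilon> F t \<le> (LINT s|lborel. exp (\<beta> * R) * (exp (- \<beta> * \<bar>t - s\<bar>) * F s)
        + exp (- (\<epsilon> / 2) * R) * (exp (- (\<epsilon> / 2) * \<bar>t - s\<bar>) * B))"
      unfolding conv_def
    proof (intro integral_mono Bochner_Integration.integrable_add integrable_mult_right integrable_mult_left integrable_conv
        integrable_exp_abs eps e2 Fm Fb)
      fix s
      let ?x = "\<bar>t - s\<bar>"
      show "exp (- \<epsilon> * ?x) * F s \<le> exp (\<beta> * R) * (exp (- \<beta> * ?x) * F s) +
          exp (- (\<epsilon> / 2) * R) * (exp (- (\<epsilon> / 2) * ?x) * B)"
      proof (cases "?x \<le> R")
        case True
        have "0 \<le> exp (- (\<epsilon> / 2) * R) * (exp (- (\<epsilon> / 2) * ?x) * B)" using B0 by simp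
        moreover have "exp (- \<epsilon> * ?x) \<le> exp (\<beta> * R) * exp (- \<beta> * ?x)"
        proof -
          have "exp (- \<epsilon> * ?x) \<le> 1" using eps by simp
          also have "0 \<le> \<beta> * R - \<beta> * ?x" using True eps by (simp add: mult_left_mono)
          hence "1 \<le> exp (\<beta> * R + - \<beta> * ?x)" by simp
          finally show ?thesis by (simp only: exp_add)
        qed
        from mult_right_mono[OF this nn[of s]] have "exp (- \<epsilon> * ?x) * F s \<le> exp (\<beta> * R) * (exp (- \<beta> * ?x) * F s)"
          by (simp only: mult.assoc)
        ultimately show ?thesis by linarith
      next
        case False
        have "\<epsilon> / 2 * R \<le> \<epsilon> / 2 * ?x" using False eps by (intro mult_left_mono) auto
        hence "exp (- \<epsilon> * ?x) \<le> exp (- (\<epsilon> / 2) * R + - (\<epsilon> / 2) * ?x)" by simp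
        hence "exp (- \<epsilon> * ?x) * F s \<le> (exp (- (\<epsilon> / 2) * R) * exp (- (\<epsilon> / 2) * ?x)) * B"
          using B'[of s] nn[of s] by (intro mult_mono) (auto simp only: exp_add exp_ge_zero mult_nonneg_nonneg)
        moreover have "0 \<le> exp (\<beta> * R) * (exp (- \<beta> * ?x) * F s)" using nn[of s] by simp
        ultimately show ?thesis by (simp only: mult.assoc)
      qed
    qed
    also have "\<dots> = exp (\<beta> * R) * conv \<beta> F t + exp (- (\<epsilon> / 2) * R) * (B * (2 / (\<epsilon> / 2)))"
    proof -
      have "(LINT s|lborel. exp (\<beta> * R) * (exp (- \<beta> * \<bar>t - s\<bar>) * F s)
        + exp (- (\<epsilon> / 2) * R) * (exp (- (\<epsilon> / 2) * \<bar>t - s\<bar>) * B)) =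
        (LINT s|lborel. exp (\<beta> * R) * (exp (- \<beta> * \<bar>t - s\<bar>) * F s)) +
        (LINT s|lborel. exp (- (\<epsilon> / 2) * R) * (exp (- (\<epsilon> / 2) * \<bar>t - s\<bar>) * B))"
        by (intro Bochner_Integration.integral_add integrable_mult_right integrable_mult_left integrable_conv
          integrable_exp_abs eps e2 Fm Fb)
      also have "(LINT s|lborel. exp (- (\<epsilon> / 2) * R) * (exp (- (\<epsilon> / 2) * \<bar>t - s\<bar>) * B)) =
          exp (- (\<epsilon> / 2) * R) * ((LINT s|lborel. exp (- (\<epsilon> / 2) * \<bar>t - s\<bar>)) * B)"
        by (simp only: integral_mult_right_zero integral_mult_left_zero)
      finally show ?thesis by (simp only: integral_exp_abs[OF e2] integral_mult_right_zero conv_def mult.commute[of B])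
    qed
    finally have "\<delta> / 2 \<le> exp (\<beta> * R) * conv \<beta> F t" using t R by linarith
    hence "exp (- \<beta> * R) * (\<delta> / 2) \<le> exp (- \<beta> * R) * (exp (\<beta> * R) * conv \<beta> F t)"
      by (intro mult_left_mono) auto
    also have "\<dots> = exp (- \<beta> * R + \<beta> * R) * conv \<beta> F t" by (simp only: exp_add mult.assoc)
    finally show ?thesis by simp
  qed
  moreover have "exp (- \<beta> * R) * (\<delta> / 2) > 0" using d by simp
  ultimately show ?thesis by blast
qed

section \<open>A comparison principle\<close>

text \<open>The supremum of \<open>n / (w + \<delta>)\<close> is finite since \<open>\<delta> > 0\<close>, even where \<open>w\<close> vanishes.\<close>

lemma comparison_principle:
  fixes n w :: "real \<Rightarrow> real" and K :: "real \<Rightarrow> real \<Rightarrow> real"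
  assumes n: "\<And>t. 0 \<le> n t" "\<And>t. n t \<le> B"
    and w: "\<And>t. 0 \<le> w t" "\<And>s t. w s \<le> exp (\<epsilon> * \<bar>t - s\<bar>) * w t" and eps: "\<epsilon> \<ge> 0"
    and K: "\<And>s t. 0 \<le> K t s" "\<And>t. integrable lborel (\<lambda>s. K t s * exp (\<epsilon> * \<bar>t - s\<bar>))"
      "\<And>t. (LINT s|lborel. K t s * exp (\<epsilon> * \<bar>t - s\<bar>)) \<le> k"
    and k: "k < 1" and C: "0 \<le> C"
    and ineq: "\<And>t. n t \<le> C * w t + (LINT s|lborel. K t s * n s)"
  shows "n t \<le> C / (1 - k) * w t"
proof -
  have main: "n t \<le> C / (1 - k) * (w t + \<delta>)" if d: "\<delta> > 0" for \<delta> t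
  proof -
    have B: "B \<ge> 0" using n[of 0] by linarith
    have wd: "w t + \<delta> > 0" for t using w(1)[of t] d by linarith
    define S where "S = (SUP t. n t / (w t + \<delta>))"
    have bdd: "bdd_above (range (\<lambda>t. n t / (w t + \<delta>)))"
    proof (rule bdd_aboveI2)
      fix t show "n t / (w t + \<delta>) \<le> B / \<delta>"
        using n w(1)[of t] d B by (intro frac_le) auto
    qed
    have le: "n t \<le> S * (w t + \<delta>)" for t
      using cSUP_upper[OF UNIV_I bdd, of t] wd[of t] by (simp add: S_def pos_divide_le_eq)
    have "0 \<le> n 0 / (w 0 + \<delta>)" using n(1)[of 0] wd[of 0] by (intro divide_nonneg_pos) auto
    also have "\<dots> \<le> S" unfolding S_def by (rule cSUP_upper[OF UNIV_I bdd])
    finally have S0: "S \<ge> 0" .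
    have step: "n t / (w t + \<delta>) \<le> C + k * S" for t
    proof -
      have "(LINT s|lborel. K t s * n s) \<le> (LINT s|lborel. K t s * exp (\<epsilon> * \<bar>t - s\<bar>) * (S * (w t + \<delta>)))"
      proof (rule integral_mono')
        show "integrable lborel (\<lambda>s. K t s * exp (\<epsilon> * \<bar>t - s\<bar>) * (S * (w t + \<delta>)))"
          using K(2) by (rule integrable_mult_left)
        fix s
        \<comment> \<open>Adding \<delta> keeps the growth condition of \<open>w\<close>, because
          the exponential factor is at least 1.\<close>
        have "1 \<le> exp (\<epsilon> * \<bar>t - s\<bar>)" using eps by simp
        hence "w s + \<delta> \<le> exp (\<epsilon> * \<bar>t - s\<bar>) * w t + exp (\<epsilon> * \<bar>t - s\<bar>) * \<delta>"
          using w(2)[of s t] d by (intro add_mono) auto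
        hence "S * (w s + \<delta>) \<le> S * (exp (\<epsilon> * \<bar>t - s\<bar>) * (w t + \<delta>))"
          using S0 by (intro mult_left_mono) (auto simp: distrib_left)
        with le[of s] have "n s \<le> exp (\<epsilon> * \<bar>t - s\<bar>) * (S * (w t + \<delta>))" by (simp add: mult.left_commute)
        hence "K t s * n s \<le> K t s * (exp (\<epsilon> * \<bar>t - s\<bar>) * (S * (w t + \<delta>)))"
          by (intro mult_left_mono K)
        thus "K t s * n s \<le> K t s * exp (\<epsilon> * \<bar>t - s\<bar>) * (S * (w t + \<delta>))"
          by (simp only: mult.assoc)
        show "0 \<le> K t s * exp (\<epsilon> * \<bar>t - s\<bar>) * (S * (w t + \<delta>))"
          using K(1) S0 wd[of t] by (intro mult_nonneg_nonneg) auto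
      qed
      also have "\<dots> = (LINT s|lborel. K t s * exp (\<epsilon> * \<bar>t - s\<bar>)) * (S * (w t + \<delta>))" by simp
      also have "\<dots> \<le> k * (S * (w t + \<delta>))"
        using K(3) S0 wd[of t] by (intro mult_right_mono) auto
      finally have "n t \<le> C * w t + k * (S * (w t + \<delta>))" using ineq[of t] by linarith
      also have "C * w t \<le> C * (w t + \<delta>)" using C d by (intro mult_left_mono) auto
      finally have "n t \<le> (C + k * S) * (w t + \<delta>)" by (simp add: algebra_simps)
      thus ?thesis using wd[of t] by (simp add: pos_divide_le_eq)
    qed
    \<comment> \<open>Finiteness of S is what permits absorbing \<open>k * S\<close>. The resulting
      bound on S does not involve \<delta>, which can then be sent to 0.\<close>
    have "S \<le> C + k * S" unfolding S_def[symmetric]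
      by (subst (1) S_def, rule cSUP_least) (use step in auto)
    hence "S \<le> C / (1 - k)" using k by (simp add: pos_le_divide_eq algebra_simps)
    hence "S * (w t + \<delta>) \<le> C / (1 - k) * (w t + \<delta>)" using wd[of t] by (intro mult_right_mono) auto
    with le[of t] show ?thesis by linarith
  qed
  have "((\<lambda>\<delta>. C / (1 - k) * (w t + \<delta>)) \<longlongrightarrow> C / (1 - k) * (w t + 0)) (at_right 0)"
    by (intro tendsto_intros)
  hence "n t \<le> C / (1 - k) * (w t + 0)"
    by (rule tendsto_lowerbound) (auto intro!: eventually_at_rightI[of 0 1] main simp del: times_divide_eq_left)
  thus ?thesis by simp
qed

text \<open>Weighting by the growth factor only slows the decay of the kernel. This is why the
  constants with index \<beta> are formed with shifted exponents: they are masses of weighted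
  kernels.\<close>

lemma kap_shift:
  assumes "0 \<le> \<beta>" "\<beta> < \<bar>\<alpha>\<bar>"
  shows "kap \<alpha> t s * exp (\<beta> * \<bar>t - s\<bar>) = kap (\<alpha> - sgn \<alpha> * \<beta>) t s"
  using assms by (auto simp: kap_def sgn_if abs_if exp_add[symmetric] algebra_simps split: if_splits)

lemma abs_shift:
  fixes \<alpha> \<beta> :: real
  assumes "0 \<le> \<beta>" "\<beta> < \<bar>\<alpha>\<bar>"
  shows "\<bar>\<alpha> - sgn \<alpha> * \<beta>\<bar> = \<bar>\<alpha>\<bar> - \<beta>" "\<alpha> - sgn \<alpha> * \<beta> \<noteq> 0"
  using assms by (auto simp: sgn_if abs_if split: if_splits)

text \<open>The weighted kernel lies above the original one, so in the difference R may be replaced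
  by its bound, which leaves a difference of two masses. This excess is uniform in t and vanishes as
  \<beta> tends to 0.\<close>

lemma J_shift_le:
  assumes "0 \<le> \<beta>" "\<beta> < \<bar>\<alpha>\<bar>" and [measurable]: "R \<in> borel_measurable borel" and nn: "\<And>s. 0 \<le> R s" and RB: "\<And>s. R s \<le> B"
  shows "J (\<alpha> - sgn \<alpha> * \<beta>) R t \<le> J \<alpha> R t + B * (1 / (\<bar>\<alpha>\<bar> - \<beta>) - 1 / \<bar>\<alpha>\<bar>)"
proof -
  let ?a = "\<alpha> - sgn \<alpha> * \<beta>"
  have nz: "\<alpha> \<noteq> 0" "?a \<noteq> 0" using assms abs_shift(2)[OF assms(1,2)] by auto
  have Rb: "bounded (range R)"
    using nn RB by (auto simp: bounded_iff intro!: exI[of _ B])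
  have "J ?a R t \<le> (LINT s|lborel. kap \<alpha> t s * R s + (B * kap ?a t s - B * kap \<alpha> t s))"
    unfolding J_def
  proof (intro integral_mono Bochner_Integration.integrable_add Bochner_Integration.integrable_diff integrable_mult_right
      integrable_kap_mult integrable_kap nz assms(3) Rb)
    fix s
    have "kap \<alpha> t s * 1 \<le> kap \<alpha> t s * exp (\<beta> * \<bar>t - s\<bar>)"
      using assms(1) by (intro mult_left_mono) auto
    hence "kap \<alpha> t s \<le> kap ?a t s" by (simp add: kap_shift[OF assms(1,2)])
    hence "(kap ?a t s - kap \<alpha> t s) * R s \<le> (kap ?a t s - kap \<alpha> t s) * B"
      by (intro mult_left_mono RB) simp
    thus "kap ?a t s * R s \<le> kap \<alpha> t s * R s + (B * kap ?a t s - B * kap \<alpha> t s)"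
      by (simp add: algebra_simps)
  qed
  also have "\<dots> = J \<alpha> R t + (B * (1 / \<bar>?a\<bar>) - B * (1 / \<bar>\<alpha>\<bar>))"
  proof -
    have "(LINT s|lborel. kap \<alpha> t s * R s + (B * kap ?a t s - B * kap \<alpha> t s)) =
      J \<alpha> R t + ((LINT s|lborel. B * kap ?a t s) - (LINT s|lborel. B * kap \<alpha> t s))"
      unfolding J_def
      by (subst Bochner_Integration.integral_add[OF _ Bochner_Integration.integrable_diff],
         (intro integrable_mult_right integrable_kap_mult integrable_kap nz assms(3) Rb)+,
         subst Bochner_Integration.integral_diff,
         (intro integrable_mult_right integrable_kap_mult integrable_kap nz assms(3) Rb refl)+)
    thus ?thesis by (simp only: integral_mult_right_zero integral_kap[OF nz(1)] integral_kap[OF nz(2)])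
  qed
  finally show ?thesis using abs_shift(1)[OF assms(1,2)] by (simp add: right_diff_distrib)
qed

section \<open>The operator \<open>G\<close>\<close>

text \<open>The derivative of \<open>G lam f\<close> (\<open>G_derivative\<close>): since
  \<open>1 / Gam lam 1 + 1 / Gam lam 2 = 0\<close>, no term in \<open>f\<close> itself
  survives.\<close>

definition Gd :: "(nat \<Rightarrow> complex) \<Rightarrow> (real \<Rightarrow> complex) \<Rightarrow> real \<Rightarrow> complex" where
  "Gd lam f t = (\<Sum>i\<in>{1,2}. gam lam i / Gam lam i * Gop (gam lam i) f t)"

definition wt :: "(nat \<Rightarrow> complex) \<Rightarrow> nat \<Rightarrow> real" where
  "wt lam i = (1 + norm (gam lam i)) / norm (lam 1 - lam 2)"

text \<open>Applied to the modulus of \<open>f\<close>, with \<beta> = 0, this majorises both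
  \<open>G\<close> and \<open>Gd\<close>, as 1 and \<open>norm (gam lam i)\<close> are at most the
  numerator of \<open>wt\<close>. One functional thus controls a pair in the maximum norm.\<close>

definition Jsum :: "(nat \<Rightarrow> complex) \<Rightarrow> real \<Rightarrow> (real \<Rightarrow> real) \<Rightarrow> real \<Rightarrow> real" where
  "Jsum lam \<beta> f t = (\<Sum>i\<in>{1,2}. wt lam i * J (shifted lam \<beta> i) f t)"

lemma BC_mult: "f \<in> BC \<Longrightarrow> g \<in> BC \<Longrightarrow> (\<lambda>t. f t * g t) \<in> BC"
proof -
  assume f: "f \<in> BC" and g: "g \<in> BC"
  obtain a b where ab: "\<And>t. norm (f t) \<le> a" "\<And>t. norm (g t) \<le> b"
    using f g by (auto simp: BC_def bounded_iff)
  have "norm (f t * g t) \<le> a * b" for t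
    unfolding norm_mult using ab order_trans[OF norm_ge_zero ab(1)] by (intro mult_mono) auto
  thus ?thesis using f g by (auto simp: BC_def bounded_iff intro!: continuous_intros)
qed

lemma BC_add: "f \<in> BC \<Longrightarrow> g \<in> BC \<Longrightarrow> (\<lambda>t. f t + g t) \<in> BC"
  by (auto simp: BC_def intro!: continuous_intros bounded_plus_comp)

lemma BC_diff: "f \<in> BC \<Longrightarrow> g \<in> BC \<Longrightarrow> (\<lambda>t. f t - g t) \<in> BC"
  by (auto simp: BC_def intro!: continuous_intros bounded_minus_comp)

lemma BC_const: "(\<lambda>t. c) \<in> BC"
  by (auto simp: BC_def)

lemma BC_power: "f \<in> BC \<Longrightarrow> (\<lambda>t. f t ^ n) \<in> BC"
  by (induction n) (auto intro: BC_const BC_mult)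

lemmas BC_intros = BC_mult BC_add BC_diff BC_const BC_power

lemma BC_I: "continuous_on UNIV f \<Longrightarrow> (\<And>t. norm (f t) \<le> c) \<Longrightarrow> f \<in> BC"
  by (auto simp: BC_def intro: boundedI)

lemma BC_norm:
  assumes "f \<in> BC"
  shows "(\<lambda>t. norm (f t)) \<in> borel_measurable borel" "bounded (range (\<lambda>t. norm (f t)))"
  using BC_D[OF assms] by (auto simp: bounded_iff)

lemma sum12: "(\<Sum>i\<in>{1,2::nat}. f i) = f 1 + f 2" for f :: "nat \<Rightarrow> 'a::comm_monoid_add"
  by simp

locale green_pair =
  fixes lam :: "nat \<Rightarrow> complex"
  assumes Re_lam: "Re (lam 0) \<noteq> Re (lam 1)" "Re (lam 0) \<noteq> Re (lam 2)" "Re (lam 1) \<noteq> Re (lam 2)"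
begin

lemma alph_nz: "i \<in> {1,2} \<Longrightarrow> alph lam i \<noteq> 0"
  using Re_lam by (auto simp: alph_def gam_def)

lemma Re_gam_nz: "i \<in> {1,2} \<Longrightarrow> Re (gam lam i) \<noteq> 0"
  using alph_nz by (simp add: alph_def)

lemma Re_gam: "Re (gam lam i) = alph lam i" by (simp add: alph_def)

lemma lam_diff_nz: "lam 1 - lam 2 \<noteq> 0" using Re_lam(3) by auto

lemma norm_Gam: "norm (Gam lam i) = norm (lam 1 - lam 2)"
  by (simp add: Gam_def norm_mult norm_power norm_minus_commute)

lemma wt_pos: "wt lam i > 0"
  using lam_diff_nz by (auto simp: wt_def intro!: divide_pos_pos add_pos_nonneg)

lemma shifted_0 [simp]: "shifted lam 0 i = alph lam i" by (simp add: shifted_def)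

context
  fixes f assumes f: "f \<in> BC"
begin

lemma integrable_gam: "i \<in> {1,2} \<Longrightarrow> integrable lborel (\<lambda>s. green (gam lam i) t s * f s)"
  using integrable_green_mult[OF Re_gam_nz] BC_D[OF f] by blast

lemma Gop_gam_derivative:
  "i \<in> {1,2} \<Longrightarrow> (Gop (gam lam i) f has_vector_derivative (f t + gam lam i * Gop (gam lam i) f t)) (at t)"
  using Gop_has_vector_derivative[OF integrable_gam Re_gam_nz] BC_D(1)[OF f] by blast

lemma G_derivative: "(G lam f has_vector_derivative Gd lam f t) (at t)"
proof -
  have c: "1 / Gam lam 1 * f t + 1 / Gam lam 2 * f t = 0"
    using lam_diff_nz by (simp add: Gam_def field_simps)
  have "((\<lambda>t. 1 / Gam lam 1 * Gop (gam lam 1) f t + 1 / Gam lam 2 * Gop (gam lam 2) f t)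
     has_vector_derivative (1 / Gam lam 1 * (f t + gam lam 1 * Gop (gam lam 1) f t)
       + 1 / Gam lam 2 * (f t + gam lam 2 * Gop (gam lam 2) f t))) (at t)"
    by (intro has_vector_derivative_add has_vector_derivative_mult_right Gop_gam_derivative) auto
  moreover have "1 / Gam lam 1 * (f t + gam lam 1 * Gop (gam lam 1) f t)
       + 1 / Gam lam 2 * (f t + gam lam 2 * Gop (gam lam 2) f t) = (1 / Gam lam 1 * f t + 1 / Gam lam 2 * f t) + Gd lam f t"
    unfolding Gd_def sum12 by (simp add: algebra_simps)
  ultimately show ?thesis unfolding G_def[abs_def] sum12 c by simp
qed

text \<open>Each \<open>gam lam i\<close> is a root of
  \<open>x^2 - (\<gamma>1 + \<gamma>2) x + \<gamma>1 \<gamma>2\<close>, and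
  \<open>\<gamma>1 / \<Gamma>1 + \<gamma>2 / \<Gamma>2 = 1\<close>. So \<open>G\<close> inverts the
  second-order operator with this characteristic polynomial.\<close>

lemma Gd_derivative:
  "(Gd lam f has_vector_derivative (f t + (gam lam 1 + gam lam 2) * Gd lam f t - gam lam 1 * gam lam 2 * G lam f t)) (at t)"
proof -
  have c: "gam lam 1 / Gam lam 1 + gam lam 2 / Gam lam 2 = 1"
  proof -
    have "gam lam 1 / Gam lam 1 + gam lam 2 / Gam lam 2 = (gam lam 1 - gam lam 2) / (lam 1 - lam 2)"
      using lam_diff_nz by (simp add: Gam_def divide_simps) (simp add: algebra_simps)
    thus ?thesis using lam_diff_nz by (simp add: gam_def)
  qed
  have "((\<lambda>t. gam lam 1 / Gam lam 1 * Gop (gam lam 1) f t + gam lam 2 / Gam lam 2 * Gop (gam lam 2) f t)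
     has_vector_derivative (gam lam 1 / Gam lam 1 * (f t + gam lam 1 * Gop (gam lam 1) f t)
       + gam lam 2 / Gam lam 2 * (f t + gam lam 2 * Gop (gam lam 2) f t))) (at t)"
    by (intro has_vector_derivative_add has_vector_derivative_mult_right Gop_gam_derivative) auto
  moreover have "gam lam 1 / Gam lam 1 * (f t + gam lam 1 * Gop (gam lam 1) f t)
       + gam lam 2 / Gam lam 2 * (f t + gam lam 2 * Gop (gam lam 2) f t) =
       (gam lam 1 / Gam lam 1 + gam lam 2 / Gam lam 2) * f t + (gam lam 1 + gam lam 2) * Gd lam f t
          - gam lam 1 * gam lam 2 * G lam f t"
    unfolding Gd_def G_def sum12 by (simp add: divide_inverse algebra_simps)
  ultimately show ?thesis unfolding Gd_def[abs_def] sum12 c by simp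
qed

lemma norm_G_le: "norm (G lam f t) \<le> Jsum lam 0 (\<lambda>s. norm (f s)) t"
  and norm_Gd_le: "norm (Gd lam f t) \<le> Jsum lam 0 (\<lambda>s. norm (f s)) t"
proof -
  have *: "norm (c / Gam lam i * Gop (gam lam i) f t) \<le> wt lam i * J (shifted lam 0 i) (\<lambda>s. norm (f s)) t"
    if "i \<in> {1,2}" "norm c \<le> 1 + norm (gam lam i)" for c i
  proof -
    have "norm (Gop (gam lam i) f t) \<le> J (shifted lam 0 i) (\<lambda>s. norm (f s)) t"
      using norm_Gop_le[OF Re_gam_nz[OF that(1)]] BC_D[OF f] by (simp add: Re_gam)
    moreover have "norm (c / Gam lam i) \<le> wt lam i"
      unfolding wt_def norm_divide norm_Gam using that(2) by (intro divide_right_mono) auto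
    ultimately show ?thesis unfolding norm_mult using wt_pos[of i] by (intro mult_mono) auto
  qed
  show "norm (G lam f t) \<le> Jsum lam 0 (\<lambda>s. norm (f s)) t"
    unfolding G_def Jsum_def by (intro sum_norm_le *) auto
  show "norm (Gd lam f t) \<le> Jsum lam 0 (\<lambda>s. norm (f s)) t"
    unfolding Gd_def Jsum_def by (intro sum_norm_le *) auto
qed

lemma G_continuous: "continuous_on UNIV (G lam f)"
  using G_derivative has_vector_derivative_continuous continuous_at_imp_continuous_on by blast

lemma Gd_continuous: "continuous_on UNIV (Gd lam f)"
  using Gd_derivative has_vector_derivative_continuous continuous_at_imp_continuous_on by blast

end

lemma Gop_diff:
  assumes "f \<in> BC" "g \<in> BC" "i \<in> {1,2}"
  shows "Gop (gam lam i) (\<lambda>s. f s - g s) t = Gop (gam lam i) f t - Gop (gam lam i) g t"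
  using Bochner_Integration.integral_diff[OF integrable_gam[OF assms(1,3)] integrable_gam[OF assms(2,3)]]
  by (simp add: Gop_def right_diff_distrib)

lemma G_diff:
  assumes "f \<in> BC" "g \<in> BC"
  shows "G lam (\<lambda>s. f s - g s) t = G lam f t - G lam g t" "Gd lam (\<lambda>s. f s - g s) t = Gd lam f t - Gd lam g t"
  unfolding G_def Gd_def sum12 by (simp_all add: Gop_diff assms algebra_simps)

lemma shifted_nz:
  assumes "0 \<le> \<beta>" "\<beta> < min \<bar>alph lam 1\<bar> \<bar>alph lam 2\<bar>" "i \<in> {1,2}"
  shows "\<bar>shifted lam \<beta> i\<bar> = \<bar>alph lam i\<bar> - \<beta>" "shifted lam \<beta> i \<noteq> 0"
  unfolding shifted_def using assms abs_shift[of \<beta> "alph lam i"] by auto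

context
  fixes \<beta> assumes \<beta>: "0 \<le> \<beta>" "\<beta> < min \<bar>alph lam 1\<bar> \<bar>alph lam 2\<bar>"
begin

lemma Jsum_mono:
  assumes "f \<in> borel_measurable borel" "bounded (range f)"
    "g \<in> borel_measurable borel" "bounded (range g)" "\<And>s. f s \<le> g s"
  shows "Jsum lam \<beta> f t \<le> Jsum lam \<beta> g t"
  unfolding Jsum_def using wt_pos
  by (intro sum_mono mult_left_mono J_mono assms shifted_nz(2)[OF \<beta>]) (auto simp: less_imp_le)

lemma Jsum_add:
  assumes "f \<in> borel_measurable borel" "bounded (range f)"
    "g \<in> borel_measurable borel" "bounded (range g)"
  shows "Jsum lam \<beta> (\<lambda>s. f s + g s) t = Jsum lam \<beta> f t + Jsum lam \<beta> g t"
  unfolding Jsum_def sum12 using J_add[OF shifted_nz(2)[OF \<beta>] assms] by (simp add: algebra_simps)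

lemma Jsum_cmult: "Jsum lam \<beta> (\<lambda>s. c * f s) t = c * Jsum lam \<beta> f t"
  unfolding Jsum_def sum12 J_cmult by (simp add: algebra_simps)

lemma Jsum_const: "Jsum lam \<beta> (\<lambda>s. c) t = c * (\<Sum>i\<in>{1,2}. wt lam i / (\<bar>alph lam i\<bar> - \<beta>))"
proof -
  have "wt lam i * J (shifted lam \<beta> i) (\<lambda>s. c) t = c * (wt lam i / (\<bar>alph lam i\<bar> - \<beta>))" if "i \<in> {1,2}" for i
    using shifted_nz[OF \<beta> that] by (simp add: J_const)
  thus ?thesis unfolding Jsum_def by (simp add: distrib_left)
qed

end

end

section \<open>The fixed point\<close>

text \<open>\<open>Npsi\<close> with the derivative made an independent variable \<open>v\<close>.
  In the application \<open>A\<close> is \<open>r\<theta>\<close>, \<open>B\<close> is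
  \<open>r 2 + 3 * \<theta>\<close> and \<open>k\<close> is \<open>3 * lam 0 + a 2\<close>, so that
  \<open>k + B\<close> is the coefficient of the square.\<close>

definition nl :: "(real \<Rightarrow> complex) \<Rightarrow> (real \<Rightarrow> complex) \<Rightarrow> (real \<Rightarrow> complex) \<Rightarrow> complex \<Rightarrow>
    (real \<Rightarrow> complex) \<Rightarrow> (real \<Rightarrow> complex) \<Rightarrow> real \<Rightarrow> complex" where
  "nl f0 A B k u v s = f0 s + A s * u s + B s * v s + (k + B s) * (u s)\<^sup>2 + 3 * u s * v s + (u s) ^ 3"

lemma BC_nl: "f0 \<in> BC \<Longrightarrow> A \<in> BC \<Longrightarrow> B \<in> BC \<Longrightarrow> u \<in> BC \<Longrightarrow> v \<in> BC \<Longrightarrow> nl f0 A B k u v \<in> BC"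
  unfolding nl_def[abs_def] by (intro BC_intros)

lemma cubic_bound:
  fixes a b k u v :: complex
  assumes u: "norm u \<le> n" and v: "norm v \<le> n"
  shows "norm (a * u + b * v + (k + b) * u\<^sup>2 + 3 * u * v + u ^ 3)
     \<le> (norm a + norm b) * n + (norm k + norm b + 3 + n) * n\<^sup>2"
proof -
  have n: "0 \<le> n" using u norm_ge_zero order_trans by blast
  have 1: "norm (a * u) \<le> norm a * n" "norm (b * v) \<le> norm b * n"
    unfolding norm_mult using u v by (auto intro: mult_left_mono)
  have 2: "norm ((k + b) * u\<^sup>2) \<le> (norm k + norm b) * n\<^sup>2"
    unfolding norm_mult norm_power using u by (intro mult_mono norm_triangle_ineq power_mono) auto
  have 3: "norm (3 * u * v) \<le> 3 * n\<^sup>2"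
    unfolding norm_mult power2_eq_square using u v n
    by (simp add: mult.assoc mult_mono)
  have 4: "norm (u ^ 3) \<le> n ^ 3" unfolding norm_power using u by (intro power_mono) auto
  have "norm (a * u + b * v + (k + b) * u\<^sup>2 + 3 * u * v + u ^ 3) \<le>
      norm a * n + norm b * n + (norm k + norm b) * n\<^sup>2 + 3 * n\<^sup>2 + n ^ 3"
    by (intro 1 2 3 4 norm_triangle_mono)
  also have "\<dots> = (norm a + norm b) * n + (norm k + norm b + 3 + n) * n\<^sup>2"
    by (simp add: algebra_simps power2_eq_square power3_eq_cube)
  finally show ?thesis .
qed

lemma cubic_lipschitz:
  fixes a b k u v u' v' :: complex
  assumes u: "norm u \<le> \<rho>" "norm u' \<le> \<rho>" and v: "norm v \<le> \<rho>" "norm v' \<le> \<rho>"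
    and d: "norm (u - u') \<le> d" "norm (v - v') \<le> d"
  shows "norm ((a * u + b * v + (k + b) * u\<^sup>2 + 3 * u * v + u ^ 3) -
      (a * u' + b * v' + (k + b) * u'\<^sup>2 + 3 * u' * v' + u' ^ 3))
     \<le> ((norm a + norm b) + (2 * (norm k + norm b) + 6) * \<rho> + 3 * \<rho>\<^sup>2) * d"
proof -
  have \<rho>: "0 \<le> \<rho>" and d0: "0 \<le> d" using u d norm_ge_zero order_trans by blast+
  have 1: "norm (a * (u - u')) \<le> norm a * d" "norm (b * (v - v')) \<le> norm b * d"
    unfolding norm_mult using d by (auto intro: mult_left_mono)
  have s: "norm (u + u') \<le> 2 * \<rho>" using norm_triangle_mono[OF u] by simp
  have 2: "norm ((k + b) * ((u + u') * (u - u'))) \<le> (norm k + norm b) * (2 * \<rho> * d)"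
    unfolding norm_mult using s d \<rho> by (intro mult_mono norm_triangle_ineq) auto
  have 3: "norm (3 * (u * (v - v'))) \<le> 3 * (\<rho> * d)" "norm (3 * (v' * (u - u'))) \<le> 3 * (\<rho> * d)"
    unfolding norm_mult using u v d \<rho> by (auto intro!: mult_mono)
  have 4: "norm ((u\<^sup>2 + u * u' + u'\<^sup>2) * (u - u')) \<le> (\<rho>\<^sup>2 + \<rho> * \<rho> + \<rho>\<^sup>2) * d"
  proof -
    have "norm (u\<^sup>2) \<le> \<rho>\<^sup>2" "norm (u * u') \<le> \<rho> * \<rho>" "norm (u'\<^sup>2) \<le> \<rho>\<^sup>2"
      unfolding norm_mult norm_power using u \<rho> by (auto intro!: mult_mono power_mono)
    hence "norm (u\<^sup>2 + u * u' + u'\<^sup>2) \<le> \<rho>\<^sup>2 + \<rho> * \<rho> + \<rho>\<^sup>2" by (intro norm_triangle_mono)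
    thus ?thesis unfolding norm_mult using d \<rho> by (intro mult_mono) auto
  qed
  \<comment> \<open>Each monomial is telescoped so that exactly one factor is a difference;
    \<open>u * v - u' * v'\<close> becomes \<open>u * (v - v') + v' * (u - u')\<close>.\<close>
  have "(a * u + b * v + (k + b) * u\<^sup>2 + 3 * u * v + u ^ 3) -
      (a * u' + b * v' + (k + b) * u'\<^sup>2 + 3 * u' * v' + u' ^ 3) =
      a * (u - u') + b * (v - v') + (k + b) * ((u + u') * (u - u')) + 3 * (u * (v - v')) + 3 * (v' * (u - u'))
        + (u\<^sup>2 + u * u' + u'\<^sup>2) * (u - u')"
    by (simp add: algebra_simps power2_eq_square power3_eq_cube)
  also have "norm \<dots> \<le> norm a * d + norm b * d + (norm k + norm b) * (2 * \<rho> * d) + 3 * (\<rho> * d) + 3 * (\<rho> * d)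
     + (\<rho>\<^sup>2 + \<rho> * \<rho> + \<rho>\<^sup>2) * d"
    by (intro norm_triangle_mono 1 2 3 4)
  also have "\<dots> = ((norm a + norm b) + (2 * (norm k + norm b) + 6) * \<rho> + 3 * \<rho>\<^sup>2) * d"
    by (simp add: algebra_simps power2_eq_square)
  finally show ?thesis .
qed

text \<open>A pair of functions is stored as a single function on the plane, whose supremum norm is the maximum of
  the two supremum norms; the metric of the product type would be the Euclidean one.\<close>

definition enc :: "(real \<Rightarrow> complex) \<Rightarrow> (real \<Rightarrow> complex) \<Rightarrow> real \<times> real \<Rightarrow> complex" where
  "enc u v = (\<lambda>(t, x). of_real (1 - max 0 (min 1 x)) * u t + of_real (max 0 (min 1 x)) * v t)"

lemma enc_simps [simp]: "enc u v (t, 0) = u t" "enc u v (t, 1) = v t"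
  by (simp_all add: enc_def)

lemma enc_diff: "enc u v p - enc u' v' p = enc (\<lambda>t. u t - u' t) (\<lambda>t. v t - v' t) p"
  by (simp add: enc_def algebra_simps split: prod.split)

lemma norm_enc_le:
  assumes "\<And>t. norm (u t) \<le> b" "\<And>t. norm (v t) \<le> b"
  shows "norm (enc u v p) \<le> b"
proof -
  obtain t x where p: "p = (t, x)" by (cases p)
  define c where "c = max 0 (min 1 x)"
  have c: "0 \<le> c" "c \<le> 1" by (auto simp: c_def)
  have "norm (enc u v p) \<le> norm (of_real (1 - c) * u t) + norm (of_real c * v t)"
    unfolding p enc_def c_def prod.case by (rule norm_triangle_ineq)
  also have "\<dots> = (1 - c) * norm (u t) + c * norm (v t)"
    using c by (simp add: norm_mult del: of_real_diff)
  also have "\<dots> \<le> (1 - c) * b + c * b"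
    using c assms by (intro add_mono mult_left_mono) auto
  finally show ?thesis by (simp add: algebra_simps)
qed

lemma continuous_on_enc:
  assumes "continuous_on UNIV u" "continuous_on UNIV v"
  shows "continuous_on UNIV (enc u v)"
  unfolding enc_def case_prod_beta
  by (intro continuous_intros continuous_on_compose2[OF assms(1)] continuous_on_compose2[OF assms(2)]) auto

text \<open>\<open>\<kappa>\<close>, \<open>\<tau>\<close>, \<open>\<rho>\<close> stand for
  \<open>L0\<close>, \<open>Q0\<close>, \<open>M\<close>, and \<open>rho_eq\<close> is the quadratic
  equation whose positive root is \<open>M\<close>. The condition on \<open>q\<close> lets the pure
  constants of the nonlinearity be charged to \<tau>.\<close>

locale small_nonlinearity = green_pair lam for lam +
  fixes f0 A B :: "real \<Rightarrow> complex" and k :: complex and q \<kappa> \<tau> \<rho> :: real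
  assumes BC: "f0 \<in> BC" "A \<in> BC" "B \<in> BC"
    and q: "1 + norm k \<le> q"
    and \<kappa>: "\<And>t. Jsum lam 0 (\<lambda>s. norm (A s) + norm (B s)) t \<le> \<kappa>"
    and \<tau>: "\<And>t. Jsum lam 0 (\<lambda>s. q + norm (B s)) t \<le> \<tau>"
    and tau_pos: "\<tau> > 0" and rho_pos: "\<rho> > 0" and rho_eq: "1 - \<kappa> = 9 * \<tau> * \<rho>\<^sup>2 + 6 * \<tau> * \<rho>"
    and f0_small: "\<And>t. norm (G lam f0 t) \<le> \<rho> * (2 / 3 * (1 - \<kappa>) - \<tau> * \<rho>)"
      "\<And>t. norm (Gd lam f0 t) \<le> \<rho> * (2 / 3 * (1 - \<kappa>) - \<tau> * \<rho>)"
begin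

abbreviation "N \<equiv> nl f0 A B k"

text \<open>The common form of the estimates for self-map and contraction: linear coefficients are
  charged to \<kappa>, higher-order terms to \<tau>.\<close>

lemma Jsum_bound:
  assumes h: "h \<in> BC" and c: "0 \<le> c1" "0 \<le> c2"
    and le: "\<And>s. norm (h s) \<le> c1 * (norm (A s) + norm (B s)) + c2 * (q + norm (B s))"
  shows "Jsum lam 0 (\<lambda>s. norm (h s)) t \<le> c1 * \<kappa> + c2 * \<tau>"
proof -
  note z = alph_nz[of 1] alph_nz[of 2]
  have \<beta>: "(0::real) \<le> 0" "0 < min \<bar>alph lam 1\<bar> \<bar>alph lam 2\<bar>" using z by auto
  have b: "bounded (range (\<lambda>s. c1 * (norm (A s) + norm (B s))))" "bounded (range (\<lambda>s. c2 * (q + norm (B s))))"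
    "bounded (range (\<lambda>s. c1 * (norm (A s) + norm (B s)) + c2 * (q + norm (B s))))"
  proof -
    obtain a b where ab: "\<And>s. norm (A s) \<le> a" "\<And>s. norm (B s) \<le> b"
      using BC_D(2)[OF BC(2)] BC_D(2)[OF BC(3)] by (auto simp: bounded_iff)
    have q0: "0 \<le> q" using q norm_ge_zero[of k] by linarith
    have 1: "norm (c1 * (norm (A s) + norm (B s))) \<le> c1 * (a + b)" for s
      using ab[of s] c by (simp add: abs_mult) (intro mult_left_mono add_mono)
    have 2: "norm (c2 * (q + norm (B s))) \<le> c2 * (q + b)" for s
      using ab[of s] c q0 by (simp add: abs_mult) (intro mult_left_mono add_mono; simp)
    show "bounded (range (\<lambda>s. c1 * (norm (A s) + norm (B s))))" "bounded (range (\<lambda>s. c2 * (q + norm (B s))))"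
      using 1 2 by (auto intro!: boundedI)
    thus "bounded (range (\<lambda>s. c1 * (norm (A s) + norm (B s)) + c2 * (q + norm (B s))))"
      by (rule bounded_plus_comp)
  qed
  have m: "(\<lambda>s. c1 * (norm (A s) + norm (B s))) \<in> borel_measurable borel"
    "(\<lambda>s. c2 * (q + norm (B s))) \<in> borel_measurable borel"
    using BC_D(3)[OF BC(2)] BC_D(3)[OF BC(3)] by measurable
  have "Jsum lam 0 (\<lambda>s. norm (h s)) t \<le> Jsum lam 0 (\<lambda>s. c1 * (norm (A s) + norm (B s)) + c2 * (q + norm (B s))) t"
    using m by (intro Jsum_mono[OF \<beta>] BC_norm[OF h] le b) simp
  also have "\<dots> = c1 * Jsum lam 0 (\<lambda>s. norm (A s) + norm (B s)) t + c2 * Jsum lam 0 (\<lambda>s. q + norm (B s)) t"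
    by (simp only: Jsum_add[OF \<beta> m(1) b(1) m(2) b(2)] Jsum_cmult[OF \<beta>])
  also have "\<dots> \<le> c1 * \<kappa> + c2 * \<tau>"
    using \<kappa> \<tau> c by (intro add_mono mult_left_mono)
  finally show ?thesis .
qed

lemma fixed_point:
  obtains u v where "u \<in> BC" "v \<in> BC" "\<And>t. norm (u t) \<le> \<rho>" "\<And>t. norm (v t) \<le> \<rho>"
    "\<And>t. u t = - G lam (N u v) t" "\<And>t. v t = - Gd lam (N u v) t"
proof -
  define U V where "U = (\<lambda>(F :: (real \<times> real) \<Rightarrow>\<^sub>C complex) t. F (t, 0))"
    and "V = (\<lambda>(F :: (real \<times> real) \<Rightarrow>\<^sub>C complex) t. F (t, 1))"
  define T0 where "T0 = (\<lambda>F. enc (\<lambda>t. - G lam (N (U F) (V F)) t) (\<lambda>t. - Gd lam (N (U F) (V F)) t))"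
  define T where "T = (\<lambda>F. Bcontfun (T0 F))"
  define S where "S = (cball 0 \<rho> :: ((real \<times> real) \<Rightarrow>\<^sub>C complex) set)"
  have UV: "norm (U F t) \<le> \<rho>" "norm (V F t) \<le> \<rho>" if "F \<in> S" for F t
    using norm_bounded[of F "(t, 0)"] norm_bounded[of F "(t, 1)"] that by (auto simp: S_def U_def V_def)
  have cF: "continuous_on UNIV (\<lambda>t. F (t, x))" for F :: "(real \<times> real) \<Rightarrow>\<^sub>C complex" and x :: real
    by (rule continuous_on_compose2[of UNIV F]) (auto intro!: continuous_intros)
  have UVBC: "U F \<in> BC" "V F \<in> BC" for F
    by (rule BC_I[of _ "norm F"]; auto simp: U_def V_def intro: cF norm_bounded)+
  have NBC: "N (U F) (V F) \<in> BC" for F by (intro BC_nl BC UVBC)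
  have N0: "N u v s - f0 s = A s * u s + B s * v s + (k + B s) * (u s)\<^sup>2 + 3 * u s * v s + (u s) ^ 3" for u v s
    by (simp add: nl_def)
  have inv: "norm (G lam (N (U F) (V F)) t) \<le> \<rho>" "norm (Gd lam (N (U F) (V F)) t) \<le> \<rho>" if F: "F \<in> S" for F t
  proof -
    let ?h = "\<lambda>s. N (U F) (V F) s - f0 s"
    have h: "?h \<in> BC" by (intro BC_diff NBC BC)
    have "Jsum lam 0 (\<lambda>s. norm (?h s)) t \<le> \<rho> * \<kappa> + (3 * \<rho>\<^sup>2 + \<rho> ^ 3) * \<tau>"
    proof (rule Jsum_bound[OF h])
      fix s
      have "norm (?h s) \<le> (norm (A s) + norm (B s)) * \<rho> + (norm k + norm (B s) + 3 + \<rho>) * \<rho>\<^sup>2"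
        unfolding N0 by (rule cubic_bound) (rule UV[OF F])+
      also have "(norm k + norm (B s) + 3 + \<rho>) * \<rho>\<^sup>2 \<le> ((3 + \<rho>) * (q + norm (B s))) * \<rho>\<^sup>2"
      proof (intro mult_right_mono)
        have "\<rho> * 1 \<le> \<rho> * (q + norm (B s))"
          using q rho_pos by (intro mult_left_mono) (smt (verit) norm_ge_zero)+
        moreover have "norm k + norm (B s) + 3 \<le> 3 * (q + norm (B s))"
          using q by (smt (verit) norm_ge_zero)
        ultimately show "norm k + norm (B s) + 3 + \<rho> \<le> (3 + \<rho>) * (q + norm (B s))"
          by (simp add: distrib_right)
      qed simp
      finally show "norm (?h s) \<le> \<rho> * (norm (A s) + norm (B s)) + (3 * \<rho>\<^sup>2 + \<rho> ^ 3) * (q + norm (B s))"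
        by (simp add: algebra_simps power2_eq_square power3_eq_cube)
    qed (use rho_pos in auto)
    \<comment> \<open>By \<open>rho_eq\<close> the left side equals
      \<open>\<rho> - 2 * \<tau> * \<rho>^3\<close>; the smallness bound on \<open>f0\<close> has
      exactly the form for which the terms \<open>\<tau> * \<rho>^2\<close> cancel.\<close>
    moreover have "\<rho> * (2 / 3 * (1 - \<kappa>) - \<tau> * \<rho>) + (\<rho> * \<kappa> + (3 * \<rho>\<^sup>2 + \<rho> ^ 3) * \<tau>) \<le> \<rho>"
    proof -
      have "\<rho> * \<kappa> = \<rho> - \<rho> * (9 * \<tau> * \<rho>\<^sup>2 + 6 * \<tau> * \<rho>)" using rho_eq by (metis diff_diff_eq2 add_diff_cancel_left' mult.right_neutral right_diff_distrib)
      moreover have "0 \<le> \<rho> ^ 3 * \<tau>" using rho_pos tau_pos by simp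
      ultimately show ?thesis unfolding rho_eq by (simp add: algebra_simps power2_eq_square power3_eq_cube)
    qed
    moreover have "G lam (N (U F) (V F)) t = G lam ?h t + G lam f0 t" "Gd lam (N (U F) (V F)) t = Gd lam ?h t + Gd lam f0 t"
      using G_diff[OF NBC BC(1)] by simp_all
    ultimately show "norm (G lam (N (U F) (V F)) t) \<le> \<rho>" "norm (Gd lam (N (U F) (V F)) t) \<le> \<rho>"
      using norm_G_le[OF h, of t] norm_Gd_le[OF h, of t] f0_small[of t]
        norm_triangle_ineq[of "G lam ?h t" "G lam f0 t"] norm_triangle_ineq[of "Gd lam ?h t" "Gd lam f0 t"] by auto
  qed
  \<comment> \<open>\<open>T\<close> is total, and \<open>Bcontfun\<close> is meaningful only on
    bounded continuous functions. Outside the ball \<open>inv\<close> says nothing, so a crude bound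
    depending on F is supplied.\<close>
  have GBC: "\<exists>b. \<forall>t. norm (G lam (N (U F) (V F)) t) \<le> b \<and> norm (Gd lam (N (U F) (V F)) t) \<le> b" for F
  proof -
    obtain b where b: "\<And>s. norm (N (U F) (V F) s) \<le> b"
      using BC_D(2)[OF NBC[of F]] by (auto simp: bounded_iff)
    have "Jsum lam 0 (\<lambda>s. norm (N (U F) (V F) s)) t \<le> Jsum lam 0 (\<lambda>s. b) 0" for t
    proof -
      have \<beta>: "(0::real) \<le> 0" "0 < min \<bar>alph lam 1\<bar> \<bar>alph lam 2\<bar>" using alph_nz[of 1] alph_nz[of 2] by auto
      have "Jsum lam 0 (\<lambda>s. norm (N (U F) (V F) s)) t \<le> Jsum lam 0 (\<lambda>s. b) t"
        by (intro Jsum_mono[OF \<beta>] BC_norm NBC b) auto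
      thus ?thesis by (simp only: Jsum_const[OF \<beta>])
    qed
    thus ?thesis using norm_G_le[OF NBC] norm_Gd_le[OF NBC] order_trans by blast
  qed
  have T: "apply_bcontfun (T F) = T0 F" for F
    unfolding T_def
  proof (rule Bcontfun_inverse)
    obtain b where "\<forall>t. norm (G lam (N (U F) (V F)) t) \<le> b \<and> norm (Gd lam (N (U F) (V F)) t) \<le> b"
      using GBC by blast
    thus "T0 F \<in> bcontfun" unfolding T0_def
      by (intro bcontfun_normI continuous_on_enc norm_enc_le continuous_intros G_continuous Gd_continuous NBC) auto
  qed
  \<comment> \<open>The Lipschitz constant of \<open>T\<close> on the ball; by \<open>rho_eq\<close>
    it equals \<open>1 - 6 * \<tau> * \<rho>^2\<close>.\<close>
  define c where "c = \<kappa> + (6 * \<rho> + 3 * \<rho>\<^sup>2) * \<tau>"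
  have L0: "0 \<le> \<kappa>"
  proof -
    have "0 \<le> Jsum lam 0 (\<lambda>s. norm (A s) + norm (B s)) 0"
      unfolding Jsum_def using wt_pos by (intro sum_nonneg mult_nonneg_nonneg J_nonneg) (auto simp: less_imp_le)
    with \<kappa>[of 0] show ?thesis by linarith
  qed
  have c: "0 \<le> c" "c < 1"
  proof -
    show "0 \<le> c" unfolding c_def using L0 rho_pos tau_pos by simp
    have "0 < \<rho>\<^sup>2 * \<tau>" using rho_pos tau_pos by simp
    moreover have "1 - c = 6 * (\<rho>\<^sup>2 * \<tau>)" using rho_eq by (simp add: c_def algebra_simps)
    ultimately show "c < 1" by linarith
  qed
  have "\<exists>!F\<in>S. T F = F"
  proof (rule Banach_fix[of S c])
    show "complete S" unfolding S_def by (simp add: complete_eq_closed)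
    show "S \<noteq> {}" unfolding S_def using rho_pos by simp
    show "T ` S \<subseteq> S"
    proof clarify
      fix F assume "F \<in> S"
      hence "norm (T0 F p) \<le> \<rho>" for p unfolding T0_def by (intro norm_enc_le) (auto simp: inv)
      hence "norm (T F) \<le> \<rho>" by (intro norm_bound) (simp add: T)
      thus "T F \<in> S" by (simp add: S_def)
    qed
    fix F1 F2 assume F: "F1 \<in> S" "F2 \<in> S"
    let ?d = "dist F1 F2"
    let ?h = "\<lambda>s. N (U F1) (V F1) s - N (U F2) (V F2) s"
    have h: "?h \<in> BC" by (intro BC_diff NBC)
    have d: "norm (U F1 s - U F2 s) \<le> ?d" "norm (V F1 s - V F2 s) \<le> ?d" for s
      using dist_bounded[of F1 _ F2] by (auto simp: U_def V_def dist_norm)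
    have J: "Jsum lam 0 (\<lambda>s. norm (?h s)) t \<le> c * ?d" for t
    proof -
      have "Jsum lam 0 (\<lambda>s. norm (?h s)) t \<le> ?d * \<kappa> + (?d * (6 * \<rho> + 3 * \<rho>\<^sup>2)) * \<tau>"
      proof (rule Jsum_bound[OF h])
        fix s
        have "?h s = (N (U F1) (V F1) s - f0 s) - (N (U F2) (V F2) s - f0 s)" by simp
        hence "norm (?h s) \<le> ((norm (A s) + norm (B s)) + (2 * (norm k + norm (B s)) + 6) * \<rho> + 3 * \<rho>\<^sup>2) * ?d"
          unfolding N0 by (simp only:) (intro cubic_lipschitz UV F d)
        also have "\<dots> \<le> ((norm (A s) + norm (B s)) + (6 * \<rho> + 3 * \<rho>\<^sup>2) * (q + norm (B s))) * ?d"
        proof (intro mult_right_mono)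
          have "\<rho> * (2 * (norm k + norm (B s)) + 6) \<le> \<rho> * (6 * (q + norm (B s)))"
            using q rho_pos by (intro mult_left_mono) (smt (verit) norm_ge_zero)+
          moreover have "3 * \<rho>\<^sup>2 * 1 \<le> 3 * \<rho>\<^sup>2 * (q + norm (B s))"
            using q by (intro mult_left_mono) ((smt (verit) norm_ge_zero)+, simp)
          ultimately show "norm (A s) + norm (B s) + (2 * (norm k + norm (B s)) + 6) * \<rho> + 3 * \<rho>\<^sup>2
             \<le> norm (A s) + norm (B s) + (6 * \<rho> + 3 * \<rho>\<^sup>2) * (q + norm (B s))"
            by (simp add: algebra_simps)
        qed simp
        finally show "norm (?h s) \<le> ?d * (norm (A s) + norm (B s)) + ?d * (6 * \<rho> + 3 * \<rho>\<^sup>2) * (q + norm (B s))"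
          by (simp add: algebra_simps)
      qed (use rho_pos in auto)
      thus ?thesis by (simp add: c_def algebra_simps)
    qed
    show "dist (T F1) (T F2) \<le> c * ?d"
    proof (rule dist_bound)
      fix p
      have "norm (T0 F1 p - T0 F2 p) \<le> c * ?d"
        unfolding T0_def enc_diff
      proof (rule norm_enc_le)
        fix t
        have "norm (G lam ?h t) \<le> c * ?d" "norm (Gd lam ?h t) \<le> c * ?d"
          using norm_G_le[OF h, of t] norm_Gd_le[OF h, of t] J[of t] by linarith+
        thus "norm (- G lam (N (U F1) (V F1)) t - - G lam (N (U F2) (V F2)) t) \<le> c * ?d"
          "norm (- Gd lam (N (U F1) (V F1)) t - - Gd lam (N (U F2) (V F2)) t) \<le> c * ?d"
          by (simp_all add: G_diff[OF NBC NBC] norm_minus_commute)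
      qed
      thus "dist (T F1 p) (T F2 p) \<le> c * ?d" by (simp add: T dist_norm)
    qed
  qed (use c in auto)
  then obtain F where F: "F \<in> S" "T F = F" by blast
  show ?thesis
  proof (rule that[of "U F" "V F"])
    have *: "F p = T0 F p" for p using T[of F] F(2) by simp
    show "U F t = - G lam (N (U F) (V F)) t" for t
      unfolding U_def[THEN fun_cong, of F, THEN fun_cong, of t] * T0_def by simp
    show "V F t = - Gd lam (N (U F) (V F)) t" for t
      unfolding V_def[THEN fun_cong, of F, THEN fun_cong, of t] * T0_def by simp
  qed (use UVBC UV[OF F(1)] in auto)
qed

end

section \<open>Decay of the fixed point\<close>

context small_nonlinearity
begin

context
  fixes u v :: "real \<Rightarrow> complex"
  assumes uv_BC: "u \<in> BC" "v \<in> BC"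
    and uv_le: "\<And>t. norm (u t) \<le> \<rho>" "\<And>t. norm (v t) \<le> \<rho>"
    and uv_eq: "\<And>t. u t = - G lam (N u v) t" "\<And>t. v t = - Gd lam (N u v) t"
begin

abbreviation "n t \<equiv> max (norm (u t)) (norm (v t))"
abbreviation "F t \<equiv> norm (f0 t)"

lemma n_nonneg: "0 \<le> n t" and n_le_rho: "n t \<le> \<rho>"
  using uv_le by (auto simp: max_def)

lemma n_measurable: "(\<lambda>t. n t) \<in> borel_measurable borel"
  using BC_norm(1)[OF uv_BC(1)] BC_norm(1)[OF uv_BC(2)] by measurable

lemma N_BC: "N u v \<in> BC"
  by (intro BC_nl BC uv_BC)

lemma n_le_Jsum: "n t \<le> Jsum lam 0 (\<lambda>s. norm (N u v s)) t"
  using norm_G_le[OF N_BC, of t] norm_Gd_le[OF N_BC, of t] uv_eq[of t] by simp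

lemma beta0: "(0::real) \<le> 0" "0 < min \<bar>alph lam 1\<bar> \<bar>alph lam 2\<bar>"
  using alph_nz[of 1] alph_nz[of 2] by auto

text \<open>The comparison principle for the fixed point. The term with \<open>R\<close> goes into
  the kernel, whose weighted mass is \<open>Jsum lam \<beta> R\<close>; \<open>C'\<close> makes room
  for contributions already bounded by the convolution.\<close>

lemma dominate:
  assumes \<beta>: "0 < \<beta>" "\<beta> < min \<bar>alph lam 1\<bar> \<bar>alph lam 2\<bar>"
    and Rm: "R \<in> borel_measurable borel" and R: "\<And>s. 0 \<le> R s" "\<And>s. R s \<le> Rb"
    and C': "0 \<le> C'"
    and le: "\<And>s. norm (N u v s) \<le> F s + C' * conv \<beta> F s + R s * n s"
    and x: "\<And>t. Jsum lam \<beta> R t \<le> x" "x < 1"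
  shows "\<exists>C\<ge>0. \<forall>t. n t \<le> C * conv \<beta> F t"
proof -
  have \<beta>': "0 \<le> \<beta>" using \<beta> by simp
  have \<beta>i: "\<beta> < \<bar>alph lam i\<bar>" if "i \<in> {1,2}" for i using \<beta> that by auto
  note Fm = BC_norm[OF BC(1)]
  have cm: "conv \<beta> F \<in> borel_measurable borel" using conv_measurable[OF \<beta>(1) Fm] .
  have cb: "bounded (range (conv \<beta> F))" using conv_bounded[OF \<beta>(1) Fm] .
  have cnn: "0 \<le> conv \<beta> F t" for t by (rule conv_nonneg[OF \<beta>(1) Fm]) simp
  have cg: "conv \<beta> F s \<le> exp (\<beta> * \<bar>t - s\<bar>) * conv \<beta> F t" for s t
    by (rule conv_growth[OF \<beta>(1) Fm]) simp
  have Rn_m: "(\<lambda>s. R s * n s) \<in> borel_measurable borel" using Rm n_measurable by measurable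
  have R_b: "bounded (range R)"
    using R by (intro boundedI[of _ Rb]) auto
  have Rn_b: "bounded (range (\<lambda>s. R s * n s))"
  proof (intro boundedI[of _ "Rb * \<rho>"])
    fix y assume "y \<in> range (\<lambda>s. R s * n s)"
    then obtain s where y: "y = R s * n s" by auto
    have "R s * n s \<le> Rb * \<rho>"
      using R(1)[of s] R(2)[of s] n_nonneg n_le_rho by (intro mult_mono) (auto intro: order_trans)
    thus "norm y \<le> Rb * \<rho>" using R(1)[of s] n_nonneg[of s] unfolding y by (simp add: abs_mult)
  qed
  have Cc: "(\<lambda>s. C' * conv \<beta> F s) \<in> borel_measurable borel" "bounded (range (\<lambda>s. C' * conv \<beta> F s))"
  proof -
    show "(\<lambda>s. C' * conv \<beta> F s) \<in> borel_measurable borel" using cm by measurable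
    obtain b where b: "\<And>s. norm (conv \<beta> F s) \<le> b" using cb by (auto simp: bounded_iff)
    have "norm (C' * conv \<beta> F s) \<le> C' * b" for s
      using mult_left_mono[OF b C'] C' by (simp add: abs_mult)
    thus "bounded (range (\<lambda>s. C' * conv \<beta> F s))" by (auto intro!: boundedI)
  qed
  define W where "W = (\<Sum>i\<in>{1,2}. wt lam i)"
  define W' where "W' = (\<Sum>i\<in>{1,2}. wt lam i * (1 / (\<bar>alph lam i\<bar> - \<beta>)))"
  define K where "K = (\<lambda>t s. \<Sum>i\<in>{1,2}. wt lam i * (kap (alph lam i) t s * R s))"
  have wt0: "0 \<le> wt lam i" for i using wt_pos[of i] by simp
  have W: "0 \<le> W" "0 \<le> W'" unfolding W_def W'_def
    by (auto intro!: sum_nonneg mult_nonneg_nonneg add_nonneg_nonneg wt0 divide_nonneg_nonneg simp: less_imp_le[OF \<beta>i[of 1], simplified] less_imp_le[OF \<beta>i[of 2]])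
  have J1: "Jsum lam 0 F t \<le> W * conv \<beta> F t" for t
    unfolding Jsum_def W_def sum_distrib_right shifted_0
    using \<beta>i by (intro sum_mono mult_left_mono wt0 J_le_conv[OF \<beta>(1) Fm]) (auto simp: less_imp_le)
  \<comment> \<open>A Green integral of \<open>conv \<beta> F\<close> is again at most a multiple of
    it: the growth factor turns the kernel into the shifted one, which is still integrable since
    \<beta> is below both decay rates.\<close>
  have J2: "Jsum lam 0 (conv \<beta> F) t \<le> W' * conv \<beta> F t" for t
    unfolding Jsum_def W'_def sum_distrib_right shifted_0 mult.assoc
  proof (intro sum_mono mult_left_mono wt0)
    fix i :: nat assume i: "i \<in> {1,2}"
    have "J (alph lam i) (conv \<beta> F) t \<le> (LINT s|lborel. kap (shifted lam \<beta> i) t s * conv \<beta> F t)"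
      unfolding J_def
    proof (intro integral_mono integrable_kap_mult[OF alph_nz[OF i] cm cb] integrable_mult_left integrable_kap shifted_nz(2)[OF \<beta>' \<beta>(2) i])
      fix s
      have "kap (alph lam i) t s * conv \<beta> F s \<le> kap (alph lam i) t s * (exp (\<beta> * \<bar>t - s\<bar>) * conv \<beta> F t)"
        by (intro mult_left_mono cg) simp
      also have "\<dots> = kap (alph lam i) t s * exp (\<beta> * \<bar>t - s\<bar>) * conv \<beta> F t" by simp
      also have "\<dots> = kap (shifted lam \<beta> i) t s * conv \<beta> F t"
        unfolding shifted_def kap_shift[OF \<beta>' \<beta>i[OF i]] ..
      finally show "kap (alph lam i) t s * conv \<beta> F s \<le> kap (shifted lam \<beta> i) t s * conv \<beta> F t" .
    qed
    also have "\<dots> = 1 / (\<bar>alph lam i\<bar> - \<beta>) * conv \<beta> F t"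
      using shifted_nz[OF \<beta>' \<beta>(2) i] by simp
    finally show "J (alph lam i) (conv \<beta> F) t \<le> 1 / (\<bar>alph lam i\<bar> - \<beta>) * conv \<beta> F t" .
  qed
  have J3: "Jsum lam 0 (\<lambda>s. R s * n s) t = (LINT s|lborel. K t s * n s)" for t
  proof -
    have i: "integrable lborel (\<lambda>s. kap (alph lam i) t s * (R s * n s))" if "i \<in> {1,2}" for i
      using that by (intro integrable_kap_mult alph_nz Rn_m Rn_b)
    have "(LINT s|lborel. K t s * n s) = (LINT s|lborel. (\<Sum>i\<in>{1,2}. wt lam i * (kap (alph lam i) t s * (R s * n s))))"
      unfolding K_def by (simp add: distrib_right mult.assoc)
    also have "\<dots> = Jsum lam 0 (\<lambda>s. R s * n s) t"
      unfolding Jsum_def J_def shifted_0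
      by (subst Bochner_Integration.integral_sum[OF integrable_mult_right[OF i]]) (simp_all only: integral_mult_right_zero)
    finally show ?thesis by simp
  qed
  have Kexp: "K t s * exp (\<beta> * \<bar>t - s\<bar>) = (\<Sum>i\<in>{1,2}. wt lam i * (kap (shifted lam \<beta> i) t s * R s))" for t s
  proof -
    have "K t s * exp (\<beta> * \<bar>t - s\<bar>) = (\<Sum>i\<in>{1,2}. wt lam i * (kap (alph lam i) t s * exp (\<beta> * \<bar>t - s\<bar>) * R s))"
      unfolding K_def sum_distrib_right by (intro sum.cong) auto
    also have "\<dots> = (\<Sum>i\<in>{1,2}. wt lam i * (kap (shifted lam \<beta> i) t s * R s))"
      unfolding shifted_def using kap_shift[OF \<beta>' \<beta>i] by (intro sum.cong) auto
    finally show ?thesis .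
  qed
  have Ki: "integrable lborel (\<lambda>s. wt lam i * (kap (shifted lam \<beta> i) t s * R s))" if "i \<in> {1,2}" for i t
    using that by (intro integrable_mult_right integrable_kap_mult shifted_nz(2)[OF \<beta>' \<beta>(2)] Rm R_b)
  have "n t \<le> (W + C' * W') / (1 - x) * conv \<beta> F t" for t
  proof (rule comparison_principle[where n = n and w = "conv \<beta> F" and K = K and \<epsilon> = \<beta> and B = \<rho>])
    show "conv \<beta> F s \<le> exp (\<beta> * \<bar>t - s\<bar>) * conv \<beta> F t" for s t by (rule cg)
    show "0 \<le> K t s" for t s
      unfolding K_def by (intro sum_nonneg mult_nonneg_nonneg wt0 R kap_nonneg)
    show "integrable lborel (\<lambda>s. K t s * exp (\<beta> * \<bar>t - s\<bar>))" for t
      unfolding Kexp by (intro Bochner_Integration.integrable_sum Ki)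
    show "(LINT s|lborel. K t s * exp (\<beta> * \<bar>t - s\<bar>)) \<le> x" for t
    proof -
      have "(LINT s|lborel. K t s * exp (\<beta> * \<bar>t - s\<bar>)) = Jsum lam \<beta> R t"
        unfolding Kexp Jsum_def J_def
        by (subst Bochner_Integration.integral_sum[OF Ki]) (simp_all only: integral_mult_right_zero)
      thus ?thesis using x(1) by simp
    qed
    fix t
    have "n t \<le> Jsum lam 0 (\<lambda>s. norm (N u v s)) t" by (rule n_le_Jsum)
    also have "\<dots> \<le> Jsum lam 0 (\<lambda>s. (F s + C' * conv \<beta> F s) + R s * n s) t"
      by (intro Jsum_mono[OF beta0] BC_norm[OF N_BC] le bounded_plus_comp Fm Cc Rn_b
          borel_measurable_add Rn_m)
    also have "\<dots> = Jsum lam 0 F t + C' * Jsum lam 0 (conv \<beta> F) t + Jsum lam 0 (\<lambda>s. R s * n s) t"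
      using Jsum_add[OF beta0 borel_measurable_add[OF Fm(1) Cc(1)] bounded_plus_comp[OF Fm(2) Cc(2)] Rn_m Rn_b, of t]
        Jsum_add[OF beta0 Fm Cc, of t] Jsum_cmult[OF beta0, of C' "conv \<beta> F" t] by simp
    also have "\<dots> \<le> W * conv \<beta> F t + C' * (W' * conv \<beta> F t) + (LINT s|lborel. K t s * n s)"
      unfolding J3 by (intro add_mono J1 mult_left_mono J2 C' order_refl)
    finally show "n t \<le> (W + C' * W') * conv \<beta> F t + (LINT s|lborel. K t s * n s)"
      by (simp add: algebra_simps)
  qed (use n_nonneg n_le_rho cnn x W C' \<beta>' in \<open>auto intro: add_nonneg_nonneg\<close>)
  moreover have "(W + C' * W') / (1 - x) \<ge> 0" using W C' x by (intro divide_nonneg_nonneg add_nonneg_nonneg mult_nonneg_nonneg) auto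
  ultimately show ?thesis by blast
qed

lemma N_le: "norm (N u v s) \<le> F s + (norm (A s) + norm (B s)) * n s + (norm k + norm (B s) + 3 + \<rho>) * (n s * n s)"
proof -
  have "norm (N u v s - f0 s) \<le> (norm (A s) + norm (B s)) * n s + (norm k + norm (B s) + 3 + n s) * (n s)\<^sup>2"
  proof -
    have "N u v s - f0 s = A s * u s + B s * v s + (k + B s) * (u s)\<^sup>2 + 3 * u s * v s + u s ^ 3"
      by (simp add: nl_def)
    thus ?thesis using cubic_bound[of "u s" "n s" "v s" "A s" "B s" k] by (simp only:)
  qed
  moreover have "(norm k + norm (B s) + 3 + n s) * (n s)\<^sup>2 \<le> (norm k + norm (B s) + 3 + \<rho>) * (n s)\<^sup>2"
    using n_le_rho[of s] by (intro mult_right_mono) auto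
  ultimately show ?thesis
    using norm_triangle_ineq[of "f0 s" "N u v s - f0 s"] by (simp add: power2_eq_square)
qed

text \<open>One factor of the quadratic terms is replaced by its bound \<rho>. The kernel mass
  becomes at most \<open>\<kappa> + (3 * \<rho> + \<rho>^2) * \<tau>\<close>, which
  \<open>rho_eq\<close> puts below 1, and the margin pays for the weight of a small
  exponent.\<close>

lemma dominated_by_some_conv:
  "\<exists>\<epsilon> C. 0 < \<epsilon> \<and> 0 \<le> C \<and> (\<forall>t. n t \<le> C * conv \<epsilon> F t)"
proof -
  define R where "R = (\<lambda>s. (norm (A s) + norm (B s)) + (3 * \<rho> + \<rho>\<^sup>2) * (q + norm (B s)))"
  obtain a b where ab: "\<And>s. norm (A s) \<le> a" "\<And>s. norm (B s) \<le> b"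
    using BC_D(2)[OF BC(2)] BC_D(2)[OF BC(3)] by (auto simp: bounded_iff)
  have q0: "1 \<le> q" using q by (smt (verit) norm_ge_zero)
  define Rb where "Rb = (a + b) + (3 * \<rho> + \<rho>\<^sup>2) * (q + b)"
  have R: "0 \<le> R s" "R s \<le> Rb" for s
    unfolding R_def Rb_def using ab rho_pos q0 by (auto intro!: add_mono mult_left_mono)
  have Am: "(\<lambda>s. norm (A s) + norm (B s)) \<in> borel_measurable borel" "(\<lambda>s. (3 * \<rho> + \<rho>\<^sup>2) * (q + norm (B s))) \<in> borel_measurable borel"
    using BC_norm(1)[OF BC(2)] BC_norm(1)[OF BC(3)] by measurable
  have Ab: "bounded (range (\<lambda>s. norm (A s) + norm (B s)))" "bounded (range (\<lambda>s. (3 * \<rho> + \<rho>\<^sup>2) * (q + norm (B s))))"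
  proof -
    show "bounded (range (\<lambda>s. norm (A s) + norm (B s)))"
      by (intro boundedI[of _ "a + b"]) (use add_mono[OF ab] in auto)
    show "bounded (range (\<lambda>s. (3 * \<rho> + \<rho>\<^sup>2) * (q + norm (B s))))"
      using ab rho_pos q0 by (intro boundedI[of _ "(3 * \<rho> + \<rho>\<^sup>2) * (q + b)"]) (auto simp: abs_mult intro!: mult_left_mono)
  qed
  have Rm: "R \<in> borel_measurable borel" unfolding R_def using Am by measurable
  define x where "x = \<kappa> + (3 * \<rho> + \<rho>\<^sup>2) * \<tau>"
  have x: "x < 1"
  proof -
    have "1 - x = 8 * (\<tau> * \<rho>\<^sup>2) + 3 * (\<tau> * \<rho>)" using rho_eq by (simp add: x_def algebra_simps)
    moreover have "0 < \<tau> * \<rho>\<^sup>2" "0 < \<tau> * \<rho>" using rho_pos tau_pos by simp_all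
    ultimately show ?thesis by linarith
  qed
  have J0: "Jsum lam 0 R t \<le> x" for t
  proof -
    have "Jsum lam 0 R t = Jsum lam 0 (\<lambda>s. norm (A s) + norm (B s)) t + (3 * \<rho> + \<rho>\<^sup>2) * Jsum lam 0 (\<lambda>s. q + norm (B s)) t"
      unfolding R_def by (simp only: Jsum_add[OF beta0 Am(1) Ab(1) Am(2) Ab(2)] Jsum_cmult[OF beta0])
    also have "\<dots> \<le> x" unfolding x_def
      using rho_pos by (intro add_mono mult_left_mono \<kappa> \<tau>) auto
    finally show ?thesis .
  qed
  \<comment> \<open>Bound from \<open>J_shift_le\<close> for the mass added by the weight; half of
    the margin \<open>1 - x\<close> is spent on it.\<close>
  define g where "g = (\<lambda>\<epsilon>. \<Sum>i\<in>{1,2}. wt lam i * (Rb * (1 / (\<bar>alph lam i\<bar> - \<epsilon>) - 1 / \<bar>alph lam i\<bar>)))"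
  have "(g \<longlongrightarrow> (\<Sum>i\<in>{1,2}. wt lam i * (Rb * (1 / (\<bar>alph lam i\<bar> - 0) - 1 / \<bar>alph lam i\<bar>)))) (at_right 0)"
    unfolding g_def using alph_nz by (intro tendsto_intros) auto
  hence "(g \<longlongrightarrow> 0) (at_right 0)" by simp
  hence "\<forall>\<^sub>F \<epsilon> in at_right 0. g \<epsilon> < (1 - x) / 2" by (rule order_tendstoD) (use x in simp)
  moreover have "\<forall>\<^sub>F \<epsilon> in at_right 0. \<epsilon> \<in> {0<..<min \<bar>alph lam 1\<bar> \<bar>alph lam 2\<bar>}"
    by (rule eventually_at_right_real[OF beta0(2)])
  ultimately have "\<forall>\<^sub>F \<epsilon> in at_right 0. g \<epsilon> < (1 - x) / 2 \<and> \<epsilon> \<in> {0<..<min \<bar>alph lam 1\<bar> \<bar>alph lam 2\<bar>}"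
    by (rule eventually_conj)
  then obtain \<epsilon> where \<epsilon>: "g \<epsilon> < (1 - x) / 2" "0 < \<epsilon>" "\<epsilon> < min \<bar>alph lam 1\<bar> \<bar>alph lam 2\<bar>"
    by (auto dest: eventually_happens)
  have "\<exists>C\<ge>0. \<forall>t. n t \<le> C * conv \<epsilon> F t"
  proof (rule dominate[OF \<epsilon>(2,3) Rm R order_refl])
    fix s
    have "(norm k + norm (B s) + 3 + \<rho>) * (n s * n s) \<le> ((3 + \<rho>) * (q + norm (B s))) * (\<rho> * n s)"
    proof (intro mult_mono)
      have "\<rho> * 1 \<le> \<rho> * (q + norm (B s))"
        using q0 rho_pos by (intro mult_left_mono) (auto intro: add_increasing2)
      moreover have "norm k + norm (B s) + 3 \<le> 3 * (q + norm (B s))"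
        using q by (smt (verit) norm_ge_zero)
      ultimately show "norm k + norm (B s) + 3 + \<rho> \<le> (3 + \<rho>) * (q + norm (B s))"
        by (simp add: distrib_right)
    qed (use n_nonneg n_le_rho rho_pos q0 in auto)
    thus "norm (N u v s) \<le> F s + 0 * conv \<epsilon> F s + R s * n s"
      using N_le[of s] by (simp add: R_def algebra_simps power2_eq_square)
    fix t
    have "Jsum lam \<epsilon> R t \<le> Jsum lam 0 R t + g \<epsilon>"
      unfolding Jsum_def g_def sum.distrib[symmetric] shifted_0 distrib_left[symmetric]
    proof (intro sum_mono mult_left_mono)
      fix i :: nat assume "i \<in> {1,2}"
      hence "\<epsilon> < \<bar>alph lam i\<bar>" using \<epsilon> by auto
      thus "J (shifted lam \<epsilon> i) R t \<le> J (alph lam i) R t + Rb * (1 / (\<bar>alph lam i\<bar> - \<epsilon>) - 1 / \<bar>alph lam i\<bar>)"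
        unfolding shifted_def using \<epsilon> R by (intro J_shift_le Rm) auto
    qed (use wt_pos in \<open>simp add: less_imp_le\<close>)
    thus "Jsum lam \<epsilon> R t \<le> x + (1 - x) / 2" using J0[of t] \<epsilon>(1) by linarith
  qed (use x in \<open>simp add: field_simps\<close>)
  thus ?thesis using \<epsilon> by blast
qed

text \<open>For this \<beta> only the linear coefficients are known to have mass below 1, so a small
  threshold has to replace \<rho> in the linearisation. Above the threshold
  \<open>dominated_by_some_conv\<close> and \<open>conv_lower_bound\<close> give a lower bound for
  \<open>conv \<beta> F\<close>.\<close>

lemma dominated_by_conv:
  assumes \<beta>: "0 < \<beta>" "\<beta> < min \<bar>alph lam 1\<bar> \<bar>alph lam 2\<bar>"
    and x: "\<And>t. Jsum lam \<beta> (\<lambda>s. norm (A s) + norm (B s)) t \<le> x" "x < 1"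
  shows "\<exists>C\<ge>0. \<forall>t. n t \<le> C * conv \<beta> F t"
proof -
  have \<beta>': "0 \<le> \<beta>" using \<beta> by simp
  obtain a b where ab: "\<And>s. norm (A s) \<le> a" "\<And>s. norm (B s) \<le> b"
    using BC_D(2)[OF BC(2)] BC_D(2)[OF BC(3)] by (auto simp: bounded_iff)
  have b0: "0 \<le> b" using ab(2)[of 0] norm_ge_zero order_trans by blast
  define d where "d = norm k + b + 3 + \<rho>"
  have d: "d > 0" using b0 rho_pos by (simp add: d_def add_nonneg_pos)
  define W where "W = (\<Sum>i\<in>{1,2}. wt lam i / (\<bar>alph lam i\<bar> - \<beta>))"
  have W: "0 < W" unfolding W_def using wt_pos \<beta> by (intro sum_pos) auto
  \<comment> \<open>Chosen so that the constant \<open>d * \<eta>\<close> has kernel mass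
    \<open>(1 - x) / 2\<close>, half of what the linear part leaves free.\<close>
  define \<eta> where "\<eta> = (1 - x) / (2 * d * W)"
  have \<eta>: "\<eta> > 0" using x d W by (simp add: \<eta>_def)
  obtain \<epsilon> C where \<epsilon>: "0 < \<epsilon>" "0 \<le> C" "\<And>t. n t \<le> C * conv \<epsilon> F t"
    using dominated_by_some_conv by blast
  \<comment> \<open>\<open>C + 1\<close> rather than C, which may be 0.\<close>
  obtain c where c: "c > 0" "\<And>t. \<eta> / (C + 1) \<le> conv \<epsilon> F t \<Longrightarrow> c \<le> conv \<beta> F t"
    using conv_lower_bound[OF \<epsilon>(1) \<beta>(1) BC_norm[OF BC(1)], of "\<eta> / (C + 1)"] \<eta> \<epsilon>(2) by auto
  let ?R = "\<lambda>s. (norm (A s) + norm (B s)) + d * \<eta>"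
  have m: "(\<lambda>s. norm (A s) + norm (B s)) \<in> borel_measurable borel"
    using BC_norm(1)[OF BC(2)] BC_norm(1)[OF BC(3)] by measurable
  have bd: "bounded (range (\<lambda>s. norm (A s) + norm (B s)))"
    by (intro boundedI[of _ "a + b"]) (use add_mono[OF ab] in auto)
  have cnn: "0 \<le> conv \<beta> F t" for t by (rule conv_nonneg[OF \<beta>(1) BC_norm[OF BC(1)]]) simp
  show ?thesis
  proof (rule dominate[OF \<beta>, where R = ?R and Rb = "a + b + d * \<eta>" and C' = "d * \<rho>\<^sup>2 / c" and x = "(1 + x) / 2"])
    fix s
    have "(norm k + norm (B s) + 3 + \<rho>) * (n s * n s) \<le> d * (n s * n s)"
      unfolding d_def using ab(2)[of s] by (intro mult_right_mono) (auto simp: zero_le_mult_iff n_nonneg)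
    moreover have "d * (n s * n s) \<le> d * \<eta> * n s + d * \<rho>\<^sup>2 / c * conv \<beta> F s"
    proof (cases "n s \<le> \<eta>")
      case True
      hence "d * (n s * n s) \<le> d * (\<eta> * n s)"
        using d n_nonneg[of s] by (intro mult_left_mono mult_right_mono) auto
      moreover have "0 \<le> d * \<rho>\<^sup>2 / c * conv \<beta> F s" using d c cnn by simp
      ultimately show ?thesis by (simp add: mult.assoc)
    next
      \<comment> \<open>Here the whole quadratic term is at most \<open>d * \<rho>^2\<close>, a
        constant that the lower bound c turns into a multiple of
        \<open>conv \<beta> F\<close>.\<close>
      case False
      have "C * conv \<epsilon> F s \<le> (C + 1) * conv \<epsilon> F s"
        using conv_nonneg[OF \<epsilon>(1) BC_norm[OF BC(1)], of s] by (intro mult_right_mono) auto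
      with \<epsilon>(3)[of s] False have "\<eta> \<le> (C + 1) * conv \<epsilon> F s" by linarith
      hence "\<eta> / (C + 1) \<le> conv \<epsilon> F s" using \<epsilon>(2) by (simp add: pos_divide_le_eq mult.commute)
      hence "c \<le> conv \<beta> F s" by (rule c)
      hence "1 \<le> conv \<beta> F s / c" using c(1) by simp
      moreover have "n s * n s \<le> \<rho> * \<rho>" using n_nonneg[of s] n_le_rho[of s] rho_pos by (intro mult_mono) linarith+
      ultimately have "(n s * n s) * 1 \<le> (\<rho> * \<rho>) * (conv \<beta> F s / c)"
        using rho_pos by (intro mult_mono[of "n s * n s"]) auto
      hence "d * (n s * n s) \<le> d * (\<rho> * \<rho> * (conv \<beta> F s / c))"
        using d by (intro mult_left_mono) auto
      moreover have "0 \<le> d * \<eta> * n s" using d \<eta> n_nonneg[of s] by (intro mult_nonneg_nonneg) auto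
      ultimately show ?thesis by (simp add: power2_eq_square)
    qed
    ultimately show "norm (N u v s) \<le> F s + d * \<rho>\<^sup>2 / c * conv \<beta> F s + ?R s * n s"
      using N_le[of s] by (simp add: distrib_right)
  next
    fix t
    have "Jsum lam \<beta> ?R t = Jsum lam \<beta> (\<lambda>s. norm (A s) + norm (B s)) t + d * \<eta> * W"
      unfolding W_def using Jsum_add[OF \<beta>' \<beta>(2) m bd, of "\<lambda>_. d * \<eta>" t] Jsum_const[OF \<beta>' \<beta>(2), of "d * \<eta>" t] by simp
    moreover have "d * \<eta> * W = (1 - x) / 2" using d W by (simp add: \<eta>_def)
    ultimately show "Jsum lam \<beta> ?R t \<le> (1 + x) / 2" using x(1)[of t] by (simp add: field_simps)
  next
    show "?R s \<le> a + b + d * \<eta>" for s using ab[of s] by (intro add_mono) auto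
  qed (use m d \<eta> c x in \<open>auto intro!: add_nonneg_nonneg\<close>)
qed

end

end

section \<open>The perturbation classes\<close>

lemma set_integrable_powr_dominated:
  fixes f :: "real \<Rightarrow> complex" and h :: "real \<Rightarrow> real"
  assumes A: "A \<in> sets borel" and f: "f \<in> borel_measurable borel" and p: "p \<ge> 1"
    and h: "set_integrable lborel A h" and le: "\<And>t. norm (f t) powr p \<le> h t"
  shows "set_integrable lborel A (\<lambda>t. norm (f t) powr p)"
  unfolding set_integrable_def
proof (rule Bochner_Integration.integrable_bound[OF h[unfolded set_integrable_def]])
  show "(\<lambda>t. indicat_real A t *\<^sub>R norm (f t) powr p) \<in> borel_measurable lborel"
    using f A by measurable
  show "AE t in lborel. norm (indicat_real A t *\<^sub>R norm (f t) powr p) \<le> norm (indicat_real A t *\<^sub>R h t)"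
    using le order_trans[OF powr_ge_zero le] by (intro AE_I2) (auto simp: indicator_def)
qed

lemma powr_add_le:
  fixes x y p :: real
  assumes "0 \<le> x" "0 \<le> y" "1 \<le> p"
  shows "(x + y) powr p \<le> 2 powr p * (x powr p + y powr p)"
proof -
  have "(x + y) powr p \<le> (2 * max x y) powr p" using assms by (intro powr_mono2) auto
  also have "\<dots> = 2 powr p * max x y powr p" by (rule powr_mult)
  also have "\<dots> \<le> 2 powr p * (x powr p + y powr p)" by (intro mult_left_mono) (auto simp: max_def)
  finally show ?thesis .
qed

text \<open>Boundedness on the negative half-line is automatic in \<open>BC\<close>, so the four
  classes reduce to limit or integrability conditions that can be treated alike.\<close>

lemma BC_mem_classes:
  assumes "f \<in> BC"
  shows "f \<in> BC0 \<longleftrightarrow> (f \<longlongrightarrow> 0) at_top" "f \<in> C00 \<longleftrightarrow> (f \<longlongrightarrow> 0) at_top \<and> (f \<longlongrightarrow> 0) at_bot"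
    "f \<in> Lp p \<longleftrightarrow> set_integrable lborel UNIV (\<lambda>t. norm (f t) powr p)"
    "f \<in> Lp0 p \<longleftrightarrow> set_integrable lborel {0..} (\<lambda>t. norm (f t) powr p)"
proof -
  have "bounded (f ` {..0})" by (rule bounded_subset[OF BC_D(2)[OF assms]]) auto
  thus "f \<in> BC0 \<longleftrightarrow> (f \<longlongrightarrow> 0) at_top" "f \<in> C00 \<longleftrightarrow> (f \<longlongrightarrow> 0) at_top \<and> (f \<longlongrightarrow> 0) at_bot"
    "f \<in> Lp p \<longleftrightarrow> set_integrable lborel UNIV (\<lambda>t. norm (f t) powr p)"
    "f \<in> Lp0 p \<longleftrightarrow> set_integrable lborel {0..} (\<lambda>t. norm (f t) powr p)"
    using assms BC_D(3)[OF assms] by (auto simp: BC0_def C00_def Lp_def Lp0_def set_integrable_def)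
qed

lemma set_integrable_powr_mult:
  assumes A: "A \<in> sets borel" and f: "f \<in> BC" and c: "c \<in> BC" and p: "p \<ge> 1"
    and i: "set_integrable lborel A (\<lambda>t. norm (f t) powr p)"
  shows "set_integrable lborel A (\<lambda>t. norm (c t * f t) powr p)"
proof -
  obtain b where b: "\<And>t. norm (c t) \<le> b" using BC_D(2)[OF c] by (auto simp: bounded_iff)
  show ?thesis
  proof (rule set_integrable_powr_dominated[OF A _ p])
    show "(\<lambda>t. c t * f t) \<in> borel_measurable borel" by (rule BC_D(3)[OF BC_mult[OF c f]])
    show "set_integrable lborel A (\<lambda>t. b powr p * norm (f t) powr p)" using i by simp
    show "norm (c t * f t) powr p \<le> b powr p * norm (f t) powr p" for t
      unfolding norm_mult using b[of t] p by (simp add: powr_mult mult_right_mono powr_mono2)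
  qed
qed

lemma set_integrable_powr_add:
  assumes A: "A \<in> sets borel" and f: "f \<in> BC" and g: "g \<in> BC" and p: "p \<ge> 1"
    and i: "set_integrable lborel A (\<lambda>t. norm (f t) powr p)" "set_integrable lborel A (\<lambda>t. norm (g t) powr p)"
  shows "set_integrable lborel A (\<lambda>t. norm (f t + g t) powr p)"
proof (rule set_integrable_powr_dominated[OF A _ p])
  show "(\<lambda>t. f t + g t) \<in> borel_measurable borel" by (rule BC_D(3)[OF BC_add[OF f g]])
  show "set_integrable lborel A (\<lambda>t. 2 powr p * (norm (f t) powr p + norm (g t) powr p))"
    using i by (intro set_integrable_mult_right set_integral_add)
  show "norm (f t + g t) powr p \<le> 2 powr p * (norm (f t) powr p + norm (g t) powr p)" for t
  proof -
    have "norm (f t + g t) powr p \<le> (norm (f t) + norm (g t)) powr p"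
      using p by (intro powr_mono2 norm_triangle_ineq) auto
    also have "\<dots> \<le> 2 powr p * (norm (f t) powr p + norm (g t) powr p)"
      using p by (intro powr_add_le) auto
    finally show ?thesis .
  qed
qed

text \<open>Jensen reduces the p-th power of a convolution to the convolution of the p-th power,
  which is integrable over the line by Fubini and over the half-line by splitting at 0.\<close>

lemma set_integrable_powr_conv:
  assumes A: "A = UNIV \<or> A = {0..}" and f: "f \<in> BC" and p: "p \<ge> 1" and eps: "\<epsilon> > 0" and C: "C \<ge> 0"
    and i: "set_integrable lborel A (\<lambda>t. norm (f t) powr p)"
    and g: "g \<in> BC" "\<And>t. norm (g t) \<le> C * conv \<epsilon> (\<lambda>s. norm (f s)) t"
  shows "set_integrable lborel A (\<lambda>t. norm (g t) powr p)"
proof -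
  let ?F = "\<lambda>s. norm (f s)" and ?H = "\<lambda>s. norm (f s) powr p"
  note F = BC_norm[OF f]
  have Hm: "?H \<in> borel_measurable borel" using BC_D(3)[OF f] by measurable
  have Hb: "bounded (range ?H)"
  proof -
    obtain b where b: "\<And>t. norm (f t) \<le> b" using BC_D(2)[OF f] by (auto simp: bounded_iff)
    show ?thesis using b p by (intro boundedI[of _ "b powr p"]) (auto intro!: powr_mono2)
  qed
  have cH: "set_integrable lborel A (conv \<epsilon> ?H)"
    using A
  proof
    assume "A = UNIV"
    thus ?thesis using i integrable_conv_of_integrable[OF eps] by (simp add: set_integrable_def)
  next
    assume "A = {0..}"
    thus ?thesis using i set_integrable_conv_half_line[OF eps Hm Hb] by simp
  qed
  show ?thesis
  proof (rule set_integrable_powr_dominated[OF _ BC_D(3)[OF g(1)] p])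
    show "set_integrable lborel A (\<lambda>t. C powr p * ((2 / \<epsilon>) powr (p - 1) * conv \<epsilon> ?H t))"
      using cH by (intro set_integrable_mult_right)
    fix t
    have cn: "0 \<le> conv \<epsilon> ?F t" by (rule conv_nonneg[OF eps F]) simp
    have "norm (g t) powr p \<le> (C * conv \<epsilon> ?F t) powr p" using p g(2) by (intro powr_mono2) auto
    also have "\<dots> = C powr p * conv \<epsilon> ?F t powr p" using C cn by (simp add: powr_mult)
    also have "\<dots> \<le> C powr p * ((2 / \<epsilon>) powr (p - 1) * conv \<epsilon> ?H t)"
      by (intro mult_left_mono conv_powr_le[OF eps F _ p]) auto
    finally show "norm (g t) powr p \<le> C powr p * ((2 / \<epsilon>) powr (p - 1) * conv \<epsilon> ?H t)" .
  qed (use A in auto)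
qed

context
  fixes N :: "(real \<Rightarrow> complex) set" and p :: real
  assumes N: "N \<in> {BC0, C00, Lp0 p, Lp p}" and p: "p \<ge> 1"
begin

lemma class_mult:
  assumes "c \<in> BC" "f \<in> N" "f \<in> BC"
  shows "(\<lambda>t. c t * f t) \<in> N"
proof -
  have 1: "((\<lambda>t. c t * f t) \<longlongrightarrow> 0) X" if "(f \<longlongrightarrow> 0) X" for X
  proof -
    obtain b where b: "\<And>t. norm (c t) \<le> b" using BC_D(2)[OF assms(1)] by (auto simp: bounded_iff)
    have "((\<lambda>t. b * norm (f t)) \<longlongrightarrow> 0) X"
      using that by (intro tendsto_mult_right_zero tendsto_norm_zero)
    thus ?thesis
      by (rule Lim_null_comparison[rotated]) (auto simp: norm_mult intro!: always_eventually mult_right_mono b)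
  qed
  show ?thesis
    using N assms(2) 1 set_integrable_powr_mult[OF _ assms(3,1) p, of UNIV] set_integrable_powr_mult[OF _ assms(3,1) p, of "{0..}"]
    by (auto simp: BC_mem_classes[OF assms(3)] BC_mem_classes[OF BC_mult[OF assms(1,3)]])
qed

lemma class_add:
  assumes "f \<in> N" "g \<in> N" "f \<in> BC" "g \<in> BC"
  shows "(\<lambda>t. f t + g t) \<in> N"
  using N assms(1,2) set_integrable_powr_add[OF _ assms(3,4) p, of UNIV] set_integrable_powr_add[OF _ assms(3,4) p, of "{0..}"]
  by (auto simp: BC_mem_classes[OF assms(3)] BC_mem_classes[OF assms(4)] BC_mem_classes[OF BC_add[OF assms(3,4)]]
      intro!: tendsto_add_zero)

lemma class_conv:
  assumes f: "f \<in> N" "f \<in> BC" and eps: "\<epsilon> > 0" and C: "C \<ge> 0"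
    and g: "g \<in> BC" "\<And>t. norm (g t) \<le> C * conv \<epsilon> (\<lambda>s. norm (f s)) t"
  shows "g \<in> N"
proof -
  have lim: "(g \<longlongrightarrow> 0) X" if "(conv \<epsilon> (\<lambda>s. norm (f s)) \<longlongrightarrow> 0) X" for X
    using g(2) by (intro Lim_null_comparison[OF always_eventually tendsto_mult_right_zero[OF that]]) blast
  have "(g \<longlongrightarrow> 0) at_top" if "(f \<longlongrightarrow> 0) at_top"
    by (intro lim conv_tendsto_at_top eps BC_norm f tendsto_norm_zero that)
  moreover have "(g \<longlongrightarrow> 0) at_bot" if "(f \<longlongrightarrow> 0) at_bot"
    by (intro lim conv_tendsto_at_bot eps BC_norm f tendsto_norm_zero that)
  ultimately show ?thesis
    using N f(1) set_integrable_powr_conv[OF disjI1[OF refl] f(2) p eps C _ g]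
      set_integrable_powr_conv[OF disjI2[OF refl] f(2) p eps C _ g]
    by (auto simp: BC_mem_classes[OF f(2)] BC_mem_classes[OF g(1)])
qed

end

section \<open>Regularity of \<open>\<theta>\<close> and the smallness constants\<close>

context green_pair
begin

lemma weight_eq: "weight lam i = ennreal (wt lam i)"
  by (simp add: weight_def wt_def)

lemma G_eq_diff: "G lam f t = (Gop (gam lam 1) f t - Gop (gam lam 2) f t) / (lam 1 - lam 2)"
  and Gd_eq_diff: "Gd lam f t = (gam lam 1 * Gop (gam lam 1) f t - gam lam 2 * Gop (gam lam 2) f t) / (lam 1 - lam 2)"
proof -
  have Gam: "Gam lam 1 = lam 1 - lam 2" "Gam lam 2 = - (lam 1 - lam 2)" by (simp_all add: Gam_def)
  show "G lam f t = (Gop (gam lam 1) f t - Gop (gam lam 2) f t) / (lam 1 - lam 2)"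
    "Gd lam f t = (gam lam 1 * Gop (gam lam 1) f t - gam lam 2 * Gop (gam lam 2) f t) / (lam 1 - lam 2)"
    unfolding G_def Gd_def sum12 Gam by (simp_all add: divide_inverse algebra_simps del: minus_diff_eq)
qed

lemma shifted_Iop_eq:
  assumes "f \<in> BC" "0 \<le> \<beta>" "\<beta> < min \<bar>alph lam 1\<bar> \<bar>alph lam 2\<bar>" "i \<in> {1,2}"
  shows "Iop (of_real (shifted lam \<beta> i)) f t = ennreal (J (shifted lam \<beta> i) (\<lambda>s. norm (f s)) t)"
  using Iop_eq_J[of "of_real (shifted lam \<beta> i)" f] shifted_nz(2)[OF assms(2-4)] BC_D[OF assms(1)] by simp

text \<open>Up to a nonzero constant \<open>z\<close> is the difference of the two Green integrals,
  so differentiability of \<open>z\<close> supplies the hypothesis of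
  \<open>Gop_diff_vector_derivative\<close>.\<close>

lemma solution_derivative:
  assumes sol: "solves_integral_eq lam N z"
  shows "(z has_vector_derivative - Gd lam (N z) t) (at t)"
proof -
  let ?f = "N z"
  have int: "integrable lborel (\<lambda>s. green (gam lam i) t s * ?f s)" if "i \<in> {1,2}" for i t
    using sol that unfolding solves_integral_eq_def by blast
  let ?w = "\<lambda>t. Gop (gam lam 1) ?f t - Gop (gam lam 2) ?f t"
  have w: "?w = (\<lambda>t. - (lam 1 - lam 2) * z t)"
  proof
    fix t
    have z: "z t = - G lam ?f t" using sol unfolding solves_integral_eq_def by blast
    have "(lam 1 - lam 2) * G lam ?f t = ?w t"
      by (simp only: G_eq_diff times_divide_eq_right nonzero_mult_div_cancel_left[OF lam_diff_nz])
    thus "?w t = - (lam 1 - lam 2) * z t"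
      by (simp only: z minus_mult_minus)
  qed
  have zd: "z differentiable (at t)" for t using sol unfolding solves_integral_eq_def by blast
  have "?w differentiable (at t)" for t unfolding w by (intro differentiable_mult differentiable_const zd)
  hence "vector_derivative ?w (at t) = gam lam 1 * Gop (gam lam 1) ?f t - gam lam 2 * Gop (gam lam 2) ?f t"
    by (intro Gop_diff_vector_derivative int Re_gam_nz) auto
  moreover have "(?w has_vector_derivative - (lam 1 - lam 2) * vector_derivative z (at t)) (at t)"
    unfolding w using zd[of t] vector_derivative_works by (intro has_vector_derivative_mult_right) blast
  ultimately have "- (lam 1 - lam 2) * vector_derivative z (at t) =
     gam lam 1 * Gop (gam lam 1) ?f t - gam lam 2 * Gop (gam lam 2) ?f t"
    using vector_derivative_at by fastforce
  hence "vector_derivative z (at t) = - Gd lam ?f t"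
    using lam_diff_nz by (simp add: Gd_eq_diff field_simps)
  thus ?thesis using zd[of t] vector_derivative_works by metis
qed

lemma Gd_continuous_rough:
  assumes "\<And>i t. i \<in> {1,2} \<Longrightarrow> integrable lborel (\<lambda>s. green (gam lam i) t s * f s)"
  shows "continuous_on UNIV (Gd lam f)"
  unfolding Gd_def[abs_def] sum12 by (intro continuous_intros Gop_continuous assms Re_gam_nz) auto

text \<open>\<open>PLF\<close> is affine in \<theta>' with bounded coefficients, and
  \<open>r\<theta>\<close> is \<open>3 * \<theta>'\<close> plus a bounded function. So \<theta>' can
  be traded for \<open>r\<theta>\<close>, whose Green integrals \<open>L\<close> controls.\<close>

lemma PLF_derivative_bound:
  assumes r: "\<And>i. i \<in> {0,1,2} \<Longrightarrow> r i \<in> BC" and \<mu>: "\<And>i. i \<in> {0,1,2} \<Longrightarrow> \<mu> i \<in> BC" and \<theta>: "\<theta> \<in> BC"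
  shows "\<exists>c\<ge>0. \<forall>t. norm (PLF a lam \<mu> \<theta> t) \<le> c + c * norm (r\<theta> a lam r \<theta> t)"
proof -
  note mem = r[of 0, simplified] r[of 1, simplified] r[of 2, simplified] \<mu>[of 0, simplified] \<mu>[of 1, simplified] \<mu>[of 2, simplified] \<theta>
  define X where "X = (\<lambda>t. PLF a lam \<mu> \<theta> t - (\<mu> 2 t + 3 * \<theta> t) * D \<theta> t)"
  define Y where "Y = (\<lambda>t. r\<theta> a lam r \<theta> t - 3 * D \<theta> t)"
  have XY: "X \<in> BC" "Y \<in> BC" "(\<lambda>t. \<mu> 2 t + 3 * \<theta> t) \<in> BC"
  proof -
    have "X = (\<lambda>t. (lam 0)\<^sup>2 * \<mu> 2 t + lam 0 * \<mu> 1 t + \<mu> 0 t + (2 * lam 0 * \<mu> 2 t + \<mu> 1 t) * \<theta> t +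
        (a 2 + \<mu> 2 t + 3 * lam 0) * (\<theta> t)\<^sup>2 + (\<theta> t) ^ 3)"
      by (auto simp: X_def PLF_def P_def Lterm_def Fterm_def algebra_simps)
    thus "X \<in> BC" using mem by (simp only:) (intro BC_intros; simp)
    have "Y = (\<lambda>t. 2 * lam 0 * r 2 t + r 1 t + 2 * (3 * lam 0 + a 2 + r 2 t) * \<theta> t + 3 * (\<theta> t)\<^sup>2)"
      by (auto simp: Y_def r\<theta>_def)
    thus "Y \<in> BC" using mem by (simp only:) (intro BC_intros; simp)
    show "(\<lambda>t. \<mu> 2 t + 3 * \<theta> t) \<in> BC" using mem by (intro BC_intros; simp)
  qed
  obtain x y w where b: "\<And>t. norm (X t) \<le> x" "\<And>t. norm (Y t) \<le> y" "\<And>t. norm (\<mu> 2 t + 3 * \<theta> t) \<le> w"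
    using BC_D(2)[OF XY(1)] BC_D(2)[OF XY(2)] BC_D(2)[OF XY(3)] by (auto simp: bounded_iff)
  have nn: "0 \<le> x" "0 \<le> y" "0 \<le> w" using b[of 0] norm_ge_zero order_trans by blast+
  define c where "c = x + w * y + w"
  have c0: "0 \<le> c" using nn by (simp add: c_def)
  have "norm (PLF a lam \<mu> \<theta> t) \<le> c + c * norm (r\<theta> a lam r \<theta> t)" for t
  proof -
    have "3 * D \<theta> t = r\<theta> a lam r \<theta> t - Y t" by (simp add: Y_def)
    hence "norm (3 * D \<theta> t) \<le> norm (r\<theta> a lam r \<theta> t) + norm (Y t)" by (metis norm_triangle_ineq4)
    hence "3 * norm (D \<theta> t) \<le> norm (r\<theta> a lam r \<theta> t) + norm (Y t)" by (simp add: norm_mult)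
    hence d: "norm (D \<theta> t) \<le> norm (r\<theta> a lam r \<theta> t) + y"
      using b(2)[of t] norm_ge_zero[of "D \<theta> t"] by linarith
    have "norm (PLF a lam \<mu> \<theta> t) \<le> norm (X t) + norm ((\<mu> 2 t + 3 * \<theta> t) * D \<theta> t)"
      using norm_triangle_ineq[of "X t" "(\<mu> 2 t + 3 * \<theta> t) * D \<theta> t"] by (simp add: X_def)
    also have "\<dots> \<le> x + w * (norm (r\<theta> a lam r \<theta> t) + y)"
      unfolding norm_mult using b d nn by (intro add_mono mult_mono) auto
    also have "\<dots> \<le> c + c * norm (r\<theta> a lam r \<theta> t)"
    proof -
      have "0 \<le> (x + w * y) * norm (r\<theta> a lam r \<theta> t)" using nn by simp
      thus ?thesis using nn by (simp add: c_def algebra_simps)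
    qed
    finally show ?thesis .
  qed
  thus ?thesis using c0 by blast
qed

text \<open>The only information on \<open>\<theta>'\<close> at this stage is that \<open>L < 1\<close> makes the Green integrals of
  \<open>r\<^sub>\<theta>\<close>, hence those of \<open>\<theta>'\<close>, bounded.\<close>

lemma theta_regular:
  assumes r: "\<And>i. i \<in> {0,1,2} \<Longrightarrow> r i \<in> BC" and \<mu>: "\<And>i. i \<in> {0,1,2} \<Longrightarrow> \<mu> i \<in> BC"
    and \<theta>: "\<theta> \<in> AP" and sol: "solves_integral_eq lam (PLF a lam \<mu>) \<theta>" and L1: "L a lam r \<theta> 0 < 1"
  shows "D \<theta> \<in> AP" "PLF a lam \<mu> \<theta> \<in> BC"
proof -
  let ?f = "PLF a lam \<mu> \<theta>"
  have \<theta>BC: "\<theta> \<in> BC" by (rule AP_BC[OF \<theta>])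
  have int: "integrable lborel (\<lambda>s. green (gam lam i) t s * ?f s)" if "i \<in> {1,2}" for i t
    using sol that unfolding solves_integral_eq_def by blast
  have der: "(\<theta> has_vector_derivative - Gd lam ?f t) (at t)" for t by (rule solution_derivative[OF sol])
  hence D\<theta>': "D \<theta> t = - Gd lam ?f t" for t by (rule vector_derivative_at)
  hence D\<theta>: "D \<theta> = (\<lambda>t. - Gd lam ?f t)" by (rule ext)
  have cont: "continuous_on UNIV (D \<theta>)"
    unfolding D\<theta> by (intro continuous_on_minus Gd_continuous_rough int)
  have "\<exists>c\<ge>0. \<forall>t. norm (?f t) \<le> c + c * norm (r\<theta> a lam r \<theta> t)"
    by (rule PLF_derivative_bound) (rule r \<mu> \<theta>BC; assumption)+
  then obtain c where c: "c \<ge> 0" "\<And>t. norm (?f t) \<le> c + c * norm (r\<theta> a lam r \<theta> t)"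
    by blast
  define S where "S = (\<lambda>i. SUP t. Iop (of_real (alph lam i)) (r\<theta> a lam r \<theta>) t)"
  have rc: "continuous_on UNIV (r 2)" "continuous_on UNIV (r 1)" "continuous_on UNIV \<theta>"
    using r \<theta>BC by (auto simp: BC_def)
  have rm: "r\<theta> a lam r \<theta> \<in> borel_measurable borel"
    unfolding r\<theta>_def[abs_def]
    by (intro borel_measurable_continuous_onI continuous_intros cont rc)
  \<comment> \<open>The weights are positive, so finiteness of \<open>L\<close> passes to each
    supremum.\<close>
  have S_fin: "S i < \<infinity>" if i: "i \<in> {1,2}" for i
  proof -
    have "weight lam i * S i \<le> weight lam i * (S i + (SUP t. Iop (of_real (shifted lam 0 i)) (\<lambda>s. r 2 s + 3 * \<theta> s) t))"
      by (intro mult_left_mono) auto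
    also have "\<dots> \<le> L a lam r \<theta> 0"
      unfolding L_def S_def shifted_0[symmetric] using i by (intro member_le_sum) auto
    also have "\<dots> < \<infinity>" using L1 by (rule order_less_trans) simp
    finally show ?thesis using wt_pos[of i] by (auto simp: weight_eq ennreal_mult_less_top)
  qed
  have Gop_b: "\<exists>b. \<forall>t. norm (Gop (gam lam i) ?f t) \<le> b" if i: "i \<in> {1,2}" for i
  proof -
    have "ennreal (norm (Gop (gam lam i) ?f t)) \<le> ennreal (c / \<bar>alph lam i\<bar>) + ennreal c * S i" for t
    proof -
      have "ennreal (norm (Gop (gam lam i) ?f t)) \<le> (\<integral>\<^sup>+s. ennreal (norm (green (gam lam i) t s * ?f s)) \<partial>lborel)"
        unfolding Gop_def by (rule integral_norm_bound_ennreal[OF int[OF i]])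
      also have "\<dots> \<le> (\<integral>\<^sup>+s. ennreal c * ennreal (kap (alph lam i) t s) +
          ennreal c * ennreal (norm (green (of_real (alph lam i)) t s * r\<theta> a lam r \<theta> s)) \<partial>lborel)"
      proof (rule nn_integral_mono)
        fix s
        have "norm (green (gam lam i) t s * ?f s) \<le> kap (alph lam i) t s * (c + c * norm (r\<theta> a lam r \<theta> s))"
          unfolding norm_mult norm_green Re_gam by (intro mult_left_mono c) simp
        also have "\<dots> = c * kap (alph lam i) t s + c * norm (green (of_real (alph lam i)) t s * r\<theta> a lam r \<theta> s)"
          by (simp add: norm_mult norm_green algebra_simps)
        finally show "ennreal (norm (green (gam lam i) t s * ?f s)) \<le> ennreal c * ennreal (kap (alph lam i) t s) +
          ennreal c * ennreal (norm (green (of_real (alph lam i)) t s * r\<theta> a lam r \<theta> s))"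
          using c(1) by (simp add: ennreal_mult'[symmetric] ennreal_plus[symmetric] ennreal_leI del: ennreal_plus)
      qed
      also have "\<dots> = ennreal c * (\<integral>\<^sup>+s. ennreal (kap (alph lam i) t s) \<partial>lborel) +
          ennreal c * Iop (of_real (alph lam i)) (r\<theta> a lam r \<theta>) t"
        unfolding Iop_def using rm by (simp add: nn_integral_add nn_integral_cmult)
      also have "(\<integral>\<^sup>+s. ennreal (kap (alph lam i) t s) \<partial>lborel) = ennreal (1 / \<bar>alph lam i\<bar>)"
        using alph_nz[OF i] by (subst nn_integral_eq_integral) auto
      also have "ennreal c * ennreal (1 / \<bar>alph lam i\<bar>) = ennreal (c / \<bar>alph lam i\<bar>)"
        using c(1) by (simp add: ennreal_mult'[symmetric])
      also have "Iop (of_real (alph lam i)) (r\<theta> a lam r \<theta>) t \<le> S i"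
        unfolding S_def by (rule SUP_upper) simp
      finally show ?thesis by (simp add: mult_left_mono)
    qed
    moreover have "ennreal (c / \<bar>alph lam i\<bar>) + ennreal c * S i < \<infinity>"
      using S_fin[OF i] by (simp add: ennreal_mult_less_top)
    ultimately show ?thesis by (metis enn2real_mono enn2real_ennreal infinity_ennreal_def norm_ge_zero)
  qed
  obtain b1 b2 where b: "\<And>t. norm (Gop (gam lam 1) ?f t) \<le> b1" "\<And>t. norm (Gop (gam lam 2) ?f t) \<le> b2"
    using Gop_b[of 1] Gop_b[of 2] by auto
  have "norm (Gd lam ?f t) \<le> norm (gam lam 1 / Gam lam 1) * b1 + norm (gam lam 2 / Gam lam 2) * b2" for t
    unfolding Gd_def sum12
    by (rule order_trans[OF norm_triangle_ineq]) (unfold norm_mult, intro add_mono mult_left_mono b norm_ge_zero)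
  hence "norm (D \<theta> t) \<le> norm (gam lam 1 / Gam lam 1) * b1 + norm (gam lam 2 / Gam lam 2) * b2" for t
    by (simp only: D\<theta>' norm_minus_cancel)
  hence D\<theta>BC: "D \<theta> \<in> BC" by (rule BC_I[OF cont])
  note mem = \<mu>[of 0, simplified] \<mu>[of 1, simplified] \<mu>[of 2, simplified] \<theta>BC D\<theta>BC
  show fBC: "?f \<in> BC"
    unfolding PLF_def[abs_def] P_def Lterm_def Fterm_def using mem by (intro BC_intros; simp)
  \<comment> \<open>The second derivative of \<theta>, bounded because \<open>PLF\<close> now is;
    hence \<open>D \<theta>\<close> is Lipschitz, as \<open>AP_lipschitz_derivative\<close>
    demands.\<close>
  define h where "h = (\<lambda>t. - (?f t + (gam lam 1 + gam lam 2) * Gd lam ?f t - gam lam 1 * gam lam 2 * G lam ?f t))"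
  have der2: "(D \<theta> has_vector_derivative h t) (at t)" for t
    unfolding D\<theta> h_def by (intro has_vector_derivative_minus Gd_derivative fBC)
  have "h \<in> BC"
  proof -
    have eq: "h = (\<lambda>t. (gam lam 1 + gam lam 2) * D \<theta> t - ?f t - gam lam 1 * gam lam 2 * \<theta> t)"
    proof
      fix t
      have "\<theta> t = - G lam ?f t" using sol unfolding solves_integral_eq_def by blast
      thus "h t = (gam lam 1 + gam lam 2) * D \<theta> t - ?f t - gam lam 1 * gam lam 2 * \<theta> t"
        unfolding h_def D\<theta>' by (simp add: algebra_simps)
    qed
    show ?thesis unfolding eq using mem fBC by (intro BC_intros; simp)
  qed
  then obtain C where C: "\<And>t. norm (h t) \<le> C" using BC_D(2) by (auto simp: bounded_iff)
  show "D \<theta> \<in> AP"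
  proof (rule AP_lipschitz_derivative[OF \<theta>])
    show "(\<theta> has_vector_derivative D \<theta> t) (at t)" for t unfolding D\<theta>' by (rule der)
    show "norm (D \<theta> s - D \<theta> t) \<le> C * \<bar>s - t\<bar>" for s t
      by (rule vector_derivative_bounded_imp_lipschitz[OF der2 C])
  qed
qed

section \<open>Real bounds from the extended-real constants \<open>L\<close> and
  \<open>Q\<close>\<close>

lemma ennreal_Jsum:
  assumes "0 \<le> \<beta>" "\<beta> < min \<bar>alph lam 1\<bar> \<bar>alph lam 2\<bar>" "\<And>s. 0 \<le> f s"
  shows "ennreal (Jsum lam \<beta> f t) = (\<Sum>i\<in>{1,2}. weight lam i * ennreal (J (shifted lam \<beta> i) f t))"
proof -
  have J: "0 \<le> J \<alpha> f t" for \<alpha> by (intro J_nonneg assms)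
  have w: "0 \<le> wt lam i" for i using wt_pos[of i] by simp
  show ?thesis unfolding Jsum_def weight_eq sum12
    by (simp only: ennreal_plus mult_nonneg_nonneg[OF w J] ennreal_mult'[OF w])
qed

lemma Jsum_le_L:
  assumes \<beta>: "0 \<le> \<beta>" "\<beta> < min \<bar>alph lam 1\<bar> \<bar>alph lam 2\<bar>"
    and BC: "r\<theta> a lam r \<theta> \<in> BC" "(\<lambda>s. r 2 s + 3 * \<theta> s) \<in> BC"
  shows "ennreal (Jsum lam \<beta> (\<lambda>s. norm (r\<theta> a lam r \<theta> s) + norm (r 2 s + 3 * \<theta> s)) t) \<le> L a lam r \<theta> \<beta>"
proof -
  have J: "ennreal (J (shifted lam \<beta> i) (\<lambda>s. norm (r\<theta> a lam r \<theta> s) + norm (r 2 s + 3 * \<theta> s)) t)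
    = Iop (of_real (shifted lam \<beta> i)) (r\<theta> a lam r \<theta>) t + Iop (of_real (shifted lam \<beta> i)) (\<lambda>s. r 2 s + 3 * \<theta> s) t"
    if i: "i \<in> {1,2}" for i
    by (simp only: ennreal_plus J_nonneg norm_ge_zero J_add[OF shifted_nz(2)[OF \<beta> i] BC_norm[OF BC(1)] BC_norm[OF BC(2)]]
        shifted_Iop_eq[OF BC(1) \<beta> i] shifted_Iop_eq[OF BC(2) \<beta> i])
  have S: "Iop (of_real (shifted lam \<beta> i)) (r\<theta> a lam r \<theta>) t + Iop (of_real (shifted lam \<beta> i)) (\<lambda>s. r 2 s + 3 * \<theta> s) t
      \<le> (SUP t. Iop (of_real (shifted lam \<beta> i)) (r\<theta> a lam r \<theta>) t)
      + (SUP t. Iop (of_real (shifted lam \<beta> i)) (\<lambda>s. r 2 s + 3 * \<theta> s) t)" for i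
    by (intro add_mono SUP_upper UNIV_I)
  show ?thesis
    unfolding L_def
  proof (subst ennreal_Jsum[OF \<beta>])
    show "(\<Sum>i\<in>{1,2}. weight lam i * ennreal (J (shifted lam \<beta> i) (\<lambda>s. norm (r\<theta> a lam r \<theta> s) + norm (r 2 s + 3 * \<theta> s)) t))
      \<le> (\<Sum>i\<in>{1,2}. weight lam i * ((SUP t. Iop (of_real (shifted lam \<beta> i)) (r\<theta> a lam r \<theta>) t)
      + (SUP t. Iop (of_real (shifted lam \<beta> i)) (\<lambda>s. r 2 s + 3 * \<theta> s) t)))"
      using S J by (intro sum_mono mult_left_mono) simp_all
  qed simp
qed

lemma Q_properties:
  assumes BC: "(\<lambda>s. r 2 s + 3 * \<theta> s) \<in> BC"
  shows "Jsum lam 0 (\<lambda>s. (1 + 3 * norm (lam 0) + norm (a 2)) + norm (r 2 s + 3 * \<theta> s)) t \<le> Q0 a lam r \<theta>"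
    "0 < Q0 a lam r \<theta>"
proof -
  let ?q = "1 + 3 * norm (lam 0) + norm (a 2)" and ?B = "\<lambda>s. r 2 s + 3 * \<theta> s"
  have \<beta>: "(0::real) \<le> 0" "0 < min \<bar>alph lam 1\<bar> \<bar>alph lam 2\<bar>" using alph_nz[of 1] alph_nz[of 2] by auto
  have q: "?q > 0" by (simp add: add_pos_nonneg)
  obtain b where b: "\<And>s. norm (?B s) \<le> b" using BC_D(2)[OF BC] by (auto simp: bounded_iff)
  have fin: "(SUP t. Iop (of_real (shifted lam 0 i)) ?B t) < \<infinity>" if i: "i \<in> {1,2}" for i
  proof -
    have "(SUP t. Iop (of_real (shifted lam 0 i)) ?B t) \<le> ennreal (b / \<bar>alph lam i\<bar>)"
    proof (rule SUP_least)
      fix t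
      have "J (shifted lam 0 i) (\<lambda>s. norm (?B s)) t \<le> J (shifted lam 0 i) (\<lambda>s. b) t"
        using shifted_nz(2)[OF \<beta> i] by (intro J_mono BC_norm[OF BC] b) auto
      also have "\<dots> = b / \<bar>alph lam i\<bar>" using alph_nz[OF i] by (simp add: J_const)
      finally show "Iop (of_real (shifted lam 0 i)) ?B t \<le> ennreal (b / \<bar>alph lam i\<bar>)"
        unfolding shifted_Iop_eq[OF BC \<beta> i] by (rule ennreal_leI)
    qed
    thus ?thesis by (rule order_le_less_trans) simp
  qed
  \<comment> \<open>\<open>enn2real\<close> sends infinity to 0, so \<open>Q0\<close> is an upper
    bound only once \<open>Q\<close> is known to be finite.\<close>
  have Qfin: "Q a lam r \<theta> 0 < \<infinity>"
    unfolding Q_def using fin[of 1] fin[of 2] by (simp add: ennreal_mult_less_top weight_eq)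
  have J: "ennreal (J (shifted lam 0 i) (\<lambda>s. ?q + norm (?B s)) t)
      = ennreal (?q / \<bar>shifted lam 0 i\<bar>) + Iop (of_real (shifted lam 0 i)) ?B t" if i: "i \<in> {1,2}" for i t
  proof -
    have "J (shifted lam 0 i) (\<lambda>s. ?q + norm (?B s)) t = ?q / \<bar>shifted lam 0 i\<bar> + J (shifted lam 0 i) (\<lambda>s. norm (?B s)) t"
      using J_add[OF shifted_nz(2)[OF \<beta> i] _ _ BC_norm[OF BC], of "\<lambda>_. ?q" t] J_const[OF shifted_nz(2)[OF \<beta> i], of ?q t] by simp
    thus ?thesis using q unfolding shifted_Iop_eq[OF BC \<beta> i]
      by (simp add: ennreal_plus[symmetric] J_nonneg divide_nonneg_nonneg del: ennreal_plus)
  qed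
  have le: "ennreal (Jsum lam 0 (\<lambda>s. ?q + norm (?B s)) t) \<le> Q a lam r \<theta> 0" for t
    unfolding Q_def
  proof (subst ennreal_Jsum[OF \<beta>])
    show "0 \<le> ?q + norm (?B s)" for s using q by (intro add_nonneg_nonneg) auto
    have "ennreal (?q / \<bar>shifted lam 0 i\<bar>) + Iop (of_real (shifted lam 0 i)) ?B t
        \<le> ennreal (?q / \<bar>shifted lam 0 i\<bar>) + (SUP t. Iop (of_real (shifted lam 0 i)) ?B t)" for i
      by (intro add_mono SUP_upper UNIV_I order_refl)
    thus "(\<Sum>i\<in>{1,2}. weight lam i * ennreal (J (shifted lam 0 i) (\<lambda>s. ?q + norm (?B s)) t))
      \<le> (\<Sum>i\<in>{1,2}. weight lam i * (ennreal (?q / \<bar>shifted lam 0 i\<bar>) + (SUP t. Iop (of_real (shifted lam 0 i)) ?B t)))"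
      using J by (intro sum_mono mult_left_mono) (simp_all only: zero_le)
  qed
  show le': "Jsum lam 0 (\<lambda>s. ?q + norm (?B s)) t \<le> Q0 a lam r \<theta>" for t
    unfolding Q0_def
    using enn2real_mono[OF le[of t]] Qfin enn2real_ennreal[of "Jsum lam 0 (\<lambda>s. ?q + norm (?B s)) t"]
    by (cases "0 \<le> Jsum lam 0 (\<lambda>s. ?q + norm (?B s)) t") (auto intro: order_trans[OF _ enn2real_nonneg])
  have "0 < Jsum lam 0 (\<lambda>s. ?q) 0"
    unfolding Jsum_const[OF \<beta>] using q wt_pos alph_nz by (auto intro!: mult_pos_pos add_pos_pos divide_pos_pos)
  also have "\<dots> \<le> Jsum lam 0 (\<lambda>s. ?q + norm (?B s)) 0"
  proof (rule Jsum_mono[OF \<beta>])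
    show "(\<lambda>s. ?q + norm (?B s)) \<in> borel_measurable borel" using BC_norm(1)[OF BC] by measurable
    show "bounded (range (\<lambda>s. ?q + norm (?B s)))"
      using b q by (intro boundedI[of _ "?q + b"]) auto
  qed auto
  also have "\<dots> \<le> Q0 a lam r \<theta>" by (rule le')
  finally show "0 < Q0 a lam r \<theta>" .
qed

end

section \<open>The third-order equation\<close>

text \<open>Divided differences: the equations are subtracted and divided by differences of the
  roots, twice.\<close>

lemma cubic_vieta:
  fixes x0 x1 x2 b2 b1 b0 :: "'a::field"
  assumes root: "\<And>x. x \<in> {x0, x1, x2} \<Longrightarrow> x ^ 3 + b2 * x\<^sup>2 + b1 * x + b0 = 0"
    and ne: "x0 \<noteq> x1" "x0 \<noteq> x2" "x1 \<noteq> x2"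
  shows "b2 = - (x0 + x1 + x2)" "b1 = x0 * x1 + x0 * x2 + x1 * x2" "b0 = - (x0 * x1 * x2)"
proof -
  have e: "x0 ^ 3 + b2 * x0\<^sup>2 + b1 * x0 + b0 = 0" "x1 ^ 3 + b2 * x1\<^sup>2 + b1 * x1 + b0 = 0"
    "x2 ^ 3 + b2 * x2\<^sup>2 + b1 * x2 + b0 = 0"
    using root by auto
  have "(x0 - x1) * (x0\<^sup>2 + x0 * x1 + x1\<^sup>2 + b2 * (x0 + x1) + b1) = 0"
    using e(1,2) by algebra
  hence d1: "x0\<^sup>2 + x0 * x1 + x1\<^sup>2 + b2 * (x0 + x1) + b1 = 0" using ne by simp
  have "(x0 - x2) * (x0\<^sup>2 + x0 * x2 + x2\<^sup>2 + b2 * (x0 + x2) + b1) = 0"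
    using e(1,3) by algebra
  hence d2: "x0\<^sup>2 + x0 * x2 + x2\<^sup>2 + b2 * (x0 + x2) + b1 = 0" using ne by simp
  have "(x1 - x2) * (x0 + x1 + x2 + b2) = 0" using d1 d2 by algebra
  hence "x0 + x1 + x2 + b2 = 0" using ne by simp
  thus s: "b2 = - (x0 + x1 + x2)" by (rule minus_unique[symmetric])
  show s1: "b1 = x0 * x1 + x0 * x2 + x1 * x2" using d1 s by algebra
  show "b0 = - (x0 * x1 * x2)" using e(1) s s1 by algebra
qed

lemma interval_integral_derivative:
  fixes f :: "real \<Rightarrow> complex"
  assumes "continuous_on UNIV f"
  shows "((\<lambda>t. LBINT s=ereal 0..ereal t. f s) has_vector_derivative f t) (at t)"
proof -
  \<comment> \<open>A symmetric interval has both 0 and t in its interior, so t may be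
    negative.\<close>
  let ?b = "\<bar>t\<bar> + 1"
  have "((\<lambda>t. LBINT s=ereal 0..ereal t. f s) has_vector_derivative f t) (at t within {-?b..?b})"
    using interval_integral_FTC2[of "-?b" 0 ?b f t] continuous_on_subset[OF assms] by (simp add: zero_ereal_def)
  thus ?thesis
    by (rule has_vector_derivative_within_subset[of _ _ _ "{-?b..?b}" "{-?b<..<?b}", THEN has_vector_derivative_within_open[THEN iffD1, rotated 2]]) auto
qed

context green_pair
begin

text \<open>The partial fraction identity \<open>c\<close> removes \<open>f\<close> from the
  logarithmic derivative and leaves \<open>lam 0 - G lam f\<close>, which is
  \<open>lam 0 + z\<close> for a solution z. The last two exponents together are thus an
  antiderivative of z.\<close>

lemma exp_formula_derivative:
  assumes f: "f \<in> BC"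
    and y: "\<And>t. y t = exp (lam 0 * of_real t)
          * exp (- (1 / (gam lam 1 * gam lam 2)) * (LBINT s=ereal 0..ereal t. f s))
          * exp (- (\<Sum>j\<in>{1, 2}. 1 / (Gam lam j * gam lam j) * Gop (gam lam j) f t))"
  shows "(y has_vector_derivative (lam 0 - G lam f t) * y t) (at t)"
proof -
  have nz: "gam lam 1 \<noteq> 0" "gam lam 2 \<noteq> 0" using Re_gam_nz[of 1] Re_gam_nz[of 2] by auto
  define E where "E = (\<lambda>t. lam 0 * of_real t - (1 / (gam lam 1 * gam lam 2)) * (LBINT s=ereal 0..ereal t. f s)
     - (1 / (Gam lam 1 * gam lam 1) * Gop (gam lam 1) f t + 1 / (Gam lam 2 * gam lam 2) * Gop (gam lam 2) f t))"
  have yE: "y = (\<lambda>t. exp (E t))"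
  proof
    fix t
    have "E t = lam 0 * of_real t + - (1 / (gam lam 1 * gam lam 2)) * (LBINT s=ereal 0..ereal t. f s)
       + - (\<Sum>j\<in>{1, 2}. 1 / (Gam lam j * gam lam j) * Gop (gam lam j) f t)"
      by (simp add: E_def)
    thus "y t = exp (E t)" by (simp only: y exp_add)
  qed
  let ?e = "lam 0 * 1 - (1 / (gam lam 1 * gam lam 2)) * f t
     - (1 / (Gam lam 1 * gam lam 1) * (f t + gam lam 1 * Gop (gam lam 1) f t)
       + 1 / (Gam lam 2 * gam lam 2) * (f t + gam lam 2 * Gop (gam lam 2) f t))"
  have o: "((\<lambda>t. complex_of_real t) has_vector_derivative 1) (at t)"
    by (auto intro!: derivative_eq_intros)
  have dE: "(E has_vector_derivative ?e) (at t)"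
    unfolding E_def
    by (intro has_vector_derivative_diff has_vector_derivative_add has_vector_derivative_mult_right o
        interval_integral_derivative BC_D(1)[OF f] Gop_gam_derivative[OF f]) auto
  have Gam: "Gam lam 1 = gam lam 1 - gam lam 2" "Gam lam 2 = - (gam lam 1 - gam lam 2)"
    by (simp_all add: Gam_def gam_def)
  have ne: "gam lam 1 - gam lam 2 \<noteq> 0" using lam_diff_nz by (simp add: gam_def)
  have "?e = lam 0 - G lam f t"
  proof -
    have c: "1 / (gam lam 1 * gam lam 2) + 1 / (Gam lam 1 * gam lam 1) + 1 / (Gam lam 2 * gam lam 2) = 0"
      unfolding Gam using nz ne by (simp add: divide_simps)
    have "1 / (Gam lam i * gam lam i) * (f t + gam lam i * Gop (gam lam i) f t) =
       1 / (Gam lam i * gam lam i) * f t + 1 / Gam lam i * Gop (gam lam i) f t" if "i \<in> {1,2}" for i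
      using nz that by (auto simp: distrib_left)
    hence "?e = lam 0 - (1 / (gam lam 1 * gam lam 2) + 1 / (Gam lam 1 * gam lam 1) + 1 / (Gam lam 2 * gam lam 2)) * f t - G lam f t"
      unfolding G_def sum12 by (simp add: algebra_simps)
    thus ?thesis by (simp only: c) simp
  qed
  hence "(E has_vector_derivative (lam 0 - G lam f t)) (at t)" using dE by (simp only:)
  moreover have "(exp has_field_derivative exp (E t)) (at (E t))" by (rule DERIV_exp)
  ultimately have "((exp \<circ> E) has_vector_derivative (lam 0 - G lam f t) * exp (E t)) (at t)"
    by (rule field_vector_diff_chain_at)
  thus ?thesis by (simp add: yE o_def)
qed

text \<open>After factoring out y the equation reads \<open>z'' - (\<gamma>1 + \<gamma>2) z' +
  \<gamma>1 \<gamma>2 z + PLF = 0\<close>, which is \<open>Gd_derivative\<close> for z = -G[PLF].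
  The linear coefficients match because \<open>a 2 + 3 * lam 0\<close> is
  \<open>- (\<gamma>1 + \<gamma>2)\<close> and the characteristic polynomial has derivative
  \<open>\<gamma>1 \<gamma>2\<close> at \<open>lam 0\<close>.\<close>

lemma solves_E3_of_reduction:
  assumes a: "a 2 = - (lam 0 + lam 1 + lam 2)" "a 1 = lam 0 * lam 1 + lam 0 * lam 2 + lam 1 * lam 2"
      "a 0 = - (lam 0 * lam 1 * lam 2)"
    and f: "PLF a lam r z \<in> BC" and z: "\<And>t. z t = - G lam (PLF a lam r z) t"
    and y: "\<And>t. (y has_vector_derivative (lam 0 + z t) * y t) (at t)"
  shows "solves_E3 a r y"
proof -
  let ?f = "PLF a lam r z"
  have dz: "(z has_vector_derivative - Gd lam ?f t) (at t)" for t
  proof -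
    have "z = (\<lambda>t. - G lam ?f t)" using z by (rule ext)
    thus ?thesis using has_vector_derivative_minus[OF G_derivative[OF f]] by metis
  qed
  have Dz: "D z t = - Gd lam ?f t" for t by (rule vector_derivative_at[OF dz])
  define z2 where "z2 = (\<lambda>t. - (?f t + (gam lam 1 + gam lam 2) * Gd lam ?f t - gam lam 1 * gam lam 2 * G lam ?f t))"
  have dz2: "((\<lambda>t. D z t) has_vector_derivative z2 t) (at t)" for t
    unfolding Dz z2_def by (intro has_vector_derivative_minus Gd_derivative f)
  have dz': "(z has_vector_derivative D z t) (at t)" for t unfolding Dz by (rule dz)
  have lz: "((\<lambda>t. lam 0 + z t) has_vector_derivative D z t) (at t)" for t
    using has_vector_derivative_add[OF has_vector_derivative_const[of "lam 0"] dz'] by simp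
  have Dy: "D y = (\<lambda>t. (lam 0 + z t) * y t)" using vector_derivative_at[OF y] by blast
  let ?y2 = "\<lambda>t. (lam 0 + z t) * ((lam 0 + z t) * y t) + D z t * y t"
  have dy2: "((\<lambda>t. (lam 0 + z t) * y t) has_vector_derivative ?y2 t) (at t)" for t
    by (rule has_vector_derivative_mult[OF lz y])
  have DDy: "D (D y) = ?y2" unfolding Dy using vector_derivative_at[OF dy2] by blast
  let ?y3 = "\<lambda>t. ((lam 0 + z t) * ?y2 t + D z t * ((lam 0 + z t) * y t)) + (D z t * ((lam 0 + z t) * y t) + z2 t * y t)"
  have dy3: "(?y2 has_vector_derivative ?y3 t) (at t)" for t
    by (intro has_vector_derivative_add has_vector_derivative_mult lz y dz2 dy2)
  have DDDy: "D (D (D y)) = ?y3" unfolding DDy using vector_derivative_at[OF dy3] by blast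
  have "?y3 t + (a 2 + r 2 t) * ?y2 t + (a 1 + r 1 t) * ((lam 0 + z t) * y t) + (a 0 + r 0 t) * y t = 0" for t
  proof -
    have z2: "z2 t = - ?f t + (gam lam 1 + gam lam 2) * D z t - gam lam 1 * gam lam 2 * z t"
      unfolding z2_def Dz using z[of t] by (simp add: algebra_simps)
    define w x where "w = D z t" and "x = z t"
    show ?thesis
      unfolding z2 a gam_def PLF_def P_def Lterm_def Fterm_def w_def[symmetric] x_def[symmetric]
      by (simp add: algebra_simps power2_eq_square power3_eq_cube)
  qed
  hence "D (D (D y)) t + (a 2 + r 2 t) * D (D y) t + (a 1 + r 1 t) * D y t + (a 0 + r 0 t) * y t = 0" for t
    using fun_cong[OF DDDy, of t] fun_cong[OF DDy, of t] fun_cong[OF Dy, of t] by (simp only:)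
  moreover have "y differentiable (at t)" "D y differentiable (at t)" for t
    unfolding Dy using y dy2 by (blast intro: differentiableI_vector)+
  moreover have "D (D y) differentiable (at t)" for t
    unfolding DDy using dy3 by (rule differentiableI_vector)
  ultimately show ?thesis unfolding solves_E3_def by blast
qed

end

lemma enn2real_less_one: "x < 1 \<Longrightarrow> enn2real x < 1"
  by (cases x) (auto simp: ennreal_less_one_iff)

theorem theorem3p7:
  fixes a lam :: "nat \<Rightarrow> complex"
    and r \<mu> \<nu> :: "nat \<Rightarrow> real \<Rightarrow> complex"
    and \<theta> :: "real \<Rightarrow> complex"
    and p :: real
    and N N1 :: "(real \<Rightarrow> complex) set"
  assumes roots: "{x. x ^ 3 + a 2 * x\<^sup>2 + a 1 * x + a 0 = 0} = {lam 0, lam 1, lam 2}"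
    and distinct_Re: "Re (lam 0) \<noteq> Re (lam 1)" "Re (lam 0) \<noteq> Re (lam 2)" "Re (lam 1) \<noteq> Re (lam 2)"
    and p: "p \<ge> 1"
    and spaces: "(N, N1) \<in> {(BC0, with_deriv BC0), (C00, with_deriv C00), (Lp0 p, Lp0 p), (Lp p, Lp p)}"
    and r: "\<forall>i\<in>{0, 1, 2}. r i \<in> AP_plus N \<and> \<mu> i \<in> AP \<and> \<nu> i \<in> N \<and> r i = (\<lambda>t. \<mu> i t + \<nu> i t)"
    and \<theta>: "\<theta> \<in> AP" "solves_integral_eq lam (PLF a lam \<mu>) \<theta>"
    and L_less_1: "L a lam r \<theta> 0 < 1"
    and small: "supnorm (G lam (P\<theta> lam \<nu> \<theta>)) + supnorm (D (G lam (P\<theta> lam \<nu> \<theta>)))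
      \<le> ennreal (M a lam r \<theta> * (2 / 3 * (1 - L0 a lam r \<theta>) - Q0 a lam r \<theta> * M a lam r \<theta>))"
  shows "\<exists>y z \<psi>.
    solves_E3 a r y \<and>
    (\<forall>t. y t = exp (lam 0 * of_real t)
          * exp (- (1 / (gam lam 1 * gam lam 2)) * (LBINT s=ereal 0..ereal t. PLF a lam r z s))
          * exp (- (\<Sum>j\<in>{1, 2}. 1 / (Gam lam j * gam lam j) * Gop (gam lam j) (PLF a lam r z) t))) \<and>
    z = (\<lambda>t. \<theta> t + \<psi> t) \<and>
    solves_integral_eq lam (PLF a lam r) z \<and>
    z \<in> AP_plus N \<and> D z \<in> AP_plus N \<and>
    \<psi> \<in> N1 \<and>
    solves_integral_eq lam (Npsi a lam r \<nu> \<theta>) \<psi> \<and>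
    (\<forall>\<beta>. 0 < \<beta> \<and> \<beta> < min \<bar>alph lam 1\<bar> \<bar>alph lam 2\<bar> \<and> L a lam r \<theta> \<beta> < 1 / 2 \<longrightarrow>
       dominated_by \<psi> (\<lambda>t. Iop (of_real \<beta>) (P\<theta> lam \<nu> \<theta>) t + Iop (of_real (- \<beta>)) (P\<theta> lam \<nu> \<theta>) t) \<and>
       dominated_by (D \<psi>) (\<lambda>t. Iop (of_real \<beta>) (P\<theta> lam \<nu> \<theta>) t + Iop (of_real (- \<beta>)) (P\<theta> lam \<nu> \<theta>) t))"
proof -
  interpret green_pair lam by unfold_locales (fact distinct_Re)+
  have N: "N \<in> {BC0, C00, Lp0 p, Lp p}" using spaces by auto
  have rBC: "r i \<in> BC" and \<mu>BC: "\<mu> i \<in> BC" and \<nu>N: "\<nu> i \<in> N" and req: "r i t = \<mu> i t + \<nu> i t"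
    if "i \<in> {0, 1, 2}" for i t
    using r that AP_BC by (auto simp: AP_plus_def fun_eq_iff)
  have \<nu>BC: "\<nu> i \<in> BC" if "i \<in> {0, 1, 2}" for i
  proof -
    have "\<nu> i = (\<lambda>t. r i t - \<mu> i t)" using req[OF that] by auto
    thus ?thesis using BC_diff[OF rBC[OF that] \<mu>BC[OF that]] by simp
  qed
  have \<theta>BC: "\<theta> \<in> BC" by (rule AP_BC[OF \<theta>(1)])
  have D\<theta>AP: "D \<theta> \<in> AP" and PLF\<theta>: "PLF a lam \<mu> \<theta> \<in> BC"
    by (rule theta_regular[where r = r and \<mu> = \<mu>, OF rBC \<mu>BC \<theta> L_less_1]; assumption)+
  have D\<theta>BC: "D \<theta> \<in> BC" by (rule AP_BC[OF D\<theta>AP])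
  note mem = rBC[of 0, simplified] rBC[of 1, simplified] rBC[of 2, simplified]
    \<nu>BC[of 0, simplified] \<nu>BC[of 1, simplified] \<nu>BC[of 2, simplified] \<theta>BC D\<theta>BC
  let ?f0 = "P\<theta> lam \<nu> \<theta>" and ?A = "r\<theta> a lam r \<theta>" and ?B = "\<lambda>s. r 2 s + 3 * \<theta> s" and ?k = "3 * lam 0 + a 2"
  let ?L = "L0 a lam r \<theta>" and ?Q = "Q0 a lam r \<theta>" and ?M = "M a lam r \<theta>"
  have BC: "?f0 \<in> BC" "?A \<in> BC" "?B \<in> BC"
    unfolding P\<theta>_def[abs_def] r\<theta>_def[abs_def] using mem by (intro BC_intros; simp)+
  have f0N: "?f0 \<in> N"
  proof -
    \<comment> \<open>Every term of \<open>P\<theta>\<close> carries a factor \<nu>, with bounded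
      continuous coefficients now that \<theta>' is bounded.\<close>
    have eq: "?f0 = (\<lambda>t. ((lam 0)\<^sup>2 + 2 * lam 0 * \<theta> t + D \<theta> t + (\<theta> t)\<^sup>2) * \<nu> 2 t + (lam 0 + \<theta> t) * \<nu> 1 t + 1 * \<nu> 0 t)"
      by (auto simp: P\<theta>_def algebra_simps)
    have c: "(\<lambda>t. (lam 0)\<^sup>2 + 2 * lam 0 * \<theta> t + D \<theta> t + (\<theta> t)\<^sup>2) \<in> BC" "(\<lambda>t. lam 0 + \<theta> t) \<in> BC" "(\<lambda>t. 1) \<in> BC"
      using mem by (intro BC_intros; simp)+
    show ?thesis unfolding eq
      by (intro class_add[OF N p] class_mult[OF N p] c \<nu>N BC_add BC_mult \<nu>BC) auto
  qed
  have \<beta>0: "(0::real) \<le> 0" "0 < min \<bar>alph lam 1\<bar> \<bar>alph lam 2\<bar>" using alph_nz[of 1] alph_nz[of 2] by auto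
  have Lfin: "Jsum lam \<beta> (\<lambda>s. norm (?A s) + norm (?B s)) t \<le> enn2real (L a lam r \<theta> \<beta>)"
    if "0 \<le> \<beta>" "\<beta> < min \<bar>alph lam 1\<bar> \<bar>alph lam 2\<bar>" "L a lam r \<theta> \<beta> < 1" for \<beta> t
  proof -
    have "L a lam r \<theta> \<beta> < top" using that(3) by (rule order_less_trans) simp
    hence "enn2real (ennreal (Jsum lam \<beta> (\<lambda>s. norm (?A s) + norm (?B s)) t)) \<le> enn2real (L a lam r \<theta> \<beta>)"
      by (intro enn2real_mono Jsum_le_L that BC)
    thus ?thesis by (cases "0 \<le> Jsum lam \<beta> (\<lambda>s. norm (?A s) + norm (?B s)) t")
        (auto intro: order_trans[OF _ enn2real_nonneg])
  qed
  have L1: "?L < 1"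
    unfolding L0_def using L_less_1 by (rule enn2real_less_one)
  note Q = Q_properties[where a = a and r = r and \<theta> = \<theta>, OF BC(3)]
  have Mpos: "?M > 0" unfolding M_def using L1 Q(2) by simp
  have Meq: "1 - ?L = 9 * ?Q * ?M\<^sup>2 + 6 * ?Q * ?M"
  proof -
    have "(3 * ?M + 1)\<^sup>2 = 1 + (1 - ?L) / ?Q"
    proof -
      have "3 * ?M + 1 = sqrt (1 + (1 - ?L) / ?Q)" by (simp add: M_def diff_divide_distrib)
      moreover have "0 \<le> 1 + (1 - ?L) / ?Q" using L1 Q(2) by (intro add_nonneg_nonneg) auto
      ultimately show ?thesis by (simp only: real_sqrt_pow2)
    qed
    hence "?Q * (9 * ?M\<^sup>2 + 6 * ?M) = 1 - ?L" using Q(2) by (simp add: power2_eq_square field_simps)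
    thus ?thesis by (simp add: algebra_simps)
  qed
  let ?X = "?M * (2 / 3 * (1 - ?L) - ?Q * ?M)"
  \<comment> \<open>\<open>ennreal\<close> truncates negative numbers to 0, so \<open>small\<close>
    yields a real bound by \<open>?X\<close> only once \<open>?X\<close> is known to be
    nonnegative.\<close>
  have X: "0 \<le> ?X"
  proof -
    have "0 \<le> 6 * ?Q * ?M\<^sup>2 + 3 * ?Q * ?M" using Q(2) Mpos by simp
    hence "0 \<le> 2 / 3 * (1 - ?L) - ?Q * ?M" unfolding Meq by (simp add: algebra_simps)
    thus ?thesis using Mpos by simp
  qed
  have DG: "D (G lam ?f0) t = Gd lam ?f0 t" for t
    by (rule vector_derivative_at[OF G_derivative[OF BC(1)]])
  have sup: "norm (g t) \<le> supnorm g" for g t unfolding supnorm_def by (rule SUP_upper) simp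
  have small': "norm (G lam ?f0 t) \<le> ?X" "norm (Gd lam ?f0 t) \<le> ?X" for t
  proof -
    have "ennreal (norm (G lam ?f0 t)) \<le> ennreal ?X"
      using sup[of "G lam ?f0" t] small by (meson add_increasing2 order_trans zero_le)
    thus "norm (G lam ?f0 t) \<le> ?X" using X by simp
    have "ennreal (norm (D (G lam ?f0) t)) \<le> ennreal ?X"
      using sup[of "D (G lam ?f0)" t] small by (meson add_increasing order_trans zero_le)
    thus "norm (Gd lam ?f0 t) \<le> ?X" using X by (simp add: DG)
  qed
  interpret small_nonlinearity lam ?f0 ?A ?B ?k "1 + 3 * norm (lam 0) + norm (a 2)" ?L ?Q ?M
  proof
    show "1 + norm ?k \<le> 1 + 3 * norm (lam 0) + norm (a 2)"
      using norm_triangle_ineq[of "3 * lam 0" "a 2"] by (simp add: norm_mult)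
    show "Jsum lam 0 (\<lambda>s. norm (?A s) + norm (?B s)) t \<le> ?L" for t
      unfolding L0_def by (rule Lfin[OF \<beta>0 L_less_1])
  qed (fact BC Q Mpos Meq small')+
  obtain u v where uv: "u \<in> BC" "v \<in> BC" "\<And>t. norm (u t) \<le> ?M" "\<And>t. norm (v t) \<le> ?M"
    and ueq: "\<And>t. u t = - G lam (nl ?f0 ?A ?B ?k u v) t" and veq: "\<And>t. v t = - Gd lam (nl ?f0 ?A ?B ?k u v) t"
    using fixed_point by blast
  let ?n = "nl ?f0 ?A ?B ?k u v"
  have nBC: "?n \<in> BC" by (intro BC_nl BC uv)
  \<comment> \<open>Here the independent unknown \<open>v\<close> is identified as the derivative of
    \<open>u\<close>, because \<open>Gd\<close> differentiates \<open>G\<close>.\<close>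
  have ud: "(u has_vector_derivative v t) (at t)" for t
  proof -
    have "u = (\<lambda>t. - G lam ?n t)" using ueq by (rule ext)
    thus ?thesis using has_vector_derivative_minus[OF G_derivative[OF nBC]] veq by metis
  qed
  hence Du': "D u t = v t" for t by (rule vector_derivative_at)
  hence Du: "D u = v" by (rule ext)
  have Npsi: "Npsi a lam r \<nu> \<theta> u = ?n"
    by (auto simp: Npsi_def nl_def Du' algebra_simps)
  have sol_u: "solves_integral_eq lam (Npsi a lam r \<nu> \<theta>) u"
    unfolding solves_integral_eq_def Npsi
    using ud ueq integrable_gam[OF nBC] by (auto intro: differentiableI_vector)
  define z where "z = (\<lambda>t. \<theta> t + u t)"
  have \<theta>d: "(\<theta> has_vector_derivative D \<theta> t) (at t)" for t
    using \<theta>(2) unfolding solves_integral_eq_def using vector_derivative_works by blast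
  have zd: "(z has_vector_derivative D \<theta> t + v t) (at t)" for t
    unfolding z_def by (intro has_vector_derivative_add \<theta>d ud)
  hence Dz': "D z t = D \<theta> t + v t" for t by (rule vector_derivative_at)
  hence Dz: "D z = (\<lambda>t. D \<theta> t + v t)" by (rule ext)
  \<comment> \<open>The cross terms of \<open>3 * z * z'\<close> are split:
    \<open>3 * \<theta>' * u\<close> belongs to \<open>r\<theta>\<close>,
    \<open>3 * \<theta> * v\<close> to \<open>?B\<close>. The terms free of u and v are
    \<open>PLF a lam \<mu> \<theta>\<close> and \<open>P\<theta>\<close>.\<close>
  have PLFz: "PLF a lam r z t = PLF a lam \<mu> \<theta> t + ?n t" for t
  proof -
    have "z t = \<theta> t + u t" by (simp add: z_def)
    moreover have "r 0 t = \<mu> 0 t + \<nu> 0 t" "r 1 t = \<mu> 1 t + \<nu> 1 t" "r 2 t = \<mu> 2 t + \<nu> 2 t"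
      by (rule req; simp)+
    ultimately show ?thesis
      unfolding PLF_def P_def Lterm_def Fterm_def nl_def P\<theta>_def r\<theta>_def Dz'
      by (simp add: algebra_simps power2_eq_square power3_eq_cube)
  qed
  have PLFzBC: "PLF a lam r z \<in> BC"
    using BC_add[OF PLF\<theta> nBC] by (simp add: PLFz[abs_def])
  have zeq: "z t = - G lam (PLF a lam r z) t" for t
  proof -
    have "\<theta> t = - G lam (PLF a lam \<mu> \<theta>) t" using \<theta>(2) unfolding solves_integral_eq_def by blast
    moreover have "(\<lambda>t. PLF a lam r z t - PLF a lam \<mu> \<theta> t) = ?n" by (simp add: PLFz)
    hence "G lam ?n t = G lam (PLF a lam r z) t - G lam (PLF a lam \<mu> \<theta>) t"
      using G_diff(1)[OF PLFzBC PLF\<theta>] by metis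
    ultimately show ?thesis using ueq[of t] by (simp add: z_def)
  qed
  have sol_z: "solves_integral_eq lam (PLF a lam r) z"
    unfolding solves_integral_eq_def
    using zd zeq integrable_gam[OF PLFzBC] by (auto intro: differentiableI_vector)
  define y where "y = (\<lambda>t. exp (lam 0 * of_real t)
          * exp (- (1 / (gam lam 1 * gam lam 2)) * (LBINT s=ereal 0..ereal t. PLF a lam r z s))
          * exp (- (\<Sum>j\<in>{1, 2}. 1 / (Gam lam j * gam lam j) * Gop (gam lam j) (PLF a lam r z) t)))"
  have yd: "(y has_vector_derivative (lam 0 + z t) * y t) (at t)" for t
    using exp_formula_derivative[OF PLFzBC, of y t] zeq[of t] by (simp add: y_def)
  have ne: "lam 0 \<noteq> lam 1" "lam 0 \<noteq> lam 2" "lam 1 \<noteq> lam 2" using distinct_Re by auto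
  have "solves_E3 a r y"
  proof (rule solves_E3_of_reduction[OF _ _ _ PLFzBC zeq yd])
    have root: "x ^ 3 + a 2 * x\<^sup>2 + a 1 * x + a 0 = 0" if "x \<in> {lam 0, lam 1, lam 2}" for x
      using that roots by blast
    show "a 2 = - (lam 0 + lam 1 + lam 2)" "a 1 = lam 0 * lam 1 + lam 0 * lam 2 + lam 1 * lam 2"
      "a 0 = - (lam 0 * lam 1 * lam 2)"
      by (rule cubic_vieta[OF root ne]; assumption)+
  qed
  obtain \<epsilon> C where \<epsilon>: "0 < \<epsilon>" "0 \<le> C" "\<And>t. max (norm (u t)) (norm (v t)) \<le> C * conv \<epsilon> (\<lambda>s. norm (?f0 s)) t"
    using dominated_by_some_conv[OF uv ueq veq] by blast
  have uN: "u \<in> N" "v \<in> N"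
    by (rule class_conv[OF N p f0N BC(1) \<epsilon>(1,2)], use uv \<epsilon>(3) in auto)+
  \<comment> \<open>The classes \<open>with_deriv BC0\<close> and \<open>with_deriv C00\<close> also
    require the derivative to lie in N, which is \<open>v \<in> N\<close>.\<close>
  have "u \<in> N1"
    using spaces uN ud by (auto simp: with_deriv_def Du intro: differentiableI_vector)
  moreover have "z \<in> AP_plus N" "D z \<in> AP_plus N"
    unfolding AP_plus_def z_def[symmetric] Dz
    using BC_add[OF \<theta>BC uv(1)] BC_add[OF D\<theta>BC uv(2)] \<theta>(1) D\<theta>AP uN by (auto simp: z_def)
  moreover have "dominated_by u (\<lambda>t. Iop (of_real \<beta>) ?f0 t + Iop (of_real (- \<beta>)) ?f0 t) \<and>
       dominated_by (D u) (\<lambda>t. Iop (of_real \<beta>) ?f0 t + Iop (of_real (- \<beta>)) ?f0 t)"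
    if \<beta>: "0 < \<beta>" "\<beta> < min \<bar>alph lam 1\<bar> \<bar>alph lam 2\<bar>" "L a lam r \<theta> \<beta> < 1 / 2" for \<beta>
  proof -
    have "(1 / 2 :: ennreal) \<le> 1" by (simp add: divide_le_posI_ennreal)
    hence L1: "L a lam r \<theta> \<beta> < 1" using \<beta>(3) by order
    hence "enn2real (L a lam r \<theta> \<beta>) < 1" by (rule enn2real_less_one)
    then obtain C where C: "C \<ge> 0" "\<And>t. max (norm (u t)) (norm (v t)) \<le> C * conv \<beta> (\<lambda>s. norm (?f0 s)) t"
      using dominated_by_conv[OF uv ueq veq \<beta>(1,2) Lfin[OF _ \<beta>(2) L1]] \<beta>(1) by auto
    have I: "Iop (of_real \<beta>) ?f0 t + Iop (of_real (- \<beta>)) ?f0 t = ennreal (conv \<beta> (\<lambda>s. norm (?f0 s)) t)" for t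
      using Iop_eq_J[of "of_real \<beta>" ?f0 t] Iop_eq_J[of "of_real (- \<beta>)" ?f0 t] \<beta>(1) BC_D[OF BC(1)]
        conv_eq_J[OF \<beta>(1) BC_norm[OF BC(1)], of t] by (simp add: J_nonneg)
    have "ennreal (norm (u t)) \<le> ennreal C * ennreal (conv \<beta> (\<lambda>s. norm (?f0 s)) t)"
      "ennreal (norm (v t)) \<le> ennreal C * ennreal (conv \<beta> (\<lambda>s. norm (?f0 s)) t)" for t
      using C(2)[of t] C(1) by (auto simp: ennreal_mult'[symmetric] intro!: ennreal_leI)
    thus ?thesis unfolding dominated_by_def I Du by blast
  qed
  ultimately show ?thesis
    using \<open>solves_E3 a r y\<close> sol_z sol_u
    by (intro exI[of _ y] exI[of _ z] exI[of _ u]) (auto simp: y_def z_def)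
qed

end
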